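(* Let $P,Q,R$ and $P_{mn}$ be quantum programs and $K,L,M,N$ binary measurements. Then: (1) (Reduction) If $(N]\equiv(K]\vartriangleleft M\vartriangleright(L]$ and $[N)\equiv[K)\vartriangleleft M\vartriangleright[L)$, then $$(P\vartriangleleft K\vartriangleright Q)\vartriangleleft M\vartriangleright(P\vartriangleleft L\vartriangleright Q)\equiv P\vartriangleleft N\vartriangleright Q .$$ For measurement in the computational basis: if $\bar q\cap\bar r=\emptyset$, then $$\mathbf{if}\,[\bar q](\square m\to\mathbf{if}\,[\bar r](\square n\to P_{mn})\,\mathbf{fi})\,\mathbf{fi}\equiv\mathbf{if}\,[\bar q,\bar r](\square(m,n)\to P_{mn})\,\mathbf{fi}.$$ (2) (Left-Distributivity) If $M\diamond_LN$ and $[N)\equiv[M];[N)$, then $$R\vartriangleleft N\vartriangleright(P\vartriangleleft M\vartriangleright Q)\equiv(R\vartriangleleft N\vartriangleright P)\vartriangleleft M\vartriangleright(R\vartriangleleft N\vartriangleright Q).$$ (3) (Right-Distributivity) If $M\diamond_RN$ and $(N]\equiv[M];(N]$, then $$(P\vartriangleleft M\vartriangleright Q)\vartriangleleft N\vartriangleright R\equiv(P\vartriangleleft N\vartriangleright R)\vartriangleleft M\vartriangleright(Q\vartriangleleft N\vartriangleright R).$$ (4) (Left-Distributivity for Projection) If $M,N$ are projective measurements and $M\blacktriangleright N$ or $M^\bot\blacktriangleright N$, then $$R\vartriangleleft N\vartriangleright(P\vartriangleleft M\vartriangleright Q)\equiv(R\vartriangleleft N\vartriangleright P)\vartriangleleft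 M\vartriangleright(R\vartriangleleft N\vartriangleright Q).$$ (5) (Right-Distributivity for Projection) If $M,N$ are projective measurements and $N\blacktriangleright M$ or $N\blacktriangleright M^\bot$, then $$(P\vartriangleleft M\vartriangleright Q)\vartriangleleft N\vartriangleright R\equiv(P\vartriangleleft N\vartriangleright R)\vartriangleleft M\vartriangleright(Q\vartriangleleft N\vartriangleright R).$$
   Context: A set $QV$ of quantum variables is given; each quantum variable $q$ has a Hilbert space $\mathcal H_q$; a register $\bar q$ is a sequence $q_1,\dots,q_n$ of distinct variables (identified with its set) with space $\mathcal H_{\bar q}=\bigotimes_i\mathcal H_{q_i}$; $\bar q,\bar r$ denotes concatenation. $\mathcal H_{QV}$ is the state space of the composite system of all variables in $QV$; operators on $\mathcal H_{\bar q}$ are identified with their extensions by the identity. $\mathcal D(\mathcal H_{QV})$ is the set of partial density operators (positive operators of trace $\le1$) on $\mathcal H_{QV}$. Circuits: $C::=\mathbf{skip}\mid U[\bar q]\mid C_1;C_2\mid \mathbf{qif}\,[\bar q](\square_{i=1}^d|\psi_i\rangle\to C_i)\,\mathbf{fiq}$ ($U$ a unitary constant from a given set, $\{|\psi_i\rangle\}$ an orthonormal basis of $\mathcal H_{\bar q}$, $\bar q$ disjoint from the variables of all $C_i$), with unitary semantics $I$, $U_{\bar q}$, $[\![C_2]\!][\![C_1]\!]$, $\sum_i|\psi_i\rangle_{\bar q}\langle\psi_i|\otimes[\![C_i]\!]$. A measurement on $\bar q$ is a family $M=\{M_m\}$ of linear operators with $\sum_mM_m^\dagger M_m=I$; binary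 if the outcomes are $0,1$; projective if the $M_m$ are mutually orthogonal projections. Programs: $P::=\mathbf{skip}\mid\mathbf{abort}\mid\bar q:=|\psi\rangle\mid C\mid P_1;P_2\mid\mathbf{if}\,M[\bar q](\square m\to P_m)\,\mathbf{fi}\mid\mathbf{while}\,M[\bar q]=1\,\mathbf{do}\,P\,\mathbf{od}$ ($M$ binary in loops). Semantics on $\mathcal D(\mathcal H_{QV})$: $[\![\mathbf{skip}]\!](\rho)=\rho$; $[\![\mathbf{abort}]\!](\rho)=0$; $[\![\bar q:=|\psi\rangle]\!](\rho)=\sum_n|\psi\rangle_{\bar q}\langle n|\rho|n\rangle_{\bar q}\langle\psi|$ ($\{|n\rangle\}$ an orthonormal basis of $\mathcal H_{\bar q}$); $[\![C]\!](\rho)=[\![C]\!]\rho[\![C]\!]^\dagger$; $[\![P_1;P_2]\!]=[\![P_2]\!]\circ[\![P_1]\!]$; $[\![\mathbf{if}\,M[\bar q](\square m\to P_m)\,\mathbf{fi}]\!](\rho)=\sum_m[\![P_m]\!](M_m\rho M_m^\dagger)$; $[\![\mathbf{while}\,M[\bar q]=1\,\mathbf{do}\,P\,\mathbf{od}]\!]=\sum_{n\ge0}\mathcal E_0\circ([\![P]\!]\circ\mathcal E_1)^n$, $\mathcal E_i(\rho)=M_i\rho M_i^\dagger$. $P\equiv Q$ iff $[\![P]\!]=[\![Q]\!]$. $\mathbf{if}\,[\bar q](\cdots)\,\mathbf{fi}$ without $M$ uses the computational-basis measurement of qubits. Notation, for binary $M=\{M_0,M_1\}$ (measured register omitted): $P_0\vartriangleleft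 M\vartriangleright P_1$ is the if-statement executing $P_0$ on outcome $0$ and $P_1$ on outcome $1$; $[M]$ abbreviates $\mathbf{skip}\vartriangleleft M\vartriangleright\mathbf{skip}$; $(M]$ abbreviates $\mathbf{abort}\vartriangleleft M\vartriangleright\mathbf{skip}$; $[M)$ abbreviates $\mathbf{skip}\vartriangleleft M\vartriangleright\mathbf{abort}$. $M^\bot$ has $(M^\bot)_0=M_1$, $(M^\bot)_1=M_0$. $M\blacktriangleright N$ iff $N_0M_1=0$. $M\diamond_LN$ iff $M_0N_1=N_1M_0$ and $M_1N_1=N_1M_1$; $M\diamond_RN$ iff $M_0N_0=N_0M_0$ and $M_1N_0=N_0M_1$. *)

theory Defs
  imports "HOL-Analysis.Analysis"
begin

text \<open>
  A Hilbert space, of arbitrary dimension, is given in coordinates with respect to an orthonormal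
  basis indexed by a set X: it is the space of square-summable complex families on X.
  Vectors are total functions vanishing outside X, and operators are total functions on families
  vanishing outside \<^term>\<open>ell2 X\<close>. With these conventions HOL equality of operators is equality
  as operators on the Hilbert space, and their product is function composition.
\<close>

type_synonym 'x vec = "'x \<Rightarrow> complex"
type_synonym 'x oper = "'x vec \<Rightarrow> 'x vec"

definition ell2 :: "'x set \<Rightarrow> 'x vec set" where
  "ell2 X = {f. (\<forall>x. x \<notin> X \<longrightarrow> f x = 0) \<and> (\<lambda>x. (cmod (f x))\<^sup>2) summable_on UNIV}"

definition cinner :: "'x vec \<Rightarrow> 'x vec \<Rightarrow> complex" where
  "cinner f g = (\<Sum>\<^sub>\<infinity>x. cnj (f x) * g x)"

definition l2norm :: "'x vec \<Rightarrow> real" where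
  "l2norm f = sqrt (\<Sum>\<^sub>\<infinity>x. (cmod (f x))\<^sup>2)"

definition ket :: "'x \<Rightarrow> 'x vec" where
  "ket x = (\<lambda>y. if y = x then 1 else 0)"

definition bounded_ops :: "'x set \<Rightarrow> 'x oper set" where
  "bounded_ops X = {A.
     (\<forall>f\<in>ell2 X. A f \<in> ell2 X) \<and>
     (\<forall>f\<in>ell2 X. \<forall>g\<in>ell2 X. A (\<lambda>x. f x + g x) = (\<lambda>x. A f x + A g x)) \<and>
     (\<forall>f\<in>ell2 X. \<forall>c. A (\<lambda>x. c * f x) = (\<lambda>x. c * A f x)) \<and>
     (\<exists>K. \<forall>f\<in>ell2 X. l2norm (A f) \<le> K * l2norm f) \<and>
     (\<forall>f. f \<notin> ell2 X \<longrightarrow> A f = (\<lambda>_. 0))}"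

definition zero_op :: "'x oper" where
  "zero_op = (\<lambda>_ _. 0)"

definition id_op :: "'x set \<Rightarrow> 'x oper" where
  "id_op X = (\<lambda>f. if f \<in> ell2 X then f else (\<lambda>_. 0))"

text \<open>
  The adjoint of a bounded operator, through its coordinates
  \<open>\<langle>x|A\<^sup>\<dagger> f\<rangle> = \<langle>A x|f\<rangle>\<close> at the basis vectors.
\<close>

definition adj :: "'x set \<Rightarrow> 'x oper \<Rightarrow> 'x oper" where
  "adj X A = (\<lambda>f. if f \<in> ell2 X
      then (\<lambda>x. if x \<in> X then cinner (A (ket x)) f else 0) else (\<lambda>_. 0))"

definition ketbra :: "'x set \<Rightarrow> 'x vec \<Rightarrow> 'x vec \<Rightarrow> 'x oper" where
  "ketbra X \<psi> \<phi> = (\<lambda>f. if f \<in> ell2 X then (\<lambda>x. \<psi> x * cinner \<phi> f) else (\<lambda>_. 0))"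

text \<open>
  Possibly infinite sums of operators, in the weak sense (coordinatewise after application to a
  vector). In the infinite sums of the program semantics the summands are positive with summable
  traces; for these the weak sum agrees with the sum in trace norm.
\<close>

definition op_sum :: "'i set \<Rightarrow> ('i \<Rightarrow> 'x oper) \<Rightarrow> 'x oper" where
  "op_sum I A = (\<lambda>f x. \<Sum>\<^sub>\<infinity>i\<in>I. A i f x)"

definition unitary :: "'x set \<Rightarrow> 'x oper \<Rightarrow> bool" where
  "unitary X U \<longleftrightarrow> U \<in> bounded_ops X \<and>
     adj X U \<circ> U = id_op X \<and> U \<circ> adj X U = id_op X"

definition projection :: "'x set \<Rightarrow> 'x oper \<Rightarrow> bool" where
  "projection X A \<longleftrightarrow> A \<in> bounded_ops X \<and> A \<circ> A = A \<and> adj X A = A"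

definition onb :: "'x set \<Rightarrow> 'i set \<Rightarrow> ('i \<Rightarrow> 'x vec) \<Rightarrow> bool" where
  "onb X I \<psi> \<longleftrightarrow>
     (\<forall>i\<in>I. \<psi> i \<in> ell2 X) \<and>
     (\<forall>i\<in>I. \<forall>j\<in>I. cinner (\<psi> i) (\<psi> j) = (if i = j then 1 else 0)) \<and>
     (\<forall>f\<in>ell2 X. (\<forall>i\<in>I. cinner (\<psi> i) f = 0) \<longrightarrow> f = (\<lambda>_. 0))"

definition positive_op :: "'x set \<Rightarrow> 'x oper \<Rightarrow> bool" where
  "positive_op X \<rho> \<longleftrightarrow> \<rho> \<in> bounded_ops X \<and> (\<forall>f\<in>ell2 X. cinner f (\<rho> f) \<in> \<real>\<^sub>\<ge>\<^sub>0)"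

definition partial_density :: "'x set \<Rightarrow> 'x oper set" where
  "partial_density X = {\<rho>. positive_op X \<rho> \<and>
     (\<lambda>x. Re (\<rho> (ket x) x)) summable_on X \<and> (\<Sum>\<^sub>\<infinity>x\<in>X. Re (\<rho> (ket x) x)) \<le> 1}"

text \<open>
  A system of quantum variables: the set \<open>qvars\<close>, for each variable the index set of the
  computational basis of its state space, and the set of available unitary constants.

  The component \<open>ref\<close> only matters when there are infinitely many variables: a basis state of the
  composite system is then an assignment that differs from \<open>ref\<close> at finitely many variables, so
  that the state space is the infinite tensor product of the spaces of the variables along the
  reference vectors \<open>|ref q\<rangle>\<close>. For finitely many variables it is the ordinary tensor product,
  whatever \<open>ref\<close> is.
\<close>

record ('v, 'b) qsystem =
  qvars :: "'v set"
  qbasis :: "'v \<Rightarrow> 'b set"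
  ref :: "'v \<Rightarrow> 'b"
  gates :: "'b list oper set"

definition valid_system :: "('v, 'b) qsystem \<Rightarrow> bool" where
  "valid_system S \<longleftrightarrow> (\<forall>q\<in>qvars S. ref S q \<in> qbasis S q)"

definition configs :: "('v, 'b) qsystem \<Rightarrow> ('v \<Rightarrow> 'b) set" where
  "configs S = {f \<in> PiE (qvars S) (qbasis S). finite {q \<in> qvars S. f q \<noteq> ref S q}}"

definition is_qubit :: "('v, 'b) qsystem \<Rightarrow> 'v \<Rightarrow> bool" where
  "is_qubit S q \<longleftrightarrow> card (qbasis S q) = 2"

definition register :: "('v, 'b) qsystem \<Rightarrow> 'v list \<Rightarrow> bool" where
  "register S qs \<longleftrightarrow> distinct qs \<and> set qs \<subseteq> qvars S"

definition reg_basis :: "('v, 'b) qsystem \<Rightarrow> 'v list \<Rightarrow> 'b list set" where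
  "reg_basis S qs = {bs. list_all2 (\<lambda>b q. b \<in> qbasis S q) bs qs}"

definition override :: "('v \<Rightarrow> 'b) \<Rightarrow> 'v list \<Rightarrow> 'b list \<Rightarrow> 'v \<Rightarrow> 'b" where
  "override f qs bs = (\<lambda>v. case map_of (zip qs bs) v of None \<Rightarrow> f v | Some b \<Rightarrow> b)"

text \<open>
  The extension \<open>A \<otimes> I\<close> to the whole system of an operator on a register: \<open>A\<close> acts on the
  slice of the state in which the variables outside the register are fixed.
\<close>

definition lift_op :: "('v, 'b) qsystem \<Rightarrow> 'v list \<Rightarrow> 'b list oper \<Rightarrow> ('v \<Rightarrow> 'b) oper" where
  "lift_op S qs A = (\<lambda>\<psi>. if \<psi> \<in> ell2 (configs S)
     then (\<lambda>f. if f \<in> configs S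
       then A (\<lambda>bs. if bs \<in> reg_basis S qs then \<psi> (override f qs bs) else 0) (map f qs)
       else 0)
     else (\<lambda>_. 0))"

definition conjugate ::
    "('v, 'b) qsystem \<Rightarrow> ('v \<Rightarrow> 'b) oper \<Rightarrow> ('v \<Rightarrow> 'b) oper \<Rightarrow> ('v \<Rightarrow> 'b) oper" where
  "conjugate S A \<rho> = A \<circ> \<rho> \<circ> adj (configs S) A"

text \<open>
  Outcomes of a measurement are numbers or, for measurements in the computational basis, basis
  labels of the measured register. Measurements come with the register they act on.
\<close>

datatype 'b outcome = Val nat | Basis (label: "'b list")

datatype ('v, 'b) meas =
  Meas (mreg: "'v list") (outcomes: "'b outcome set") (mop: "'b outcome \<Rightarrow> 'b list oper")

definition measurement :: "('v, 'b) qsystem \<Rightarrow> ('v, 'b) meas \<Rightarrow> bool" where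
  "measurement S M \<longleftrightarrow> register S (mreg M) \<and>
     (\<forall>m\<in>outcomes M. mop M m \<in> bounded_ops (reg_basis S (mreg M))) \<and>
     (\<forall>f\<in>ell2 (reg_basis S (mreg M)). \<forall>x.
        ((\<lambda>m. adj (reg_basis S (mreg M)) (mop M m) (mop M m f) x) has_sum f x) (outcomes M))"

definition binary_measurement :: "('v, 'b) qsystem \<Rightarrow> ('v, 'b) meas \<Rightarrow> bool" where
  "binary_measurement S M \<longleftrightarrow> measurement S M \<and> outcomes M = {Val 0, Val 1}"

definition projective :: "('v, 'b) qsystem \<Rightarrow> ('v, 'b) meas \<Rightarrow> bool" where
  "projective S M \<longleftrightarrow>
     (\<forall>m\<in>outcomes M. projection (reg_basis S (mreg M)) (mop M m)) \<and>
     (\<forall>m\<in>outcomes M. \<forall>n\<in>outcomes M. m \<noteq> n \<longrightarrow> mop M m \<circ> mop M n = zero_op)"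

definition comp_meas :: "('v, 'b) qsystem \<Rightarrow> 'v list \<Rightarrow> ('v, 'b) meas" where
  "comp_meas S qs = Meas qs (Basis ` reg_basis S qs)
     (\<lambda>m. ketbra (reg_basis S qs) (ket (label m)) (ket (label m)))"

definition mext :: "('v, 'b) qsystem \<Rightarrow> ('v, 'b) meas \<Rightarrow> 'b outcome \<Rightarrow> ('v \<Rightarrow> 'b) oper" where
  "mext S M m = lift_op S (mreg M) (mop M m)"

text \<open>In \<^term>\<open>Qif qs d \<psi> C\<close> only the values of \<open>\<psi>\<close> and \<open>C\<close> at \<open>1..d\<close> are relevant.\<close>

datatype ('v, 'b) circ =
    CSkip
  | Gate "'b list oper" "'v list"
  | CSeq "('v, 'b) circ" "('v, 'b) circ"
  | Qif "'v list" nat "nat \<Rightarrow> 'b list vec" "nat \<Rightarrow> ('v, 'b) circ"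

primrec cvars :: "('v, 'b) circ \<Rightarrow> 'v set" where
  "cvars CSkip = {}"
| "cvars (Gate U qs) = set qs"
| "cvars (CSeq C D) = cvars C \<union> cvars D"
| "cvars (Qif qs d \<psi> C) = set qs \<union> (\<Union>i\<in>{1..d}. cvars (C i))"

primrec wf_circ :: "('v, 'b) qsystem \<Rightarrow> ('v, 'b) circ \<Rightarrow> bool" where
  "wf_circ S CSkip \<longleftrightarrow> True"
| "wf_circ S (Gate U qs) \<longleftrightarrow> register S qs \<and> U \<in> gates S \<and> unitary (reg_basis S qs) U"
| "wf_circ S (CSeq C D) \<longleftrightarrow> wf_circ S C \<and> wf_circ S D"
| "wf_circ S (Qif qs d \<psi> C) \<longleftrightarrow> register S qs \<and> onb (reg_basis S qs) {1..d} \<psi> \<and>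
     (\<forall>i\<in>{1..d}. wf_circ S (C i) \<and> set qs \<inter> cvars (C i) = {})"

primrec csem :: "('v, 'b) qsystem \<Rightarrow> ('v, 'b) circ \<Rightarrow> ('v \<Rightarrow> 'b) oper" where
  "csem S CSkip = id_op (configs S)"
| "csem S (Gate U qs) = lift_op S qs U"
| "csem S (CSeq C D) = csem S D \<circ> csem S C"
| "csem S (Qif qs d \<psi> C) =
     op_sum {1..d} (\<lambda>i. lift_op S qs (ketbra (reg_basis S qs) (\<psi> i) (\<psi> i)) \<circ> csem S (C i))"

datatype ('v, 'b) prog =
    Skip
  | Abort
  | Init "'v list" "'b list vec"
  | Circ "('v, 'b) circ"
  | Seq "('v, 'b) prog" "('v, 'b) prog"
  | If "('v, 'b) meas" "'b outcome \<Rightarrow> ('v, 'b) prog"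
  | While "('v, 'b) meas" "('v, 'b) prog"

primrec wf_prog :: "('v, 'b) qsystem \<Rightarrow> ('v, 'b) prog \<Rightarrow> bool" where
  "wf_prog S Skip \<longleftrightarrow> True"
| "wf_prog S Abort \<longleftrightarrow> True"
| "wf_prog S (Init qs \<psi>) \<longleftrightarrow> register S qs \<and> \<psi> \<in> ell2 (reg_basis S qs) \<and> l2norm \<psi> = 1"
| "wf_prog S (Circ C) \<longleftrightarrow> wf_circ S C"
| "wf_prog S (Seq P Q) \<longleftrightarrow> wf_prog S P \<and> wf_prog S Q"
| "wf_prog S (If M P) \<longleftrightarrow> measurement S M \<and> (\<forall>m\<in>outcomes M. wf_prog S (P m))"
| "wf_prog S (While M P) \<longleftrightarrow> binary_measurement S M \<and> wf_prog S P"

primrec sem :: "('v, 'b) qsystem \<Rightarrow> ('v, 'b) prog \<Rightarrow> ('v \<Rightarrow> 'b) oper \<Rightarrow> ('v \<Rightarrow> 'b) oper" where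
  "sem S Skip = (\<lambda>\<rho>. \<rho>)"
| "sem S Abort = (\<lambda>\<rho>. zero_op)"
| "sem S (Init qs \<psi>) = (\<lambda>\<rho>. op_sum (reg_basis S qs)
     (\<lambda>n. lift_op S qs (ketbra (reg_basis S qs) \<psi> (ket n)) \<circ> \<rho> \<circ>
          lift_op S qs (ketbra (reg_basis S qs) (ket n) \<psi>)))"
| "sem S (Circ C) = conjugate S (csem S C)"
| "sem S (Seq P Q) = sem S Q \<circ> sem S P"
| "sem S (If M P) = (\<lambda>\<rho>. op_sum (outcomes M) (\<lambda>m. sem S (P m) (conjugate S (mext S M m) \<rho>)))"
| "sem S (While M P) = (\<lambda>\<rho>. op_sum UNIV (\<lambda>n.
     (conjugate S (mext S M (Val 0)) \<circ> (sem S P \<circ> conjugate S (mext S M (Val 1))) ^^ n) \<rho>))"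

definition prog_equiv :: "('v, 'b) prog \<Rightarrow> ('v, 'b) qsystem \<Rightarrow> ('v, 'b) prog \<Rightarrow> bool"
    ("(_ \<simeq>\<^bsub>_\<^esub> _)" [51, 0, 51] 50) where
  "P \<simeq>\<^bsub>S\<^esub> Q \<longleftrightarrow> (\<forall>\<rho>\<in>partial_density (configs S). sem S P \<rho> = sem S Q \<rho>)"

text \<open>The left branch is taken on outcome 0, the right one on outcome 1.\<close>

definition cond :: "('v, 'b) prog \<Rightarrow> ('v, 'b) meas \<Rightarrow> ('v, 'b) prog \<Rightarrow> ('v, 'b) prog"
    ("(_ \<triangleleft> _ \<triangleright> _)" [61, 0, 61] 60) where
  "P \<triangleleft> M \<triangleright> Q = If M (\<lambda>m. if m = Val 0 then P else Q)"

text \<open>\<open>[M]\<close>, \<open>(M]\<close> and \<open>[M)\<close>, in this order.\<close>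

definition test_any :: "('v, 'b) meas \<Rightarrow> ('v, 'b) prog" where
  "test_any M = Skip \<triangleleft> M \<triangleright> Skip"

definition test_one :: "('v, 'b) meas \<Rightarrow> ('v, 'b) prog" where
  "test_one M = Abort \<triangleleft> M \<triangleright> Skip"

definition test_zero :: "('v, 'b) meas \<Rightarrow> ('v, 'b) prog" where
  "test_zero M = Skip \<triangleleft> M \<triangleright> Abort"

definition if_comp ::
    "('v, 'b) qsystem \<Rightarrow> 'v list \<Rightarrow> ('b list \<Rightarrow> ('v, 'b) prog) \<Rightarrow> ('v, 'b) prog" where
  "if_comp S qs P = If (comp_meas S qs) (\<lambda>m. P (label m))"

definition meas_compl :: "('v, 'b) meas \<Rightarrow> ('v, 'b) meas" where
  "meas_compl M = Meas (mreg M) (outcomes M)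
     (\<lambda>m. if m = Val 0 then mop M (Val 1) else mop M (Val 0))"

text \<open>
  The conditions relating two measurements are on their extensions to the whole system, as the
  measured registers may differ or overlap: \<open>N\<^sub>0 M\<^sub>1 = 0\<close> (\<open>meas_impl\<close>), and the commutation
  conditions written \<open>M \<diamond>\<^sub>L N\<close> and \<open>M \<diamond>\<^sub>R N\<close>.
\<close>

definition meas_impl :: "('v, 'b) qsystem \<Rightarrow> ('v, 'b) meas \<Rightarrow> ('v, 'b) meas \<Rightarrow> bool" where
  "meas_impl S M N \<longleftrightarrow> mext S N (Val 0) \<circ> mext S M (Val 1) = zero_op"

definition commute_L :: "('v, 'b) qsystem \<Rightarrow> ('v, 'b) meas \<Rightarrow> ('v, 'b) meas \<Rightarrow> bool" where
  "commute_L S M N \<longleftrightarrow>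
     mext S M (Val 0) \<circ> mext S N (Val 1) = mext S N (Val 1) \<circ> mext S M (Val 0) \<and>
     mext S M (Val 1) \<circ> mext S N (Val 1) = mext S N (Val 1) \<circ> mext S M (Val 1)"

definition commute_R :: "('v, 'b) qsystem \<Rightarrow> ('v, 'b) meas \<Rightarrow> ('v, 'b) meas \<Rightarrow> bool" where
  "commute_R S M N \<longleftrightarrow>
     mext S M (Val 0) \<circ> mext S N (Val 0) = mext S N (Val 0) \<circ> mext S M (Val 0) \<and>
     mext S M (Val 1) \<circ> mext S N (Val 0) = mext S N (Val 0) \<circ> mext S M (Val 1)"

end

theory Submission
  imports Defs
begin

text \<open>
  Nested measurements in the computational basis compose because their operators multiply to those
  of the joint measurement. The other laws follow from the additivity of program semantics: each measurement condition equates
  \<open>A \<rho> A\<^sup>\<dagger>\<close>, for a measurement operator \<open>A\<close>, with a sum of such terms, and the branch programs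
  distribute over that sum. In infinite dimension additivity needs convergence of the sums defining
  loops, initialisations and measurements with infinitely many outcomes, so one proves along with
  it that programs map positive operators of finite trace to such operators without increasing the
  trace.

  The trace bound \<open>\<Sum>\<^sub>i tr (A\<^sub>i \<rho> A\<^sub>i\<^sup>\<dagger>) \<le> tr \<rho>\<close> for \<open>\<Sum>\<^sub>i A\<^sub>i\<^sup>\<dagger> A\<^sub>i \<le> I\<close> is obtained without
  spectral theory: only countably many diagonal entries of \<open>\<rho>\<close> are nonzero, and Cholesky
  elimination along them writes \<open>\<rho>\<close> as a sum of operators \<open>|v\<^sub>k\<rangle>\<langle>v\<^sub>k|\<close> with
  \<open>\<Sum>\<^sub>k \<parallel>v\<^sub>k\<parallel>\<^sup>2 = tr \<rho>\<close>.
\<close>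

subsection \<open>Square-summable families\<close>

text \<open>The sums of the semantics are coordinatewise \<open>infsum\<close>s, which return 0 on
  divergence, so additivity of a program is a convergence claim and cannot be read off its formula.
  Convergence is controlled by a single number, the trace: each coordinate of
  \<open>\<rho> f\<close> is at most the trace of the positive operator \<open>\<rho>\<close> times
  the norm of \<open>f\<close>, so summable traces make all coordinate sums absolutely convergent.
  The argument moves from \<open>partial_density\<close>, which is not closed under addition, to the
  cone \<open>trace_pos\<close>.

  Cyclicity of the trace would require a theory of trace-class operators. With \<rho> split into
  rank-one pieces, the trace bound becomes an inequality between
  \<open>\<Sum>i. (l2norm (A i v))\<^sup>2\<close> and \<open>(l2norm v)\<^sup>2\<close> for one
  vector \<open>v\<close> at a time, which is what completeness of a measurement, or contractivity
  of a circuit, provides.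

  Tensor products are handled through slices: with the variables outside a register fixed, a state
  becomes a vector on that register. A lifted operator acts on every slice separately, and norms and
  inner products are sums over slices.\<close>

lemma ell2_outside: "f \<in> ell2 X \<Longrightarrow> x \<notin> X \<Longrightarrow> f x = 0"
  by (simp add: ell2_def)

lemma ell2_summable: "f \<in> ell2 X \<Longrightarrow> (\<lambda>x. (cmod (f x))\<^sup>2) summable_on A"
  unfolding ell2_def by (auto intro: summable_on_subset)

lemma l2norm_nonneg [simp]: "0 \<le> l2norm f"
  by (simp add: l2norm_def infsum_nonneg)

lemma l2norm_square: "(l2norm f)\<^sup>2 = (\<Sum>\<^sub>\<infinity>x. (cmod (f x))\<^sup>2)"
  by (simp add: l2norm_def infsum_nonneg)

lemma l2norm_has_sum:
  assumes "f \<in> ell2 X"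
  shows "((\<lambda>x. (cmod (f x))\<^sup>2) has_sum (l2norm f)\<^sup>2) X"
proof -
  have "((\<lambda>x. (cmod (f x))\<^sup>2) has_sum (l2norm f)\<^sup>2) UNIV"
    unfolding l2norm_square by (intro has_sum_infsum ell2_summable[OF assms])
  then show ?thesis
    by (rule has_sum_cong_neutral[THEN iffD1, rotated -1]) (auto simp: ell2_outside[OF assms])
qed

lemma L2_set_le_l2norm: "f \<in> ell2 X \<Longrightarrow> L2_set (\<lambda>x. cmod (f x)) F \<le> l2norm f"
proof (cases "finite F")
  case True
  assume "f \<in> ell2 X"
  then have "(\<Sum>x\<in>F. (cmod (f x))\<^sup>2) \<le> (\<Sum>\<^sub>\<infinity>x. (cmod (f x))\<^sup>2)"
    by (intro finite_sum_le_infsum True) (auto simp: ell2_summable)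
  then show ?thesis by (simp add: L2_set_def l2norm_def)
qed simp

lemma cmod_le_l2norm: "f \<in> ell2 X \<Longrightarrow> cmod (f x) \<le> l2norm f"
  using L2_set_le_l2norm[of f X "{x}"] by simp

text \<open>The working criterion for square summability: a bound uniform over finite sets yields
  membership and the norm estimate together, so that finite inequalities can be transferred to
  infinite families.\<close>

lemma ell2_bounded_sums:
  assumes "\<And>x. x \<notin> X \<Longrightarrow> f x = 0" and "0 \<le> B"
    and "\<And>F. finite F \<Longrightarrow> F \<subseteq> X \<Longrightarrow> (\<Sum>x\<in>F. (cmod (f x))\<^sup>2) \<le> B\<^sup>2"
  shows "f \<in> ell2 X" "l2norm f \<le> B"
proof -
  have *: "(\<Sum>x\<in>F. (cmod (f x))\<^sup>2) \<le> B\<^sup>2" if "finite F" for F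
  proof -
    have "(\<Sum>x\<in>F. (cmod (f x))\<^sup>2) = (\<Sum>x\<in>F \<inter> X. (cmod (f x))\<^sup>2)"
      using that assms(1) by (intro sum.mono_neutral_right) auto
    then show ?thesis using assms(3)[of "F \<inter> X"] that by simp
  qed
  have "(\<lambda>x. (cmod (f x))\<^sup>2) summable_on UNIV"
    by (rule nonneg_bdd_above_summable_on) (auto intro!: bdd_aboveI2 *)
  then show "f \<in> ell2 X" using assms(1) by (auto simp: ell2_def)
  then have "(l2norm f)\<^sup>2 \<le> B\<^sup>2"
    unfolding l2norm_square by (intro infsum_le_finite_sums * ell2_summable) auto
  then show "l2norm f \<le> B" using assms(2) by (simp add: power2_le_iff_abs_le)
qed

lemma ell2_zero [simp]: "(\<lambda>_. 0) \<in> ell2 X"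
  by (simp add: ell2_def)

lemma l2norm_zero [simp]: "l2norm (\<lambda>_. 0) = 0"
  by (simp add: l2norm_def)

lemma ell2_scale [simp]: "f \<in> ell2 X \<Longrightarrow> (\<lambda>x. c * f x) \<in> ell2 X"
  by (auto simp: ell2_def norm_mult power_mult_distrib intro: summable_on_cmult_right)

lemma l2norm_scale: "l2norm (\<lambda>x. c * f x) = cmod c * l2norm f"
  by (simp add: l2norm_def norm_mult power_mult_distrib infsum_cmult_right' real_sqrt_mult)

text \<open>Minkowski's inequality on finite sets survives the passage to infinite families because
  its bound does not depend on the set.\<close>

lemma
  assumes "f \<in> ell2 X" "g \<in> ell2 X"
  shows ell2_add [simp]: "(\<lambda>x. f x + g x) \<in> ell2 X"
    and l2norm_triangle: "l2norm (\<lambda>x. f x + g x) \<le> l2norm f + l2norm g"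
proof -
  have "(\<Sum>x\<in>F. (cmod (f x + g x))\<^sup>2) \<le> (l2norm f + l2norm g)\<^sup>2" for F
  proof -
    have "L2_set (\<lambda>x. cmod (f x + g x)) F \<le> L2_set (\<lambda>x. cmod (f x) + cmod (g x)) F"
      by (intro L2_set_mono norm_triangle_ineq) auto
    also have "\<dots> \<le> L2_set (\<lambda>x. cmod (f x)) F + L2_set (\<lambda>x. cmod (g x)) F"
      by (rule L2_set_triangle_ineq)
    also have "\<dots> \<le> l2norm f + l2norm g"
      by (rule add_mono[OF L2_set_le_l2norm[OF assms(1)] L2_set_le_l2norm[OF assms(2)]])
    finally have "(L2_set (\<lambda>x. cmod (f x + g x)) F)\<^sup>2 \<le> (l2norm f + l2norm g)\<^sup>2"
      by (intro power_mono) auto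
    then show ?thesis by (simp add: L2_set_def sum_nonneg)
  qed
  then show "(\<lambda>x. f x + g x) \<in> ell2 X" "l2norm (\<lambda>x. f x + g x) \<le> l2norm f + l2norm g"
    using assms
    by (auto intro!: ell2_bounded_sums[where B = "l2norm f + l2norm g"]
        simp: ell2_outside[OF assms(1)] ell2_outside[OF assms(2)])
qed

lemma ell2_uminus [simp]: "f \<in> ell2 X \<Longrightarrow> (\<lambda>x. - f x) \<in> ell2 X"
  using ell2_scale[of f X "-1"] by simp

lemma ell2_diff [simp]: "f \<in> ell2 X \<Longrightarrow> g \<in> ell2 X \<Longrightarrow> (\<lambda>x. f x - g x) \<in> ell2 X"
  using ell2_add[of f X "\<lambda>x. - g x"] by simp

lemma ell2_sum [simp]:
  assumes "\<And>i. i \<in> I \<Longrightarrow> f i \<in> ell2 X"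
  shows "(\<lambda>x. \<Sum>i\<in>I. f i x) \<in> ell2 X"
  using assms by (induction I rule: infinite_finite_induct) auto

lemma ell2_ket [simp]: "ket x \<in> ell2 X \<longleftrightarrow> x \<in> X"
proof -
  have "(\<lambda>y. (cmod (ket x y))\<^sup>2) summable_on UNIV"
    by (rule finite_nonzero_values_imp_summable_on) (simp add: ket_def)
  then show ?thesis by (auto simp: ell2_def ket_def)
qed

lemma ell2_restrict [simp]: "f \<in> ell2 X \<Longrightarrow> (\<lambda>x. if x \<in> F then f x else 0) \<in> ell2 X"
  unfolding ell2_def
  by (auto intro: summable_on_comparison_test[of "\<lambda>x. (cmod (f x))\<^sup>2"])

text \<open>The squared error is the tail of a convergent sum. This is the density of finitely
  supported vectors, through which continuity arguments reduce to basis vectors.\<close>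

lemma l2norm_truncation:
  assumes "f \<in> ell2 X"
  shows "((\<lambda>F. l2norm (\<lambda>x. f x - (if x \<in> F then f x else 0))) \<longlongrightarrow> 0)
           (finite_subsets_at_top UNIV)"
proof -
  let ?s = "\<lambda>x. (cmod (f x))\<^sup>2"
  have eq: "l2norm (\<lambda>x. f x - (if x \<in> F then f x else 0)) = sqrt (infsum ?s UNIV - sum ?s F)"
    if "finite F" for F
  proof -
    have "(\<Sum>\<^sub>\<infinity>x. (cmod (f x - (if x \<in> F then f x else 0)))\<^sup>2) = infsum ?s (UNIV - F)"
      by (rule infsum_cong_neutral) auto
    also have "\<dots> = infsum ?s UNIV - infsum ?s F"
      by (rule infsum_Diff) (use that in \<open>auto intro: ell2_summable[OF assms]\<close>)
    finally show ?thesis using that by (simp add: l2norm_def)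
  qed
  have "((\<lambda>F. sqrt (infsum ?s UNIV - sum ?s F)) \<longlongrightarrow> sqrt (infsum ?s UNIV - infsum ?s UNIV))
      (finite_subsets_at_top UNIV)"
    by (intro tendsto_intros infsum_tendsto ell2_summable[OF assms])
  moreover have "\<forall>\<^sub>F F in finite_subsets_at_top UNIV.
      sqrt (infsum ?s UNIV - sum ?s F) = l2norm (\<lambda>x. f x - (if x \<in> F then f x else 0))"
    using eventually_finite_subsets_at_top_weakI[of UNIV] eq
    by (metis (mono_tags, lifting))
  ultimately show ?thesis
    by (simp add: filterlim_cong tendsto_cong)
qed

text \<open>Finite Cauchy-Schwarz with a uniform bound. Absolute convergence makes
  \<open>cinner\<close> additive and later allows exchanging it with infinite sums of
  operators.\<close>

lemma
  assumes "f \<in> ell2 X" "g \<in> ell2 X"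
  shows cinner_abs_summable: "(\<lambda>x. cmod (cnj (f x) * g x)) summable_on UNIV"
    and cinner_abs_le: "(\<Sum>\<^sub>\<infinity>x. cmod (cnj (f x) * g x)) \<le> l2norm f * l2norm g"
proof -
  have *: "(\<Sum>x\<in>F. cmod (cnj (f x) * g x)) \<le> l2norm f * l2norm g" for F
  proof -
    have "(\<Sum>x\<in>F. cmod (cnj (f x) * g x)) = (\<Sum>x\<in>F. \<bar>cmod (f x)\<bar> * \<bar>cmod (g x)\<bar>)"
      by (simp add: norm_mult)
    also have "\<dots> \<le> L2_set (\<lambda>x. cmod (f x)) F * L2_set (\<lambda>x. cmod (g x)) F"
      by (rule L2_set_mult_ineq)
    also have "\<dots> \<le> l2norm f * l2norm g"
      by (intro mult_mono L2_set_le_l2norm[OF assms(1)] L2_set_le_l2norm[OF assms(2)]) auto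
    finally show ?thesis .
  qed
  show s: "(\<lambda>x. cmod (cnj (f x) * g x)) summable_on UNIV"
    by (rule nonneg_bdd_above_summable_on) (auto intro!: bdd_aboveI2 *)
  show "(\<Sum>\<^sub>\<infinity>x. cmod (cnj (f x) * g x)) \<le> l2norm f * l2norm g"
    by (intro infsum_le_finite_sums s *)
qed

lemma cinner_summable:
  "f \<in> ell2 X \<Longrightarrow> g \<in> ell2 X \<Longrightarrow> (\<lambda>x. cnj (f x) * g x) summable_on UNIV"
  by (blast intro: abs_summable_summable cinner_abs_summable)

lemma Cauchy_Schwarz_cinner:
  assumes "f \<in> ell2 X" "g \<in> ell2 X"
  shows "cmod (cinner f g) \<le> l2norm f * l2norm g"
  unfolding cinner_def
  using norm_infsum_bound[OF cinner_abs_summable[OF assms]] cinner_abs_le[OF assms] by linarith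

lemma cinner_commute: "cinner g f = cnj (cinner f g)"
  unfolding cinner_def infsum_cnj[symmetric] by (simp add: mult.commute)

lemma cinner_add_right:
  "f \<in> ell2 X \<Longrightarrow> g \<in> ell2 X \<Longrightarrow> h \<in> ell2 X \<Longrightarrow>
   cinner f (\<lambda>x. g x + h x) = cinner f g + cinner f h"
  unfolding cinner_def by (simp add: distrib_left infsum_add cinner_summable)

lemma cinner_scale_right: "cinner f (\<lambda>x. c * g x) = c * cinner f g"
proof -
  have "(\<lambda>x. cnj (f x) * (c * g x)) = (\<lambda>x. c * (cnj (f x) * g x))" by (auto simp: mult_ac)
  then show ?thesis by (simp add: cinner_def infsum_cmult_right')
qed

lemma cinner_zero_right [simp]: "cinner f (\<lambda>_. 0) = 0"
  by (simp add: cinner_def)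

lemma cinner_zero_left [simp]: "cinner (\<lambda>_. 0) f = 0"
  by (simp add: cinner_def)

lemma cinner_add_left:
  "f \<in> ell2 X \<Longrightarrow> g \<in> ell2 X \<Longrightarrow> h \<in> ell2 X \<Longrightarrow>
   cinner (\<lambda>x. f x + g x) h = cinner f h + cinner g h"
  by (subst (1 2 3) cinner_commute) (simp add: cinner_add_right)

lemma cinner_scale_left: "cinner (\<lambda>x. c * f x) g = cnj c * cinner f g"
  by (subst (1 2) cinner_commute) (simp add: cinner_scale_right)

lemma cinner_diff_right:
  "f \<in> ell2 X \<Longrightarrow> g \<in> ell2 X \<Longrightarrow> h \<in> ell2 X \<Longrightarrow>
   cinner f (\<lambda>x. g x - h x) = cinner f g - cinner f h"
  using cinner_add_right[of f X g "\<lambda>x. -1 * h x"] cinner_scale_right[of f "-1" h] by simp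

lemma cinner_sum_right:
  "f \<in> ell2 X \<Longrightarrow> (\<And>i. i \<in> I \<Longrightarrow> g i \<in> ell2 X) \<Longrightarrow>
   cinner f (\<lambda>x. \<Sum>i\<in>I. g i x) = (\<Sum>i\<in>I. cinner f (g i))"
  by (induction I rule: infinite_finite_induct) (auto simp: cinner_add_right[where X = X])

lemma cinner_ket_left [simp]: "cinner (ket x) f = f x"
proof -
  have "cinner (ket x) f = (\<Sum>\<^sub>\<infinity>y\<in>{x}. f y)"
    unfolding cinner_def by (rule infsum_cong_neutral) (auto simp: ket_def)
  then show ?thesis by simp
qed

lemma cinner_ket_right [simp]: "cinner f (ket x) = cnj (f x)"
  by (subst cinner_commute) simp

lemma cinner_self: "f \<in> ell2 X \<Longrightarrow> cinner f f = of_real ((l2norm f)\<^sup>2)"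
proof -
  assume f: "f \<in> ell2 X"
  have "cinner f f = (\<Sum>\<^sub>\<infinity>x. of_real ((cmod (f x))\<^sup>2))"
    unfolding cinner_def by (simp add: complex_norm_square mult.commute del: of_real_power)
  also have "\<dots> = of_real (\<Sum>\<^sub>\<infinity>x. (cmod (f x))\<^sup>2)"
    by (intro infsumI has_sum_of_real has_sum_infsum ell2_summable[OF f])
  finally show ?thesis by (simp add: l2norm_square)
qed

lemma ell2_eqI:
  assumes "f \<in> ell2 X" "g \<in> ell2 X" "\<And>h. h \<in> ell2 X \<Longrightarrow> cinner h f = cinner h g"
  shows "f = g"
proof
  fix x show "f x = g x"
    using assms(3)[of "ket x"] assms(1,2) by (cases "x \<in> X") (auto simp: ell2_outside)
qed

lemma l2norm_truncation_le:
  assumes "f \<in> ell2 X"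
  shows "l2norm (\<lambda>x. if x \<in> G then f x else 0) \<le> l2norm f"
proof (rule ell2_bounded_sums)
  fix F assume F: "finite F" "F \<subseteq> X"
  have "(\<Sum>x\<in>F. (cmod (if x \<in> G then f x else 0))\<^sup>2) \<le> (\<Sum>x\<in>F. (cmod (f x))\<^sup>2)"
    by (intro sum_mono) auto
  also have "\<dots> \<le> (l2norm f)\<^sup>2"
    unfolding l2norm_square using F by (intro finite_sum_le_infsum ell2_summable[OF assms]) auto
  finally show "(\<Sum>x\<in>F. (cmod (if x \<in> G then f x else 0))\<^sup>2) \<le> (l2norm f)\<^sup>2" .
qed (use assms in \<open>auto simp: ell2_outside\<close>)

subsection \<open>Bounded functionals and operators\<close>

lemma truncation_eq_sum_ket:
  assumes "finite F"
  shows "(\<lambda>x. if x \<in> F then f x else 0) = (\<lambda>x. \<Sum>y\<in>F. f y * ket y x)"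
  using assms by (auto simp: fun_eq_iff ket_def if_distrib cong: if_cong)

lemma functional_sum:
  fixes \<phi> :: "'x vec \<Rightarrow> complex"
  assumes add: "\<And>f g. f \<in> ell2 X \<Longrightarrow> g \<in> ell2 X \<Longrightarrow> \<phi> (\<lambda>x. f x + g x) = \<phi> f + \<phi> g"
    and scale: "\<And>f c. f \<in> ell2 X \<Longrightarrow> \<phi> (\<lambda>x. c * f x) = c * \<phi> f"
    and "\<And>i. i \<in> I \<Longrightarrow> f i \<in> ell2 X"
  shows "\<phi> (\<lambda>x. \<Sum>i\<in>I. f i x) = (\<Sum>i\<in>I. \<phi> (f i))"
proof -
  have z: "\<phi> (\<lambda>_. 0) = 0" using scale[of "\<lambda>_. 0" 0] by simp
  show ?thesis
    using assms(3) by (induction I rule: infinite_finite_induct) (auto simp: add z)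
qed

text \<open>A bounded functional is continuous, so its value at \<open>f\<close> is the limit of its
  values at truncations of \<open>f\<close>, which are finite combinations of basis vectors.\<close>

lemma functional_has_sum:
  fixes \<phi> :: "'x vec \<Rightarrow> complex"
  assumes add: "\<And>f g. f \<in> ell2 X \<Longrightarrow> g \<in> ell2 X \<Longrightarrow> \<phi> (\<lambda>x. f x + g x) = \<phi> f + \<phi> g"
    and scale: "\<And>f c. f \<in> ell2 X \<Longrightarrow> \<phi> (\<lambda>x. c * f x) = c * \<phi> f"
    and bound: "\<And>f. f \<in> ell2 X \<Longrightarrow> cmod (\<phi> f) \<le> C * l2norm f"
    and f: "f \<in> ell2 X"
  shows "((\<lambda>y. f y * \<phi> (ket y)) has_sum \<phi> f) X"
proof -
  let ?t = "\<lambda>F x. if x \<in> F then f x else 0"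
  have t: "\<phi> (?t F) = (\<Sum>y\<in>F \<inter> X. f y * \<phi> (ket y))" if "finite F" for F
  proof -
    have "?t F = ?t (F \<inter> X)" using f by (auto simp: fun_eq_iff ell2_outside)
    also have "\<dots> = (\<lambda>x. \<Sum>y\<in>F \<inter> X. f y * ket y x)"
      using that by (intro truncation_eq_sum_ket) auto
    finally have "\<phi> (?t F) = \<phi> (\<lambda>x. \<Sum>y\<in>F \<inter> X. f y * ket y x)"
      by simp
    also have "\<dots> = (\<Sum>y\<in>F \<inter> X. \<phi> (\<lambda>x. f y * ket y x))"
      by (rule functional_sum[OF add scale]) auto
    finally show ?thesis by (simp add: scale)
  qed
  have d: "cmod (\<phi> (?t F) - \<phi> f) \<le> l2norm (\<lambda>x. f x - ?t F x) * C" for F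
  proof -
    have "\<phi> f = \<phi> (\<lambda>x. (f x - ?t F x) + ?t F x)" by simp
    also have "\<dots> = \<phi> (\<lambda>x. f x - ?t F x) + \<phi> (?t F)"
      using f by (intro add) auto
    finally have "cmod (\<phi> (?t F) - \<phi> f) = cmod (\<phi> (\<lambda>x. f x - ?t F x))"
      by (simp add: norm_minus_commute)
    also have "\<dots> \<le> C * l2norm (\<lambda>x. f x - ?t F x)"
      using f by (intro bound) auto
    finally show ?thesis by (simp add: mult.commute)
  qed
  have "((\<lambda>F. \<phi> (?t F) - \<phi> f) \<longlongrightarrow> 0) (finite_subsets_at_top UNIV)"
    by (rule Lim_null_comparison[OF _ tendsto_mult_left_zero[OF l2norm_truncation[OF f]]])
       (use d in auto)
  then have "((\<lambda>F. \<phi> (?t F)) \<longlongrightarrow> \<phi> f) (finite_subsets_at_top UNIV)"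
    by (rule LIM_zero_cancel)
  moreover have "\<forall>\<^sub>F F in finite_subsets_at_top UNIV.
      \<phi> (?t F) = (\<Sum>y\<in>F. if y \<in> X then f y * \<phi> (ket y) else 0)"
    by (rule eventually_finite_subsets_at_top_weakI) (simp add: t sum.inter_restrict)
  ultimately have "((\<lambda>y. if y \<in> X then f y * \<phi> (ket y) else 0) has_sum \<phi> f) UNIV"
    unfolding has_sum_def using tendsto_cong by fastforce
  then show ?thesis
    by (rule has_sum_cong_neutral[THEN iffD1, rotated -1]) auto
qed

text \<open>Riesz representation in coordinates: the values at basis vectors dictate the
  representing vector \<open>r\<close>, and only its square summability needs an argument. That
  comes from evaluating the functional at truncations of \<open>r\<close> itself.\<close>

lemma functional_representation:
  fixes \<phi> :: "'x vec \<Rightarrow> complex"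
  assumes add: "\<And>f g. f \<in> ell2 X \<Longrightarrow> g \<in> ell2 X \<Longrightarrow> \<phi> (\<lambda>x. f x + g x) = \<phi> f + \<phi> g"
    and scale: "\<And>f c. f \<in> ell2 X \<Longrightarrow> \<phi> (\<lambda>x. c * f x) = c * \<phi> f"
    and bound: "\<And>f. f \<in> ell2 X \<Longrightarrow> cmod (\<phi> f) \<le> C * l2norm f"
    and "0 \<le> C"
  defines "r \<equiv> (\<lambda>y. if y \<in> X then cnj (\<phi> (ket y)) else 0)"
  shows "r \<in> ell2 X" "l2norm r \<le> C" "\<And>f. f \<in> ell2 X \<Longrightarrow> \<phi> f = cinner r f"
proof -
  have *: "(\<Sum>x\<in>F. (cmod (r x))\<^sup>2) \<le> C\<^sup>2" if "finite F" "F \<subseteq> X" for F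
  proof -
    let ?s = "\<Sum>x\<in>F. (cmod (r x))\<^sup>2"
    let ?t = "\<lambda>x. if x \<in> F then r x else 0"
    have e: "?t = (\<lambda>x. \<Sum>y\<in>F. r y * ket y x)"
      by (rule truncation_eq_sum_ket) fact
    have t: "?t \<in> ell2 X"
      unfolding e using that by (intro ell2_sum ell2_scale) auto
    \<comment> \<open>At its own truncation the functional returns exactly the sum of squares
      \<open>?s\<close>, while the bound allows at most \<open>C * sqrt ?s\<close>; cancelling
      \<open>sqrt ?s\<close> bounds \<open>?s\<close> independently of \<open>F\<close>.\<close>
    have "\<phi> ?t = (\<Sum>y\<in>F. r y * \<phi> (ket y))"
      unfolding e using that(2)
      by (subst functional_sum[OF add scale]) (auto simp: subset_iff scale)
    also have "\<dots> = (\<Sum>y\<in>F. of_real ((cmod (r y))\<^sup>2))"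
      using that(2) unfolding r_def
      by (intro sum.cong) (auto simp: complex_norm_square mult.commute simp del: of_real_power)
    finally have 1: "\<phi> ?t = of_real ?s" by simp
    have "(l2norm ?t)\<^sup>2 = ?s"
      unfolding l2norm_square
      by (subst infsum_cong_neutral[of F UNIV "\<lambda>x. (cmod (r x))\<^sup>2"]) (use that in auto)
    then have 2: "l2norm ?t = sqrt ?s" by (metis l2norm_nonneg real_sqrt_unique)
    have "\<bar>?s\<bar> \<le> C * sqrt ?s" using bound[OF t] unfolding 1 2 by (simp del: of_real_sum)
    moreover have "0 \<le> ?s" by (simp add: sum_nonneg)
    ultimately have "sqrt ?s * sqrt ?s \<le> C * sqrt ?s" by simp
    then have "sqrt ?s \<le> C"
    proof (cases "0 < sqrt ?s")
      case False
      then have "sqrt ?s \<le> 0" by linarith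
      then show ?thesis using \<open>0 \<le> C\<close> by linarith
    qed (rule mult_right_le_imp_le)
    then have "(sqrt ?s)\<^sup>2 \<le> C\<^sup>2" using \<open>0 \<le> ?s\<close> by (intro power_mono) auto
    then show ?thesis using \<open>0 \<le> ?s\<close> by simp
  qed
  show "r \<in> ell2 X" "l2norm r \<le> C"
    using ell2_bounded_sums[of X r C] * \<open>0 \<le> C\<close> by (auto simp: r_def)
  fix f assume f: "f \<in> ell2 X"
  have "\<phi> f = (\<Sum>\<^sub>\<infinity>y\<in>X. f y * \<phi> (ket y))"
    by (rule infsumI[symmetric], rule functional_has_sum[of X \<phi> C, OF add scale bound f])
  also have "\<dots> = cinner r f"
    unfolding cinner_def by (rule infsum_cong_neutral) (auto simp: r_def mult.commute)
  finally show "\<phi> f = cinner r f" .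
qed

section \<open>Bounded operators: continuity and matrix entries\<close>

lemma bounded_ops_ell2 [simp]: "A \<in> bounded_ops X \<Longrightarrow> A f \<in> ell2 X"
  unfolding bounded_ops_def by (cases "f \<in> ell2 X") simp_all

lemma bounded_ops_add:
  "A \<in> bounded_ops X \<Longrightarrow> f \<in> ell2 X \<Longrightarrow> g \<in> ell2 X \<Longrightarrow> A (\<lambda>x. f x + g x) = (\<lambda>x. A f x + A g x)"
  unfolding bounded_ops_def by blast

lemma bounded_ops_scale:
  "A \<in> bounded_ops X \<Longrightarrow> f \<in> ell2 X \<Longrightarrow> A (\<lambda>x. c * f x) = (\<lambda>x. c * A f x)"
  unfolding bounded_ops_def by blast

lemma bounded_ops_outside: "A \<in> bounded_ops X \<Longrightarrow> f \<notin> ell2 X \<Longrightarrow> A f = (\<lambda>_. 0)"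
  unfolding bounded_ops_def by blast

lemma bounded_ops_zero: "A \<in> bounded_ops X \<Longrightarrow> A (\<lambda>_. 0) = (\<lambda>_. 0)"
  using bounded_ops_scale[of A X "\<lambda>_. 0" 0] by simp

lemma bounded_ops_bound:
  assumes "A \<in> bounded_ops X"
  obtains C where "0 \<le> C" "\<And>f. f \<in> ell2 X \<Longrightarrow> l2norm (A f) \<le> C * l2norm f"
proof -
  obtain K where K: "\<forall>f\<in>ell2 X. l2norm (A f) \<le> K * l2norm f"
    using assms unfolding bounded_ops_def by blast
  \<comment> \<open>\<open>bounded_ops\<close> puts no sign on its constant, while multiplying
    estimates calls for a nonnegative one.\<close>
  have "l2norm (A f) \<le> \<bar>K\<bar> * l2norm f" if "f \<in> ell2 X" for f
  proof -
    have "l2norm (A f) \<le> K * l2norm f" using K that by blast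
    also have "\<dots> \<le> \<bar>K\<bar> * l2norm f" by (intro mult_right_mono) auto
    finally show ?thesis .
  qed
  then show thesis using that[of "\<bar>K\<bar>"] by simp
qed

lemma bounded_opsI:
  assumes "\<And>f. f \<in> ell2 X \<Longrightarrow> A f \<in> ell2 X"
    and "\<And>f g. f \<in> ell2 X \<Longrightarrow> g \<in> ell2 X \<Longrightarrow> A (\<lambda>x. f x + g x) = (\<lambda>x. A f x + A g x)"
    and "\<And>f c. f \<in> ell2 X \<Longrightarrow> A (\<lambda>x. c * f x) = (\<lambda>x. c * A f x)"
    and "\<And>f. f \<in> ell2 X \<Longrightarrow> l2norm (A f) \<le> K * l2norm f"
    and "\<And>f. f \<notin> ell2 X \<Longrightarrow> A f = (\<lambda>_. 0)"
  shows "A \<in> bounded_ops X"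
  using assms unfolding bounded_ops_def by blast

lemma bounded_ops_diff:
  assumes "A \<in> bounded_ops X" "f \<in> ell2 X" "g \<in> ell2 X"
  shows "A (\<lambda>x. f x - g x) = (\<lambda>x. A f x - A g x)"
  using bounded_ops_add[OF assms(1,2) ell2_scale[OF assms(3), of "-1"]]
    bounded_ops_scale[OF assms(1,3), of "-1"] by simp

lemma bounded_ops_sum:
  assumes "A \<in> bounded_ops X" "\<And>i. i \<in> I \<Longrightarrow> f i \<in> ell2 X"
  shows "A (\<lambda>x. \<Sum>i\<in>I. f i x) = (\<lambda>x. \<Sum>i\<in>I. A (f i) x)"
  using assms(2)
  by (induction I rule: infinite_finite_induct)
     (auto simp: bounded_ops_zero[OF assms(1)] bounded_ops_add[OF assms(1)])

text \<open>The reverse triangle inequality bounds the difference of norms by the norm of the image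
  of the truncation error, which tends to 0.\<close>

lemma bounded_ops_truncation:
  assumes A: "A \<in> bounded_ops X" and f: "f \<in> ell2 X"
  shows "((\<lambda>G. l2norm (A (\<lambda>x. if x \<in> G then f x else 0))) \<longlongrightarrow> l2norm (A f))
    (finite_subsets_at_top UNIV)"
proof -
  obtain C where C: "\<And>f. f \<in> ell2 X \<Longrightarrow> l2norm (A f) \<le> C * l2norm f"
    using bounded_ops_bound[OF A] by blast
  let ?t = "\<lambda>G x. if x \<in> G then f x else 0"
  have "norm (l2norm (A (?t G)) - l2norm (A f)) \<le> l2norm (\<lambda>x. f x - ?t G x) * C" for G
  proof -
    have t: "?t G \<in> ell2 X" using f by simp
    let ?d = "A (\<lambda>x. f x - ?t G x)"
    have d: "?d = (\<lambda>x. A f x - A (?t G) x)"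
      by (rule bounded_ops_diff[OF A f t])
    have "l2norm (\<lambda>x. A (?t G) x + ?d x) \<le> l2norm (A (?t G)) + l2norm ?d"
      by (rule l2norm_triangle[of _ X]) (simp_all add: A)
    then have 1: "l2norm (A f) \<le> l2norm (A (?t G)) + l2norm ?d" unfolding d by simp
    have "l2norm (\<lambda>x. A f x + -1 * ?d x) \<le> l2norm (A f) + l2norm (\<lambda>x. -1 * ?d x)"
      by (rule l2norm_triangle[of _ X]) (simp_all add: A del: mult_minus1)
    then have 2: "l2norm (A (?t G)) \<le> l2norm (A f) + l2norm ?d"
      unfolding l2norm_scale unfolding d by simp
    show ?thesis using 1 2 C[of "\<lambda>x. f x - ?t G x"] f t by (simp add: mult.commute)
  qed
  then have "((\<lambda>G. l2norm (A (?t G)) - l2norm (A f)) \<longlongrightarrow> 0) (finite_subsets_at_top UNIV)"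
    by (intro Lim_null_comparison[OF _ tendsto_mult_left_zero[OF l2norm_truncation[OF f]]]) auto
  then show ?thesis by (rule LIM_zero_cancel)
qed

lemma bounded_ops_comp [simp]:
  assumes "A \<in> bounded_ops X" "B \<in> bounded_ops X"
  shows "A \<circ> B \<in> bounded_ops X"
proof -
  obtain C where C: "0 \<le> C" "\<And>f. f \<in> ell2 X \<Longrightarrow> l2norm (A f) \<le> C * l2norm f"
    using bounded_ops_bound[OF assms(1)] by blast
  obtain D where D: "0 \<le> D" "\<And>f. f \<in> ell2 X \<Longrightarrow> l2norm (B f) \<le> D * l2norm f"
    using bounded_ops_bound[OF assms(2)] by blast
  show ?thesis
  proof (rule bounded_opsI)
    fix f assume "f \<in> ell2 X"
    have "l2norm (A (B f)) \<le> C * l2norm (B f)" using assms by (intro C) auto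
    also have "\<dots> \<le> C * (D * l2norm f)" by (intro mult_left_mono C(1) D(2)) fact
    finally show "l2norm ((A \<circ> B) f) \<le> (C * D) * l2norm f" by (simp add: mult.assoc)
  qed (use assms in \<open>auto simp: bounded_ops_add bounded_ops_scale bounded_ops_outside
         bounded_ops_zero\<close>)
qed

lemma zero_op_bounded [simp]: "zero_op \<in> bounded_ops X"
  by (rule bounded_opsI[where K = 0]) (auto simp: zero_op_def)

lemma id_op_bounded [simp]: "id_op X \<in> bounded_ops X"
  by (rule bounded_opsI[where K = 1]) (auto simp: id_op_def)

lemma ketbra_bounded [simp]:
  assumes "\<psi> \<in> ell2 X" "\<phi> \<in> ell2 X"
  shows "ketbra X \<psi> \<phi> \<in> bounded_ops X"
proof (rule bounded_opsI)
  fix f assume f: "f \<in> ell2 X"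
  have "ketbra X \<psi> \<phi> f = (\<lambda>x. cinner \<phi> f * \<psi> x)" using f by (auto simp: ketbra_def)
  then have "l2norm (ketbra X \<psi> \<phi> f) = cmod (cinner \<phi> f) * l2norm \<psi>"
    by (simp only: l2norm_scale)
  also have "\<dots> \<le> (l2norm \<phi> * l2norm f) * l2norm \<psi>"
    by (intro mult_right_mono Cauchy_Schwarz_cinner[OF assms(2) f]) auto
  finally show "l2norm (ketbra X \<psi> \<phi> f) \<le> (l2norm \<phi> * l2norm \<psi>) * l2norm f"
    by (simp add: mult_ac)
next
  fix f assume "f \<in> ell2 X"
  then show "ketbra X \<psi> \<phi> f \<in> ell2 X"
    using ell2_scale[OF assms(1), of "cinner \<phi> f"] by (simp add: ketbra_def mult.commute)
qed (use assms in \<open>auto simp: ketbra_def cinner_add_right[OF assms(2)] cinner_scale_right fun_eq_iff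
       algebra_simps\<close>)

text \<open>Each coordinate of \<open>A f\<close> is a bounded functional of \<open>f\<close>, so an
  operator is determined by its matrix in the basis.\<close>

lemma bounded_ops_has_sum:
  assumes "A \<in> bounded_ops X" "f \<in> ell2 X"
  shows "((\<lambda>y. f y * A (ket y) x) has_sum A f x) X"
proof -
  obtain C where C: "0 \<le> C" "\<And>f. f \<in> ell2 X \<Longrightarrow> l2norm (A f) \<le> C * l2norm f"
    using bounded_ops_bound[OF assms(1)] by blast
  have "cmod (A g x) \<le> C * l2norm g" if "g \<in> ell2 X" for g
    using cmod_le_l2norm[of "A g" X x] C(2)[OF that] assms(1) by simp
  then show ?thesis
    by (intro functional_has_sum[where \<phi> = "\<lambda>f. A f x" and C = C] assms)
       (auto simp: bounded_ops_add[OF assms(1)] bounded_ops_scale[OF assms(1)])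
qed

lemma bounded_ops_eqI:
  assumes "A \<in> bounded_ops X" "B \<in> bounded_ops X" "\<And>x. x \<in> X \<Longrightarrow> A (ket x) = B (ket x)"
  shows "A = B"
proof (intro ext)
  fix f x show "A f x = B f x"
  proof (cases "f \<in> ell2 X")
    case True
    have "((\<lambda>y. f y * A (ket y) x) has_sum B f x) X"
      using bounded_ops_has_sum[OF assms(2) True, of x] assms(3)
      by (subst has_sum_cong[of _ _ "\<lambda>y. f y * B (ket y) x"]) auto
    then show ?thesis using bounded_ops_has_sum[OF assms(1) True, of x] has_sum_unique by blast
  next
    case False
    then show ?thesis using assms(1,2) by (metis bounded_ops_outside)
  qed
qed

text \<open>The coordinates used to define \<open>adj\<close> are those of the Riesz vector of the
  functional taking \<open>f\<close> to \<open>cinner g (A f)\<close>. Square summability,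
  boundedness and the adjoint identity all come from that representation.\<close>

lemma
  assumes A: "A \<in> bounded_ops X"
  shows adj_bounded [simp]: "adj X A \<in> bounded_ops X"
    and cinner_adj: "\<And>f g. f \<in> ell2 X \<Longrightarrow> g \<in> ell2 X \<Longrightarrow> cinner (adj X A g) f = cinner g (A f)"
proof -
  obtain C where C: "0 \<le> C" "\<And>f. f \<in> ell2 X \<Longrightarrow> l2norm (A f) \<le> C * l2norm f"
    using bounded_ops_bound[OF A] by blast
  have r: "adj X A g = (\<lambda>y. if y \<in> X then cnj (cinner g (A (ket y))) else 0)"
    if "g \<in> ell2 X" for g
    using that by (auto simp: adj_def cinner_commute[of _ g] fun_eq_iff)
  have b: "cmod (cinner g (A f)) \<le> C * l2norm g * l2norm f" if "g \<in> ell2 X" "f \<in> ell2 X" for f g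
  proof -
    have "cmod (cinner g (A f)) \<le> l2norm g * l2norm (A f)"
      using that A by (intro Cauchy_Schwarz_cinner[of _ X]) auto
    also have "\<dots> \<le> l2norm g * (C * l2norm f)" by (intro mult_left_mono C that) auto
    finally show ?thesis by (simp add: mult_ac)
  qed
  have R: "adj X A g \<in> ell2 X \<and> l2norm (adj X A g) \<le> C * l2norm g \<and>
      (\<forall>f\<in>ell2 X. cinner g (A f) = cinner (adj X A g) f)"
    if g: "g \<in> ell2 X" for g
    unfolding r[OF g]
    by (intro conjI ballI functional_representation[of X "\<lambda>f. cinner g (A f)" "C * l2norm g"])
       (use g A C(1) in \<open>auto simp: bounded_ops_add bounded_ops_scale cinner_scale_right b
          cinner_add_right[of g X]\<close>)
  show "cinner (adj X A g) f = cinner g (A f)" if "f \<in> ell2 X" "g \<in> ell2 X" for f g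
    using R[OF that(2)] that(1) by simp
  show "adj X A \<in> bounded_ops X"
  proof (rule bounded_opsI)
    fix f g assume "f \<in> ell2 X" "g \<in> ell2 X"
    then show "adj X A (\<lambda>x. f x + g x) = (\<lambda>x. adj X A f x + adj X A g x)"
      using A by (auto simp: adj_def cinner_add_right[of _ X] fun_eq_iff)
  qed (use R in \<open>auto simp: adj_def cinner_scale_right\<close>)
qed

lemma cinner_adj_right:
  "A \<in> bounded_ops X \<Longrightarrow> f \<in> ell2 X \<Longrightarrow> g \<in> ell2 X \<Longrightarrow> cinner f (adj X A g) = cinner (A f) g"
  using cinner_adj[of A X f g] by (metis cinner_commute)

lemma adj_eqI:
  assumes "A \<in> bounded_ops X" "B \<in> bounded_ops X"
    and "\<And>f g. f \<in> ell2 X \<Longrightarrow> g \<in> ell2 X \<Longrightarrow> cinner (A f) g = cinner f (B g)"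
  shows "adj X A = B"
proof
  fix g show "adj X A g = B g"
  proof (cases "g \<in> ell2 X")
    case True
    then show ?thesis using assms
      by (intro ell2_eqI[of _ X]) (auto simp: cinner_adj_right)
  qed (use assms bounded_ops_outside[of "adj X A" X g] bounded_ops_outside[of B X g] in simp)
qed

lemma adj_comp:
  assumes "A \<in> bounded_ops X" "B \<in> bounded_ops X"
  shows "adj X (A \<circ> B) = adj X B \<circ> adj X A"
  using assms by (intro adj_eqI) (auto simp: cinner_adj_right)

lemma adj_ketbra:
  assumes "\<psi> \<in> ell2 X" "\<phi> \<in> ell2 X"
  shows "adj X (ketbra X \<psi> \<phi>) = ketbra X \<phi> \<psi>"
proof (rule adj_eqI)
  fix f g assume fg: "f \<in> ell2 X" "g \<in> ell2 X"
  have "cinner (ketbra X \<psi> \<phi> f) g = cinner (\<lambda>x. cinner \<phi> f * \<psi> x) g"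
    using fg by (simp add: ketbra_def mult.commute)
  also have "\<dots> = cnj (cinner \<phi> f) * cinner \<psi> g" by (rule cinner_scale_left)
  also have "\<dots> = cinner f (\<lambda>x. cinner \<psi> g * \<phi> x)"
    unfolding cinner_scale_right cinner_commute[of f \<phi>] by (rule mult.commute)
  also have "\<dots> = cinner f (ketbra X \<phi> \<psi> g)"
    using fg by (simp add: ketbra_def mult.commute)
  finally show "cinner (ketbra X \<psi> \<phi> f) g = cinner f (ketbra X \<phi> \<psi> g)" .
qed (use assms in auto)

subsection \<open>Positive operators of finite trace\<close>

text \<open>Partial densities without the bound 1 on the trace: additivity has to be stated on a set
  closed under sums.\<close>

definition trace_pos :: "'x set \<Rightarrow> 'x oper set" where
  "trace_pos X = {\<rho>. positive_op X \<rho> \<and> (\<lambda>x. Re (\<rho> (ket x) x)) summable_on X}"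

definition op_trace :: "'x set \<Rightarrow> 'x oper \<Rightarrow> real" where
  "op_trace X \<rho> = (\<Sum>\<^sub>\<infinity>x\<in>X. Re (\<rho> (ket x) x))"

definition op_add :: "'x oper \<Rightarrow> 'x oper \<Rightarrow> 'x oper" where
  "op_add \<rho> \<sigma> = (\<lambda>f x. \<rho> f x + \<sigma> f x)"

lemma partial_density_trace_pos: "partial_density X \<subseteq> trace_pos X"
  by (auto simp: partial_density_def trace_pos_def)

lemma positive_op_bounded: "positive_op X R \<Longrightarrow> R \<in> bounded_ops X"
  by (simp add: positive_op_def)

lemma positive_op_nonneg: "positive_op X R \<Longrightarrow> f \<in> ell2 X \<Longrightarrow> cinner f (R f) \<in> \<real>\<^sub>\<ge>\<^sub>0"
  by (simp add: positive_op_def)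

text \<open>Polarization: the quadratic form is real at \<open>f + g\<close> and at
  \<open>f + \<i> g\<close>, which fixes the imaginary and the real part of the two mixed
  terms.\<close>

lemma positive_op_hermitian:
  assumes R: "positive_op X R" and f: "f \<in> ell2 X" and g: "g \<in> ell2 X"
  shows "cinner g (R f) = cnj (cinner f (R g))"
proof -
  note B = positive_op_bounded[OF R]
  have real: "Im (cinner h (R h)) = 0" if "h \<in> ell2 X" for h
    using positive_op_nonneg[OF R that] by (simp add: complex_nonneg_Reals_iff)
  have expand: "cinner (\<lambda>x. f x + c * g x) (R (\<lambda>x. f x + c * g x)) =
      cinner f (R f) + c * cinner f (R g) + cnj c * cinner g (R f) + (cnj c * c) * cinner g (R g)"
    for c
  proof -
    have "R (\<lambda>x. f x + c * g x) = (\<lambda>x. R f x + c * R g x)"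
      using f g by (simp add: bounded_ops_add[OF B] bounded_ops_scale[OF B])
    then show ?thesis
      using f g B
      by (simp add: cinner_add_left[of _ X] cinner_add_right[of _ X] cinner_scale_left
          cinner_scale_right algebra_simps)
  qed
  have "Im (cinner f (R g) + cinner g (R f)) = 0"
    using real[of "\<lambda>x. f x + 1 * g x"] real[OF f] real[OF g] f g unfolding expand by simp
  moreover have "Im (\<i> * cinner f (R g) - \<i> * cinner g (R f)) = 0"
    using real[of "\<lambda>x. f x + \<i> * g x"] real[OF f] real[OF g] f g unfolding expand by simp
  ultimately show ?thesis by (auto simp: complex_eq_iff)
qed

lemma positive_op_Cauchy_Schwarz:
  assumes R: "positive_op X R" and f: "f \<in> ell2 X" and g: "g \<in> ell2 X"
  shows "(cmod (cinner f (R g)))\<^sup>2 \<le> Re (cinner f (R f)) * Re (cinner g (R g))"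
proof -
  note B = positive_op_bounded[OF R]
  define a b c where "a = Re (cinner f (R f))" "b = cinner f (R g)" "c = Re (cinner g (R g))"
  have "0 \<le> c - 2 * s * (cmod b)\<^sup>2 + s\<^sup>2 * (cmod b)\<^sup>2 * a" for s :: real
  proof -
    \<comment> \<open>The factor \<open>b\<close> aligns the phases, so both mixed terms become real
      and the form is a real quadratic polynomial in \<open>s\<close>.\<close>
    define z where "z = - of_real s * b"
    have "R (\<lambda>x. g x + z * f x) = (\<lambda>x. R g x + z * R f x)"
      using f g by (simp add: bounded_ops_add[OF B] bounded_ops_scale[OF B])
    then have "cinner (\<lambda>x. g x + z * f x) (R (\<lambda>x. g x + z * f x)) =
        cinner g (R g) + z * cinner g (R f) + cnj z * cinner f (R g)
        + (cnj z * z) * cinner f (R f)"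
      using f g B
      by (simp add: cinner_add_left[of _ X] cinner_add_right[of _ X] cinner_scale_left
          cinner_scale_right algebra_simps)
    also have "\<dots> = cinner g (R g) + z * cnj b + cnj z * b + (cnj z * z) * cinner f (R f)"
      using positive_op_hermitian[OF R f g] by (simp add: a_b_c_def)
    also have "\<dots> = cinner g (R g) - of_real (2 * s * (cmod b)\<^sup>2)
        + of_real (s\<^sup>2 * (cmod b)\<^sup>2) * cinner f (R f)"
    proof -
      have "z * cnj b = - of_real s * (b * cnj b)" "cnj z * b = - of_real s * (b * cnj b)"
        "cnj z * z = of_real s * of_real s * (b * cnj b)"
        by (simp_all add: z_def)
      then show ?thesis
        unfolding complex_norm_square[symmetric] by (simp add: power2_eq_square)
    qed
    finally have "Re (cinner (\<lambda>x. g x + z * f x) (R (\<lambda>x. g x + z * f x))) =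
        c - 2 * s * (cmod b)\<^sup>2 + s\<^sup>2 * (cmod b)\<^sup>2 * a"
      by (simp add: a_b_c_def(1,3) del: of_real_mult of_real_power)
    moreover have "cinner (\<lambda>x. g x + z * f x) (R (\<lambda>x. g x + z * f x)) \<in> \<real>\<^sub>\<ge>\<^sub>0"
      using f g by (intro positive_op_nonneg[OF R]) auto
    ultimately show ?thesis by (simp add: complex_nonneg_Reals_iff)
  qed
  note q = this
  have "0 \<le> a" using positive_op_nonneg[OF R f] by (simp add: a_b_c_def complex_nonneg_Reals_iff)
  have "(cmod b)\<^sup>2 \<le> a * c"
  proof (cases "a = 0")
    case True
    have "\<not> 0 < (cmod b)\<^sup>2"
    proof
      assume "0 < (cmod b)\<^sup>2"
      then show False
        \<comment> \<open>With \<open>a = 0\<close> the polynomial is affine in \<open>s\<close>; at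
          this value it equals -1.\<close>
        using q[of "(c + 1) / (2 * (cmod b)\<^sup>2)"] True by (simp add: field_simps)
    qed
    then show ?thesis using True by simp
  next
    case False
    then show ?thesis
      \<comment> \<open>The minimizer of the quadratic polynomial.\<close>
      using q[of "1 / a"] \<open>0 \<le> a\<close> by (simp add: field_simps power2_eq_square)
  qed
  then show ?thesis by (simp add: a_b_c_def)
qed

lemma positive_op_diag_nonneg:
  assumes "positive_op X R" shows "0 \<le> Re (R (ket x) x)"
proof (cases "x \<in> X")
  case True
  then show ?thesis
    using positive_op_nonneg[OF assms, of "ket x"] by (simp add: complex_nonneg_Reals_iff)
next
  case False
  then show ?thesis
    using bounded_ops_outside[OF positive_op_bounded[OF assms], of "ket x"] by simp
qed

lemma trace_pos_positive: "\<rho> \<in> trace_pos X \<Longrightarrow> positive_op X \<rho>"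
  by (simp add: trace_pos_def)

lemma trace_pos_bounded [simp]: "\<rho> \<in> trace_pos X \<Longrightarrow> \<rho> \<in> bounded_ops X"
  by (simp add: trace_pos_def positive_op_def)

lemma trace_pos_has_sum:
  "\<rho> \<in> trace_pos X \<Longrightarrow> ((\<lambda>x. Re (\<rho> (ket x) x)) has_sum op_trace X \<rho>) X"
  by (simp add: trace_pos_def op_trace_def)

lemma op_trace_nonneg: "\<rho> \<in> trace_pos X \<Longrightarrow> 0 \<le> op_trace X \<rho>"
  unfolding op_trace_def by (intro infsum_nonneg positive_op_diag_nonneg trace_pos_positive)

lemma diag_le_op_trace: "\<rho> \<in> trace_pos X \<Longrightarrow> x \<in> X \<Longrightarrow> Re (\<rho> (ket x) x) \<le> op_trace X \<rho>"
  unfolding op_trace_def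
  using finite_sum_le_infsum[of "\<lambda>x. Re (\<rho> (ket x) x)" X "{x}"]
  by (auto simp: trace_pos_def positive_op_diag_nonneg)

text \<open>Cauchy-Schwarz for the form of \<rho> at two basis vectors bounds a matrix entry by the
  geometric mean of the two diagonal entries. The factor at \<open>x\<close> is kept explicit
  because its squares sum to the trace, so that the bound can be summed over
  \<open>x\<close>.\<close>

lemma trace_pos_entry_le:
  assumes \<rho>: "\<rho> \<in> trace_pos X" and f: "f \<in> ell2 X"
  shows "cmod (\<rho> f x) \<le> sqrt (Re (\<rho> (ket x) x)) * (sqrt (op_trace X \<rho>) * l2norm f)"
proof (cases "x \<in> X")
  case x: True
  note P = trace_pos_positive[OF \<rho>]
  \<comment> \<open>The vector of square roots of the diagonal; its squared norm is the trace, and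
    it dominates the matrix of \<rho> entrywise by products \<open>w x * w y\<close>.\<close>
  define w :: "'a vec" where "w = (\<lambda>y. if y \<in> X then of_real (sqrt (Re (\<rho> (ket y) y))) else 0)"
  have sq: "(cmod (w y))\<^sup>2 = (if y \<in> X then Re (\<rho> (ket y) y) else 0)" for y
    using positive_op_diag_nonneg[OF P] by (simp add: w_def)
  have w: "w \<in> ell2 X \<and> l2norm w \<le> sqrt (op_trace X \<rho>)"
  proof -
    have *: "(\<Sum>y\<in>F. (cmod (w y))\<^sup>2) \<le> (sqrt (op_trace X \<rho>))\<^sup>2"
      if F: "finite F" "F \<subseteq> X" for F
    proof -
      have "(\<Sum>y\<in>F. (cmod (w y))\<^sup>2) = (\<Sum>y\<in>F. Re (\<rho> (ket y) y))"
        using F by (intro sum.cong) (auto simp: sq)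
      also have "\<dots> \<le> op_trace X \<rho>"
        unfolding op_trace_def using F \<rho> P
        by (intro finite_sum_le_infsum) (auto simp: trace_pos_def positive_op_diag_nonneg)
      finally show ?thesis
        using op_trace_nonneg[OF \<rho>] by simp
    qed
    then show ?thesis
      using ell2_bounded_sums[of X w "sqrt (op_trace X \<rho>)"] op_trace_nonneg[OF \<rho>]
      by (auto simp: w_def)
  qed
  have entry: "cmod (\<rho> (ket y) x) \<le> cmod (w x) * cmod (w y)" if "y \<in> X" for y
  proof -
    have "(cmod (\<rho> (ket y) x))\<^sup>2 \<le> Re (\<rho> (ket x) x) * Re (\<rho> (ket y) y)"
      using positive_op_Cauchy_Schwarz[OF P, of "ket x" "ket y"] x that by simp
    then have "(cmod (\<rho> (ket y) x))\<^sup>2 \<le> (cmod (w x) * cmod (w y))\<^sup>2"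
      using x that by (simp add: power_mult_distrib sq)
    then show ?thesis by (simp add: power2_le_iff_abs_le)
  qed
  have fx: "((\<lambda>y. f y * \<rho> (ket y) x) has_sum \<rho> f x) X"
    using \<rho> f by (intro bounded_ops_has_sum) auto
  have le: "(\<Sum>y\<in>F. cmod (f y * \<rho> (ket y) x)) \<le> cmod (w x) * (l2norm w * l2norm f)"
    if "finite F" "F \<subseteq> X" for F
  proof -
    have "(\<Sum>y\<in>F. cmod (f y * \<rho> (ket y) x)) \<le> (\<Sum>y\<in>F. cmod (w x) * (\<bar>cmod (w y)\<bar> * \<bar>cmod (f y)\<bar>))"
      using that mult_left_mono[OF entry norm_ge_zero, of _ "f _"]
      by (intro sum_mono) (auto simp: norm_mult mult_ac subset_iff)
    also have "\<dots> = cmod (w x) * (\<Sum>y\<in>F. \<bar>cmod (w y)\<bar> * \<bar>cmod (f y)\<bar>)"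
      by (simp add: sum_distrib_left)
    also have "\<dots> \<le> cmod (w x) * (L2_set (\<lambda>y. cmod (w y)) F * L2_set (\<lambda>y. cmod (f y)) F)"
      by (intro mult_left_mono L2_set_mult_ineq) auto
    also have "\<dots> \<le> cmod (w x) * (l2norm w * l2norm f)"
      by (rule mult_left_mono[OF mult_mono[OF L2_set_le_l2norm L2_set_le_l2norm]])
         (use w f in auto)
    finally show ?thesis .
  qed
  have "(\<lambda>y. cmod (f y * \<rho> (ket y) x)) summable_on X"
    by (rule nonneg_bdd_above_summable_on) (auto intro!: bdd_aboveI2 le)
  then have "cmod (\<rho> f x) \<le> (\<Sum>\<^sub>\<infinity>y\<in>X. cmod (f y * \<rho> (ket y) x))"
    using norm_infsum_bound[of "\<lambda>y. f y * \<rho> (ket y) x" X] infsumI[OF fx] by simp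
  also have "\<dots> \<le> cmod (w x) * (l2norm w * l2norm f)"
    by (rule infsum_le_finite_sums) (use le in \<open>auto intro!: nonneg_bdd_above_summable_on bdd_aboveI2\<close>)
  also have "\<dots> \<le> cmod (w x) * (sqrt (op_trace X \<rho>) * l2norm f)"
    using w by (intro mult_left_mono mult_right_mono) auto
  also have "cmod (w x) = sqrt (Re (\<rho> (ket x) x))"
    using x positive_op_diag_nonneg[OF P] by (simp add: w_def)
  finally show ?thesis .
next
  case False
  then show ?thesis
    using \<rho> positive_op_diag_nonneg[OF trace_pos_positive[OF \<rho>]] op_trace_nonneg[OF \<rho>]
    by (simp add: ell2_outside[of "\<rho> f" X])
qed

text \<open>Squaring the entry bound and summing over coordinates turns the diagonal factors into a
  second trace: the operator norm is at most the trace.\<close>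

lemma
  assumes \<rho>: "\<rho> \<in> trace_pos X" and f: "f \<in> ell2 X"
  shows trace_pos_coord_le: "cmod (\<rho> f x) \<le> op_trace X \<rho> * l2norm f"
    and trace_pos_norm_le: "l2norm (\<rho> f) \<le> op_trace X \<rho> * l2norm f"
    and trace_pos_quadratic_le: "Re (cinner f (\<rho> f)) \<le> op_trace X \<rho> * (l2norm f)\<^sup>2"
proof -
  note t = op_trace_nonneg[OF \<rho>] and P = trace_pos_positive[OF \<rho>]
  show n: "l2norm (\<rho> f) \<le> op_trace X \<rho> * l2norm f"
  proof (rule ell2_bounded_sums[of X])
    fix F assume F: "finite F" "F \<subseteq> X"
    have "(\<Sum>x\<in>F. (cmod (\<rho> f x))\<^sup>2) \<le>
        (\<Sum>x\<in>F. (sqrt (Re (\<rho> (ket x) x)) * (sqrt (op_trace X \<rho>) * l2norm f))\<^sup>2)"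
      by (intro sum_mono power_mono trace_pos_entry_le \<rho> f) auto
    also have "\<dots> = (\<Sum>x\<in>F. Re (\<rho> (ket x) x)) * (op_trace X \<rho> * (l2norm f)\<^sup>2)"
      using t positive_op_diag_nonneg[OF P] by (simp add: power_mult_distrib sum_distrib_right)
    also have "\<dots> \<le> op_trace X \<rho> * (op_trace X \<rho> * (l2norm f)\<^sup>2)"
      unfolding op_trace_def using F \<rho> P t
      by (intro mult_right_mono finite_sum_le_infsum)
         (auto simp: trace_pos_def positive_op_diag_nonneg op_trace_def)
    finally show "(\<Sum>x\<in>F. (cmod (\<rho> f x))\<^sup>2) \<le> (op_trace X \<rho> * l2norm f)\<^sup>2"
      by (simp add: power_mult_distrib power2_eq_square mult_ac)
  qed (use \<rho> t f in \<open>auto simp: ell2_outside[of "\<rho> f" X]\<close>)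
  show "cmod (\<rho> f x) \<le> op_trace X \<rho> * l2norm f"
    using cmod_le_l2norm[of "\<rho> f" X x] n \<rho> by simp
  have "Re (cinner f (\<rho> f)) \<le> cmod (cinner f (\<rho> f))" by (rule complex_Re_le_cmod)
  also have "\<dots> \<le> l2norm f * l2norm (\<rho> f)"
    using \<rho> f by (intro Cauchy_Schwarz_cinner[of _ X]) auto
  also have "\<dots> \<le> l2norm f * (op_trace X \<rho> * l2norm f)"
    using n by (intro mult_left_mono) auto
  finally show "Re (cinner f (\<rho> f)) \<le> op_trace X \<rho> * (l2norm f)\<^sup>2"
    by (simp add: power2_eq_square mult_ac)
qed

subsection \<open>Decomposition into rank-one operators\<close>

text \<open>Column \<open>x\<close> of \<open>R\<close> scaled by the square root of its pivot. At
  pivot 0 the convention \<open>1 / 0 = 0\<close> gives the zero vector, so elimination there does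
  nothing.\<close>

definition chol_vec :: "'x oper \<Rightarrow> 'x \<Rightarrow> 'x vec" where
  "chol_vec R x = (\<lambda>y. of_real (1 / sqrt (Re (R (ket x) x))) * R (ket x) y)"

text \<open>The Schur complement of the diagonal entry at \<open>x\<close>: one step of Cholesky
  elimination.\<close>

definition chol_step :: "'x set \<Rightarrow> 'x \<Rightarrow> 'x oper \<Rightarrow> 'x oper" where
  "chol_step X x R = (\<lambda>f y. R f y - ketbra X (chol_vec R x) (chol_vec R x) f y)"

lemma bounded_ops_minus:
  assumes A: "A \<in> bounded_ops X" and B: "B \<in> bounded_ops X"
  shows "(\<lambda>f x. A f x - B f x) \<in> bounded_ops X"
proof -
  obtain C where C: "0 \<le> C" "\<And>f. f \<in> ell2 X \<Longrightarrow> l2norm (A f) \<le> C * l2norm f"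
    using bounded_ops_bound[OF A] by blast
  obtain D where D: "0 \<le> D" "\<And>f. f \<in> ell2 X \<Longrightarrow> l2norm (B f) \<le> D * l2norm f"
    using bounded_ops_bound[OF B] by blast
  show ?thesis
  proof (rule bounded_opsI)
    fix f assume f: "f \<in> ell2 X"
    have "l2norm (\<lambda>x. A f x + -1 * B f x) \<le> l2norm (A f) + l2norm (\<lambda>x. -1 * B f x)"
      using A B by (intro l2norm_triangle[of _ X] ell2_scale) auto
    also have "\<dots> = l2norm (A f) + l2norm (B f)" by (simp only: l2norm_scale) simp
    also have "\<dots> \<le> (C + D) * l2norm f" using C(2)[OF f] D(2)[OF f] by (simp add: distrib_right)
    finally show "l2norm (\<lambda>x. A f x - B f x) \<le> (C + D) * l2norm f" by simp
  qed (use A B in \<open>auto simp: bounded_ops_add bounded_ops_scale bounded_ops_outside fun_eq_iff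
         algebra_simps\<close>)
qed

lemma chol_vec_ell2 [simp]: "R \<in> bounded_ops X \<Longrightarrow> chol_vec R x \<in> ell2 X"
  unfolding chol_vec_def by (intro ell2_scale) simp

text \<open>Positivity of the Schur complement is Cauchy-Schwarz for the form of \<open>R\<close> at
  \<open>f\<close> and \<open>ket x\<close>, divided by the pivot. The pivot entry disappears
  because the scaled column has squared modulus equal to the pivot at \<open>x\<close>.\<close>

lemma
  assumes R: "positive_op X R"
  shows chol_step_form: "\<And>f. f \<in> ell2 X \<Longrightarrow>
        cinner f (chol_step X x R f) =
        cinner f (R f) - of_real ((cmod (cinner (chol_vec R x) f))\<^sup>2)"
    and chol_step_positive: "positive_op X (chol_step X x R)"
    and chol_step_diag: "Re (chol_step X x R (ket x) x) = 0"
proof -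
  note B = positive_op_bounded[OF R]
  let ?v = "chol_vec R x" and ?a = "Re (R (ket x) x)"
  have B': "chol_step X x R \<in> bounded_ops X"
    unfolding chol_step_def using B by (intro bounded_ops_minus) auto
  show form: "cinner f (chol_step X x R f) =
      cinner f (R f) - of_real ((cmod (cinner ?v f))\<^sup>2)" if f: "f \<in> ell2 X" for f
  proof -
    have "cinner f (chol_step X x R f) = cinner f (R f) - cinner f (ketbra X ?v ?v f)"
      unfolding chol_step_def using f B by (intro cinner_diff_right) auto
    also have "ketbra X ?v ?v f = (\<lambda>y. cinner ?v f * ?v y)"
      using f by (simp add: ketbra_def mult.commute)
    also have "cinner f \<dots> = cinner ?v f * cnj (cinner ?v f)"
      unfolding cinner_scale_right cinner_commute[of f ?v] ..
    finally show ?thesis by (simp only: complex_norm_square)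
  qed
  have a: "0 \<le> ?a" by (rule positive_op_diag_nonneg[OF R])
  have le: "(cmod (cinner ?v f))\<^sup>2 \<le> Re (cinner f (R f))" if f: "f \<in> ell2 X" for f
  proof (cases "x \<in> X \<and> ?a \<noteq> 0")
    case True
    have "cinner ?v f = of_real (1 / sqrt ?a) * cinner (R (ket x)) f"
      unfolding chol_vec_def cinner_scale_left by simp
    then have "(cmod (cinner ?v f))\<^sup>2 = (cmod (cinner f (R (ket x))))\<^sup>2 / ?a"
      using a by (subst cinner_commute) (simp add: norm_mult power_mult_distrib power_divide
          norm_divide)
    also have "\<dots> \<le> Re (cinner f (R f))"
      using positive_op_Cauchy_Schwarz[OF R f, of "ket x"] a True by (simp add: divide_le_eq)
    finally show ?thesis .
  next
    case False
    \<comment> \<open>Two reasons: outside \<open>X\<close> the column \<open>R (ket x)\<close> is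
      zero, and at a zero pivot the scaling factor is.\<close>
    then have "?v = (\<lambda>_. 0)"
      using bounded_ops_outside[OF B, of "ket x"] by (auto simp: chol_vec_def)
    then show ?thesis
      using positive_op_nonneg[OF R f] by (simp add: complex_nonneg_Reals_iff)
  qed
  show "positive_op X (chol_step X x R)"
    unfolding positive_op_def
    using B' le positive_op_nonneg[OF R] by (auto simp: form complex_nonneg_Reals_iff)
  show "Re (chol_step X x R (ket x) x) = 0"
  proof (cases "x \<in> X \<and> ?a \<noteq> 0")
    case True
    have "Im (R (ket x) x) = 0"
      using True positive_op_nonneg[OF R, of "ket x"] by (simp add: complex_nonneg_Reals_iff)
    then have "R (ket x) x = of_real ?a" by (simp add: complex_eq_iff)
    then have "cmod (R (ket x) x) = ?a" using a by (metis norm_of_real abs_of_nonneg)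
    then have "(cmod (?v x))\<^sup>2 = ?a"
      using a by (simp add: chol_vec_def norm_mult norm_divide power_divide power2_eq_square)
    then show ?thesis using form[of "ket x"] True by simp
  next
    case False
    show ?thesis
    proof (cases "x \<in> X")
      case True
      then have "?a = 0" using False by simp
      then show ?thesis
        using form[of "ket x"] True by (simp add: chol_vec_def)
    next
      case False
      then show ?thesis using bounded_ops_outside[OF B', of "ket x"] by simp
    qed
  qed
qed

text \<open>Tonelli's theorem: for nonnegative entries, summable row sums already give summability
  over the product, so the columns have the same total.\<close>

lemma has_sum_interchange_nonneg:
  fixes h :: "'a \<Rightarrow> 'b \<Rightarrow> real"
  assumes nonneg: "\<And>k x. k \<in> K \<Longrightarrow> x \<in> X \<Longrightarrow> 0 \<le> h k x"
    and rows: "\<And>k. k \<in> K \<Longrightarrow> ((\<lambda>x. h k x) has_sum b k) X"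
    and cols: "\<And>x. x \<in> X \<Longrightarrow> ((\<lambda>k. h k x) has_sum a x) K"
    and total: "(b has_sum s) K"
  shows "(a has_sum s) X"
proof -
  have "((\<lambda>(k, x). h k x) has_sum s) (K \<times> X)"
    using rows total nonneg
    by (intro has_sum_SigmaI[where g = b]) (auto intro!: summable_on_SigmaI simp: has_sum_imp_summable)
  then have "((\<lambda>(x, k). h k x) has_sum s) (X \<times> K)"
    using has_sum_swap[of "\<lambda>(k, x). h k x" K X s] by (simp add: case_prod_unfold)
  then show ?thesis
    by (rule has_sum_SigmaD) (use cols in auto)
qed

text \<open>Each diagonal entry is exhausted after finitely many steps, so Tonelli identifies the
  sum of the squared norms with the trace. Hence the traces of the positive remainders
  \<open>R n\<close> tend to 0, and since the trace dominates the quadratic form, the remainders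
  vanish as forms.\<close>

lemma trace_pos_decomposition:
  assumes \<rho>: "\<rho> \<in> trace_pos X"
  obtains v :: "nat \<Rightarrow> 'x vec" where "\<And>k. v k \<in> ell2 X"
    "\<And>f. f \<in> ell2 X \<Longrightarrow> ((\<lambda>k. (cmod (cinner (v k) f))\<^sup>2) has_sum Re (cinner f (\<rho> f))) UNIV"
    "((\<lambda>k. (l2norm (v k))\<^sup>2) has_sum op_trace X \<rho>) UNIV"
proof -
  have "countable {x \<in> X. Re (\<rho> (ket x) x) \<noteq> 0}"
    using \<rho> by (intro summable_countable_real) (auto simp: trace_pos_def)
  \<comment> \<open>Only covering the nonzero diagonal entries matters. The enumeration may repeat
    an index or meet an entry that is 0: such a pivot produces the zero vector.\<close>
  then obtain e :: "nat \<Rightarrow> 'x" where e: "{x \<in> X. Re (\<rho> (ket x) x) \<noteq> 0} \<subseteq> range e"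
    by (metis (no_types, lifting) empty_subsetI range_from_nat_into subset_refl)
  define R where "R = rec_nat \<rho> (\<lambda>n. chol_step X (e n))"
  define v where "v n = chol_vec (R n) (e n)" for n
  have R0: "R 0 = \<rho>" and RS: "R (Suc n) = chol_step X (e n) (R n)" for n
    by (simp_all add: R_def)
  have pos: "positive_op X (R n)" for n
    by (induction n) (auto simp: R0 RS trace_pos_positive[OF \<rho>] chol_step_positive)
  note bd = positive_op_bounded[OF pos]
  have v: "v k \<in> ell2 X" for k by (simp add: v_def bd)
  have form: "Re (cinner f (R n f)) = Re (cinner f (\<rho> f)) - (\<Sum>k<n. (cmod (cinner (v k) f))\<^sup>2)"
    if "f \<in> ell2 X" for f n
    using that by (induction n) (auto simp: R0 RS chol_step_form[OF pos] v_def)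
  have diag: "Re (R n (ket x) x) = Re (\<rho> (ket x) x) - (\<Sum>k<n. (cmod (v k x))\<^sup>2)"
    if "x \<in> X" for x n
    using form[of "ket x" n] that by simp
  have le: "(\<Sum>k<n. (cmod (cinner (v k) f))\<^sup>2) \<le> Re (cinner f (\<rho> f))" if "f \<in> ell2 X" for f n
    using form[OF that, of n] positive_op_nonneg[OF pos that, of n]
    by (simp add: complex_nonneg_Reals_iff)
  have cols: "((\<lambda>k. (cmod (v k x))\<^sup>2) has_sum Re (\<rho> (ket x) x)) UNIV" if x: "x \<in> X" for x
  proof -
    obtain m where m: "\<And>n. n \<ge> m \<Longrightarrow> Re (R n (ket x) x) = 0"
    proof (cases "Re (\<rho> (ket x) x) = 0")
      case True
      have "Re (R n (ket x) x) = 0" for n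
        using diag[OF x, of n] positive_op_diag_nonneg[OF pos, of n x] True
          sum_nonneg[of "{..<n}" "\<lambda>k. (cmod (v k x))\<^sup>2"] by simp
      then show ?thesis using that by blast
    next
      case False
      then obtain j where j: "x = e j" using e x by blast
      \<comment> \<open>\<open>x\<close> is the pivot of the step from \<open>R j\<close> to
        \<open>R (Suc j)\<close>, where its entry becomes 0; diagonal entries only decrease and stay
        nonnegative, so it remains 0.\<close>
      have "Re (R n (ket x) x) = 0" if "n \<ge> Suc j" for n
      proof -
        have "Re (R n (ket x) x) \<le> Re (R (Suc j) (ket x) x)"
          using that unfolding diag[OF x] by (intro diff_left_mono sum_mono2) auto
        also have "\<dots> = 0" unfolding RS j by (rule chol_step_diag[OF pos])
        finally show ?thesis using positive_op_diag_nonneg[OF pos, of n x] by simp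
      qed
      then show ?thesis using that by blast
    qed
    have "(\<lambda>k. (cmod (v k x))\<^sup>2) sums Re (\<rho> (ket x) x)"
      unfolding sums_def
    proof (rule tendsto_eventually)
      show "\<forall>\<^sub>F n in sequentially. (\<Sum>k<n. (cmod (v k x))\<^sup>2) = Re (\<rho> (ket x) x)"
        by (rule eventually_sequentiallyI[of m]) (use m diag[OF x] in simp)
    qed
    then show ?thesis by (rule sums_nonneg_imp_has_sum) simp
  qed
  have norms: "((\<lambda>k. (l2norm (v k))\<^sup>2) has_sum op_trace X \<rho>) UNIV"
  proof (rule has_sum_interchange_nonneg)
    show "((\<lambda>x. Re (\<rho> (ket x) x)) has_sum op_trace X \<rho>) X" by (rule trace_pos_has_sum[OF \<rho>])
    show "((\<lambda>x. (cmod (v k x))\<^sup>2) has_sum (l2norm (v k))\<^sup>2) X" for k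
      by (rule l2norm_has_sum[OF v])
  qed (use cols in auto)
  have tr: "R n \<in> trace_pos X \<and> op_trace X (R n) = op_trace X \<rho> - (\<Sum>k<n. (l2norm (v k))\<^sup>2)" for n
  proof -
    have "((\<lambda>x. (cmod (v k x))\<^sup>2) has_sum (l2norm (v k))\<^sup>2) X" for k
      by (rule l2norm_has_sum[OF v])
    then have "((\<lambda>x. \<Sum>k<n. (cmod (v k x))\<^sup>2) has_sum (\<Sum>k<n. (l2norm (v k))\<^sup>2)) X"
      by (induction n) (auto intro: has_sum_add)
    then have "((\<lambda>x. - (\<Sum>k<n. (cmod (v k x))\<^sup>2)) has_sum - (\<Sum>k<n. (l2norm (v k))\<^sup>2)) X"
      by (simp add: has_sum_uminus)
    from has_sum_add[OF trace_pos_has_sum[OF \<rho>] this]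
    have "((\<lambda>x. Re (R n (ket x) x)) has_sum (op_trace X \<rho> - (\<Sum>k<n. (l2norm (v k))\<^sup>2))) X"
      by (subst has_sum_cong[where g = "\<lambda>x. Re (\<rho> (ket x) x) + - (\<Sum>k<n. (cmod (v k x))\<^sup>2)"])
         (auto simp: diag)
    then show ?thesis
      using pos by (auto simp: trace_pos_def op_trace_def has_sum_imp_summable infsumI)
  qed
  have "((\<lambda>k. (cmod (cinner (v k) f))\<^sup>2) has_sum Re (cinner f (\<rho> f))) UNIV" if f: "f \<in> ell2 X" for f
  proof -
    \<comment> \<open>The trace of the remainder times the squared norm of \<open>f\<close>: the
      upper half of the squeeze for the form of the remainder.\<close>
    have "(\<lambda>n. (op_trace X \<rho> - (\<Sum>k<n. (l2norm (v k))\<^sup>2)) * (l2norm f)\<^sup>2) \<longlonglongrightarrow>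
        (op_trace X \<rho> - op_trace X \<rho>) * (l2norm f)\<^sup>2"
      by (intro tendsto_intros) (use has_sum_imp_sums[OF norms] in \<open>simp add: sums_def\<close>)
    then have lim: "(\<lambda>n. (op_trace X \<rho> - (\<Sum>k<n. (l2norm (v k))\<^sup>2)) * (l2norm f)\<^sup>2) \<longlonglongrightarrow> 0" by simp
    have "(\<lambda>n. Re (cinner f (\<rho> f)) - (\<Sum>k<n. (cmod (cinner (v k) f))\<^sup>2)) \<longlonglongrightarrow> 0"
    proof (rule tendsto_sandwich[OF _ _ tendsto_const lim])
      show "\<forall>\<^sub>F n in sequentially. 0 \<le> Re (cinner f (\<rho> f)) - (\<Sum>k<n. (cmod (cinner (v k) f))\<^sup>2)"
        using le[OF f] by simp
      show "\<forall>\<^sub>F n in sequentially. Re (cinner f (\<rho> f)) - (\<Sum>k<n. (cmod (cinner (v k) f))\<^sup>2)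
          \<le> (op_trace X \<rho> - (\<Sum>k<n. (l2norm (v k))\<^sup>2)) * (l2norm f)\<^sup>2"
        using trace_pos_quadratic_le[OF _ f, of "R _"] tr form[OF f] by simp
    qed
    from tendsto_diff[OF tendsto_const[of "Re (cinner f (\<rho> f))"] this]
    have "(\<lambda>k. (cmod (cinner (v k) f))\<^sup>2) sums Re (cinner f (\<rho> f))"
      by (simp add: sums_def)
    then show ?thesis by (rule sums_nonneg_imp_has_sum) simp
  qed
  with v norms show thesis by (intro that)
qed

subsection \<open>Additive trace-nonincreasing maps\<close>

lemma op_add_trace_pos [simp]:
  assumes \<rho>: "\<rho> \<in> trace_pos X" and \<sigma>: "\<sigma> \<in> trace_pos X"
  shows "op_add \<rho> \<sigma> \<in> trace_pos X"
proof -
  have "positive_op X (op_add \<rho> \<sigma>)"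
    unfolding positive_op_def
  proof
    show "op_add \<rho> \<sigma> \<in> bounded_ops X"
    proof (rule bounded_opsI)
      fix f assume f: "f \<in> ell2 X"
      have "l2norm (\<lambda>x. \<rho> f x + \<sigma> f x) \<le> l2norm (\<rho> f) + l2norm (\<sigma> f)"
        using \<rho> \<sigma> by (intro l2norm_triangle[of _ X]) auto
      also have "\<dots> \<le> (op_trace X \<rho> + op_trace X \<sigma>) * l2norm f"
        using trace_pos_norm_le[OF \<rho> f] trace_pos_norm_le[OF \<sigma> f] by (simp add: distrib_right)
      finally show "l2norm (op_add \<rho> \<sigma> f) \<le> (op_trace X \<rho> + op_trace X \<sigma>) * l2norm f"
        by (simp add: op_add_def)
    qed (use \<rho> \<sigma> in \<open>auto simp: op_add_def bounded_ops_add[OF trace_pos_bounded[OF \<rho>]]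
           bounded_ops_add[OF trace_pos_bounded[OF \<sigma>]] bounded_ops_scale[OF trace_pos_bounded[OF \<rho>]]
           bounded_ops_scale[OF trace_pos_bounded[OF \<sigma>]] bounded_ops_outside[of _ X]
           fun_eq_iff algebra_simps\<close>)
    show "\<forall>f\<in>ell2 X. cinner f (op_add \<rho> \<sigma> f) \<in> \<real>\<^sub>\<ge>\<^sub>0"
      using \<rho> \<sigma>
      by (auto simp: op_add_def cinner_add_right[of _ X] intro!: nonneg_Reals_add_I
          positive_op_nonneg[OF trace_pos_positive])
  qed
  moreover have "((\<lambda>x. Re (op_add \<rho> \<sigma> (ket x) x)) has_sum (op_trace X \<rho> + op_trace X \<sigma>)) X"
    using has_sum_add[OF trace_pos_has_sum[OF \<rho>] trace_pos_has_sum[OF \<sigma>]]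
    by (simp add: op_add_def)
  ultimately show "op_add \<rho> \<sigma> \<in> trace_pos X"
    by (auto simp: trace_pos_def has_sum_imp_summable)
qed

lemma op_add_zero [simp]: "op_add \<rho> zero_op = \<rho>" "op_add zero_op \<rho> = \<rho>"
  by (simp_all add: op_add_def zero_op_def)

lemma op_add_assoc: "op_add (op_add \<rho> \<sigma>) \<tau> = op_add \<rho> (op_add \<sigma> \<tau>)"
  by (simp add: op_add_def add.assoc)

lemma op_add_commute: "op_add \<rho> \<sigma> = op_add \<sigma> \<rho>"
  by (simp add: op_add_def add.commute)

lemma op_add_left_commute: "op_add \<rho> (op_add \<sigma> \<tau>) = op_add \<sigma> (op_add \<rho> \<tau>)"
  by (simp add: op_add_def add.left_commute)

lemma zero_op_apply [simp]: "zero_op f x = 0"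
  by (simp add: zero_op_def)

lemma zero_op_trace_pos [simp]: "zero_op \<in> trace_pos X" "op_trace X zero_op = 0"
  by (simp_all add: trace_pos_def positive_op_def op_trace_def cinner_def del: trace_pos_bounded)

section \<open>Conjugation by operators and Kraus families\<close>

abbreviation sandwich :: "'x set \<Rightarrow> 'x oper \<Rightarrow> 'x oper \<Rightarrow> 'x oper" where
  "sandwich X A \<rho> \<equiv> A \<circ> \<rho> \<circ> adj X A"

lemma sandwich_comp:
  "A \<in> bounded_ops X \<Longrightarrow> B \<in> bounded_ops X \<Longrightarrow>
   sandwich X A (sandwich X B \<rho>) = sandwich X (A \<circ> B) \<rho>"
  by (simp add: adj_comp o_assoc)

lemma sandwich_add:
  assumes "A \<in> bounded_ops X" "\<rho> \<in> bounded_ops X" "\<sigma> \<in> bounded_ops X"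
  shows "sandwich X A (op_add \<rho> \<sigma>) = op_add (sandwich X A \<rho>) (sandwich X A \<sigma>)"
  using assms by (simp add: op_add_def bounded_ops_add fun_eq_iff)

lemma sandwich_zero: "adj X zero_op = zero_op" "sandwich X zero_op \<rho> = zero_op"
  by (auto simp: zero_op_def adj_def fun_eq_iff)

text \<open>Conjugation replaces each vector \<open>v k\<close> of the decomposition by
  \<open>A (v k)\<close>. The decomposition is a parameter because traces for several operators are
  to be compared along the same vectors.\<close>

lemma sandwich_trace:
  assumes A: "A \<in> bounded_ops X" and \<rho>: "\<rho> \<in> trace_pos X"
    and v: "\<And>k. v k \<in> ell2 X"
    and form: "\<And>f. f \<in> ell2 X \<Longrightarrow>
      ((\<lambda>k. (cmod (cinner (v k) f))\<^sup>2) has_sum Re (cinner f (\<rho> f))) UNIV"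
    and norms: "((\<lambda>k. (l2norm (v k))\<^sup>2) has_sum op_trace X \<rho>) UNIV"
  shows "sandwich X A \<rho> \<in> trace_pos X"
    and "((\<lambda>k. (l2norm (A (v k)))\<^sup>2) has_sum op_trace X (sandwich X A \<rho>)) UNIV"
proof -
  obtain C where C: "0 \<le> C" "\<And>f. f \<in> ell2 X \<Longrightarrow> l2norm (A f) \<le> C * l2norm f"
    using bounded_ops_bound[OF A] by blast
  have "(l2norm (A (v k)))\<^sup>2 \<le> C\<^sup>2 * (l2norm (v k))\<^sup>2" for k
    using power_mono[OF C(2)[OF v]] by (simp add: power_mult_distrib)
  moreover have "(\<lambda>k. C\<^sup>2 * (l2norm (v k))\<^sup>2) summable_on UNIV"
    by (intro summable_on_cmult_right has_sum_imp_summable[OF norms])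
  ultimately have "(\<lambda>k. (l2norm (A (v k)))\<^sup>2) summable_on UNIV"
    by - (rule summable_on_comparison_test[where f = "\<lambda>k. C\<^sup>2 * (l2norm (v k))\<^sup>2"], auto)
  then obtain s where s: "((\<lambda>k. (l2norm (A (v k)))\<^sup>2) has_sum s) UNIV"
    using has_sum_infsum by blast
  have "positive_op X (sandwich X A \<rho>)"
    unfolding positive_op_def
  proof
    show "\<forall>f\<in>ell2 X. cinner f (sandwich X A \<rho> f) \<in> \<real>\<^sub>\<ge>\<^sub>0"
    proof
      fix f assume f: "f \<in> ell2 X"
      have "cinner f (sandwich X A \<rho> f) = cinner (adj X A f) (\<rho> (adj X A f))"
        using f A \<rho> by (simp add: cinner_adj)
      also have "\<dots> \<in> \<real>\<^sub>\<ge>\<^sub>0"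
        using A by (intro positive_op_nonneg[of X] trace_pos_positive \<rho>) auto
      finally show "cinner f (sandwich X A \<rho> f) \<in> \<real>\<^sub>\<ge>\<^sub>0" .
    qed
  qed (use A \<rho> in auto)
  moreover have sum: "((\<lambda>x. Re (sandwich X A \<rho> (ket x) x)) has_sum s) X"
  proof (rule has_sum_interchange_nonneg[OF _ _ _ s])
    show "((\<lambda>x. (cmod (A (v k) x))\<^sup>2) has_sum (l2norm (A (v k)))\<^sup>2) X" for k
      by (rule l2norm_has_sum[OF bounded_ops_ell2[OF A]])
    show "((\<lambda>k. (cmod (A (v k) x))\<^sup>2) has_sum Re (sandwich X A \<rho> (ket x) x)) UNIV"
      if x: "x \<in> X" for x
    proof -
      have "cinner (v k) (adj X A (ket x)) = cnj (A (v k) x)" for k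
        using A v x by (simp add: cinner_adj_right)
      moreover have "cinner (adj X A (ket x)) (\<rho> (adj X A (ket x))) = sandwich X A \<rho> (ket x) x"
        using A \<rho> x by (simp add: cinner_adj)
      ultimately show ?thesis
        using form[of "adj X A (ket x)"] A by simp
    qed
  qed auto
  ultimately show "sandwich X A \<rho> \<in> trace_pos X"
    by (auto simp: trace_pos_def has_sum_imp_summable)
  have "op_trace X (sandwich X A \<rho>) = s"
    unfolding op_trace_def by (rule infsumI[OF sum])
  then show "((\<lambda>k. (l2norm (A (v k)))\<^sup>2) has_sum op_trace X (sandwich X A \<rho>)) UNIV"
    using s by simp
qed

lemma sandwich_trace_pos [simp]:
  "A \<in> bounded_ops X \<Longrightarrow> \<rho> \<in> trace_pos X \<Longrightarrow> sandwich X A \<rho> \<in> trace_pos X"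
  by (metis trace_pos_decomposition sandwich_trace(1))

lemma has_sum_sum:
  fixes f :: "'i \<Rightarrow> 'a \<Rightarrow> 'b::topological_comm_monoid_add"
  assumes "\<And>i. i \<in> F \<Longrightarrow> (f i has_sum s i) A"
  shows "((\<lambda>x. \<Sum>i\<in>F. f i x) has_sum (\<Sum>i\<in>F. s i)) A"
  using assms by (induction F rule: infinite_finite_induct) (auto intro!: has_sum_add)

text \<open>The inequality saying that the sum of the products of adjoint and operator is at most
  the identity, tested on vectors and finite subfamilies so that no series of operators has to
  converge.\<close>

definition kraus_family :: "'x set \<Rightarrow> 'i set \<Rightarrow> ('i \<Rightarrow> 'x oper) \<Rightarrow> bool" where
  "kraus_family X I A \<longleftrightarrow> (\<forall>i\<in>I. A i \<in> bounded_ops X) \<and>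
     (\<forall>F f. finite F \<longrightarrow> F \<subseteq> I \<longrightarrow> f \<in> ell2 X \<longrightarrow> (\<Sum>i\<in>F. (l2norm (A i f))\<^sup>2) \<le> (l2norm f)\<^sup>2)"

text \<open>Along one decomposition of \<rho> both sides are sums over \<open>k\<close>, and the
  Kraus inequality at \<open>v k\<close> compares them term by term.\<close>

lemma kraus_trace_le:
  assumes A: "kraus_family X I A" and \<rho>: "\<rho> \<in> trace_pos X" and F: "finite F" "F \<subseteq> I"
  shows "(\<Sum>i\<in>F. op_trace X (sandwich X (A i) \<rho>)) \<le> op_trace X \<rho>"
proof -
  obtain v :: "nat \<Rightarrow> 'a vec" where v: "\<And>k. v k \<in> ell2 X"
    "\<And>f. f \<in> ell2 X \<Longrightarrow> ((\<lambda>k. (cmod (cinner (v k) f))\<^sup>2) has_sum Re (cinner f (\<rho> f))) UNIV"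
    "((\<lambda>k. (l2norm (v k))\<^sup>2) has_sum op_trace X \<rho>) UNIV"
    using trace_pos_decomposition[OF \<rho>] by blast
  have "((\<lambda>k. (l2norm (A i (v k)))\<^sup>2) has_sum op_trace X (sandwich X (A i) \<rho>)) UNIV" if "i \<in> F" for i
    using sandwich_trace(2)[OF _ \<rho> v] A F that by (auto simp: kraus_family_def)
  then have "((\<lambda>k. \<Sum>i\<in>F. (l2norm (A i (v k)))\<^sup>2) has_sum
      (\<Sum>i\<in>F. op_trace X (sandwich X (A i) \<rho>))) UNIV"
    by (rule has_sum_sum)
  then show ?thesis
    by (rule has_sum_mono[OF _ v(3)]) (use A F v(1) in \<open>auto simp: kraus_family_def\<close>)
qed

text \<open>The convergence theorem behind all infinite sums of the semantics: for positive
  operators with summable traces, the coordinatewise sum is again a positive operator of finite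
  trace, and the trace passes through the sum.\<close>

lemma
  assumes \<sigma>: "\<And>i. i \<in> I \<Longrightarrow> \<sigma> i \<in> trace_pos X"
    and sum: "(\<lambda>i. op_trace X (\<sigma> i)) summable_on I"
  shows op_sum_abs_summable: "\<And>f x. f \<in> ell2 X \<Longrightarrow> (\<lambda>i. cmod (\<sigma> i f x)) summable_on I"
    and op_sum_trace_pos: "op_sum I \<sigma> \<in> trace_pos X"
    and op_trace_op_sum: "op_trace X (op_sum I \<sigma>) = (\<Sum>\<^sub>\<infinity>i\<in>I. op_trace X (\<sigma> i))"
proof -
  define T where "T = (\<Sum>\<^sub>\<infinity>i\<in>I. op_trace X (\<sigma> i))"
  have t: "0 \<le> op_trace X (\<sigma> i)" if "i \<in> I" for i by (rule op_trace_nonneg[OF \<sigma>[OF that]])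
  have T: "0 \<le> T" unfolding T_def by (intro infsum_nonneg t)
  have d: "0 \<le> Re (\<sigma> i (ket x) x)" if "i \<in> I" for i x
    by (rule positive_op_diag_nonneg[OF trace_pos_positive[OF \<sigma>[OF that]]])
  note bd = trace_pos_bounded[OF \<sigma>]
  show abs: "(\<lambda>i. cmod (\<sigma> i f x)) summable_on I" if f: "f \<in> ell2 X" for f x
  proof (rule summable_on_comparison_test)
    show "(\<lambda>i. op_trace X (\<sigma> i) * l2norm f) summable_on I" by (intro summable_on_cmult_left sum)
  qed (use trace_pos_coord_le[OF \<sigma> f] in auto)
  note summ = abs_summable_summable[OF abs]
  define s where "s x = (\<Sum>\<^sub>\<infinity>i\<in>I. Re (\<sigma> i (ket x) x))" for x
  have diag: "((\<lambda>i. Re (\<sigma> i (ket x) x)) has_sum s x) I" if "x \<in> X" for x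
    unfolding s_def
  proof (rule has_sum_infsum, rule summable_on_comparison_test[OF sum])
    show "Re (\<sigma> i (ket x) x) \<le> op_trace X (\<sigma> i)" if "i \<in> I" for i
      by (rule diag_le_op_trace[OF \<sigma>[OF that] \<open>x \<in> X\<close>])
  qed (rule d)
  have trace: "(s has_sum T) X"
    by (rule has_sum_interchange_nonneg[OF _ trace_pos_has_sum[OF \<sigma>] diag])
       (use sum d in \<open>auto simp: T_def\<close>)
  have s_nonneg: "0 \<le> s x" for x unfolding s_def by (intro infsum_nonneg d)
  \<comment> \<open>Cauchy-Schwarz over the summation index: the entry bound of each summand is a
    product of two square roots, one summing to \<open>s x\<close> and the other to
    \<open>T\<close>. The factor \<open>sqrt (s x)\<close> keeps the bound square summable in
    \<open>x\<close>.\<close>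
  have coord: "cmod (op_sum I \<sigma> f x) \<le> sqrt (s x) * (sqrt T * l2norm f)"
    if f: "f \<in> ell2 X" and x: "x \<in> X" for f x
  proof -
    have "cmod (op_sum I \<sigma> f x) \<le> (\<Sum>\<^sub>\<infinity>i\<in>I. cmod (\<sigma> i f x))"
      unfolding op_sum_def by (rule norm_infsum_bound[OF abs[OF f]])
    also have "\<dots> \<le> sqrt (s x) * (sqrt T * l2norm f)"
    proof (rule infsum_le_finite_sums[OF abs[OF f]])
      fix F assume F: "finite F" "F \<subseteq> I"
      let ?a = "\<lambda>i. sqrt (Re (\<sigma> i (ket x) x))" and ?b = "\<lambda>i. sqrt (op_trace X (\<sigma> i))"
      have "(\<Sum>i\<in>F. cmod (\<sigma> i f x)) \<le> (\<Sum>i\<in>F. ?a i * (?b i * l2norm f))"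
        using F by (intro sum_mono trace_pos_entry_le \<sigma> f) auto
      also have "\<dots> = (\<Sum>i\<in>F. \<bar>?a i\<bar> * \<bar>?b i\<bar>) * l2norm f"
        unfolding sum_distrib_right using F d t by (intro sum.cong) auto
      also have "\<dots> \<le> (L2_set ?a F * L2_set ?b F) * l2norm f"
        by (intro mult_right_mono L2_set_mult_ineq) auto
      also have "\<dots> \<le> (sqrt (s x) * sqrt T) * l2norm f"
      proof (intro mult_right_mono mult_mono)
        have "(\<Sum>i\<in>F. (?a i)\<^sup>2) = (\<Sum>i\<in>F. Re (\<sigma> i (ket x) x))"
          using F d by (intro sum.cong) auto
        also have "\<dots> \<le> s x"
          using F d by (intro finite_sum_le_has_sum[OF diag[OF x]]) auto
        finally show "L2_set ?a F \<le> sqrt (s x)" by (simp add: L2_set_def)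
        have "(\<Sum>i\<in>F. (?b i)\<^sup>2) = (\<Sum>i\<in>F. op_trace X (\<sigma> i))"
          using F t by (intro sum.cong) auto
        also have "\<dots> \<le> T"
          unfolding T_def using F t by (intro finite_sum_le_infsum[OF sum]) auto
        finally show "L2_set ?b F \<le> sqrt T" by (simp add: L2_set_def)
      qed (use s_nonneg T in auto)
      finally show "(\<Sum>i\<in>F. cmod (\<sigma> i f x)) \<le> sqrt (s x) * (sqrt T * l2norm f)"
        by (simp add: mult.assoc)
    qed
    finally show ?thesis .
  qed
  have outside: "op_sum I \<sigma> f x = 0" if "x \<notin> X" for f x
    unfolding op_sum_def by (rule infsum_0) (rule ell2_outside[OF bounded_ops_ell2[OF bd] that])
  have ell: "op_sum I \<sigma> f \<in> ell2 X \<and> l2norm (op_sum I \<sigma> f) \<le> T * l2norm f"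
    if f: "f \<in> ell2 X" for f
  proof -
    have "(\<Sum>x\<in>F. (cmod (op_sum I \<sigma> f x))\<^sup>2) \<le> (T * l2norm f)\<^sup>2" if F: "finite F" "F \<subseteq> X" for F
    proof -
      have "(\<Sum>x\<in>F. (cmod (op_sum I \<sigma> f x))\<^sup>2) \<le> (\<Sum>x\<in>F. (sqrt (s x) * (sqrt T * l2norm f))\<^sup>2)"
        using F by (intro sum_mono power_mono coord f) auto
      also have "\<dots> = (\<Sum>x\<in>F. s x) * (T * (l2norm f)\<^sup>2)"
        using T s_nonneg by (simp add: power_mult_distrib sum_distrib_right)
      also have "\<dots> \<le> T * (T * (l2norm f)\<^sup>2)"
        using F s_nonneg T by (intro mult_right_mono finite_sum_le_has_sum[OF trace]) auto
      finally show ?thesis by (simp add: power_mult_distrib power2_eq_square mult_ac)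
    qed
    then show ?thesis
      using ell2_bounded_sums[of X "op_sum I \<sigma> f" "T * l2norm f"] outside T by auto
  qed
  have bounded: "op_sum I \<sigma> \<in> bounded_ops X"
  proof (rule bounded_opsI)
    fix f g assume f: "f \<in> ell2 X" and g: "g \<in> ell2 X"
    have "op_sum I \<sigma> (\<lambda>x. f x + g x) = (\<lambda>x. \<Sum>\<^sub>\<infinity>i\<in>I. \<sigma> i f x + \<sigma> i g x)"
      unfolding op_sum_def
      by (intro ext infsum_cong) (simp add: bounded_ops_add[OF bd f g])
    then show "op_sum I \<sigma> (\<lambda>x. f x + g x) = (\<lambda>x. op_sum I \<sigma> f x + op_sum I \<sigma> g x)"
      by (simp add: op_sum_def infsum_add summ f g)
  next
    fix f c assume f: "f \<in> ell2 X"
    have "op_sum I \<sigma> (\<lambda>x. c * f x) = (\<lambda>x. \<Sum>\<^sub>\<infinity>i\<in>I. c * \<sigma> i f x)"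
      unfolding op_sum_def
      by (intro ext infsum_cong) (simp add: bounded_ops_scale[OF bd f])
    then show "op_sum I \<sigma> (\<lambda>x. c * f x) = (\<lambda>x. c * op_sum I \<sigma> f x)"
      by (simp add: op_sum_def infsum_cmult_right')
  next
    fix f assume "f \<notin> ell2 X"
    then show "op_sum I \<sigma> f = (\<lambda>_. 0)"
      unfolding op_sum_def by (intro ext infsum_0) (simp add: bounded_ops_outside[OF bd])
  qed (use ell in auto)
  have pos: "cinner f (op_sum I \<sigma> f) \<in> \<real>\<^sub>\<ge>\<^sub>0" if f: "f \<in> ell2 X" for f
  proof -
    have row: "(\<lambda>x. cmod (cnj (f x) * \<sigma> i f x)) summable_on UNIV" if "i \<in> I" for i
      using that by (intro cinner_abs_summable[of _ X] f) (simp add: bd)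
    have "(\<lambda>i. \<Sum>\<^sub>\<infinity>x. cmod (cnj (f x) * \<sigma> i f x)) summable_on I"
    proof (rule summable_on_comparison_test)
      show "(\<lambda>i. op_trace X (\<sigma> i) * (l2norm f)\<^sup>2) summable_on I" by (intro summable_on_cmult_left sum)
      show "(\<Sum>\<^sub>\<infinity>x. cmod (cnj (f x) * \<sigma> i f x)) \<le> op_trace X (\<sigma> i) * (l2norm f)\<^sup>2" if i: "i \<in> I" for i
      proof -
        have "(\<Sum>\<^sub>\<infinity>x. cmod (cnj (f x) * \<sigma> i f x)) \<le> l2norm f * l2norm (\<sigma> i f)"
          using i by (intro cinner_abs_le[of _ X] f) (simp add: bd)
        also have "\<dots> \<le> l2norm f * (op_trace X (\<sigma> i) * l2norm f)"
          by (intro mult_left_mono trace_pos_norm_le \<sigma> i f) auto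
        finally show ?thesis by (simp add: power2_eq_square mult_ac)
      qed
    qed (simp add: infsum_nonneg)
    \<comment> \<open>Absolute summability over pairs permits exchanging the sum over
      \<open>i\<close> with the inner product, so positivity is inherited from the summands.\<close>
    then have "(\<lambda>(i, x). cmod (cnj (f x) * \<sigma> i f x)) summable_on I \<times> UNIV"
      using row by (intro summable_on_SigmaI[where g = "\<lambda>i. \<Sum>\<^sub>\<infinity>x. cmod (cnj (f x) * \<sigma> i f x)"])
        (auto simp del: norm_mult)
    then have "(\<lambda>(i, x). cnj (f x) * \<sigma> i f x) summable_on I \<times> UNIV"
      by (intro abs_summable_summable[of "\<lambda>(i, x). cnj (f x) * \<sigma> i f x"])
         (simp only: case_prod_unfold)
    then have "(\<Sum>\<^sub>\<infinity>i\<in>I. \<Sum>\<^sub>\<infinity>x. cnj (f x) * \<sigma> i f x) = (\<Sum>\<^sub>\<infinity>x. \<Sum>\<^sub>\<infinity>i\<in>I. cnj (f x) * \<sigma> i f x)"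
      by (rule infsum_swap_banach)
    then have "cinner f (op_sum I \<sigma> f) = (\<Sum>\<^sub>\<infinity>i\<in>I. cinner f (\<sigma> i f))"
      by (simp add: cinner_def op_sum_def infsum_cmult_right')
    moreover have "cinner f (\<sigma> i f) \<ge> 0" if "i \<in> I" for i
      using positive_op_nonneg[OF trace_pos_positive[OF \<sigma>[OF that]] f]
      by (simp add: complex_nonneg_Reals_iff less_eq_complex_def)
    \<comment> \<open>If the sum of the forms did not converge, \<open>infsum\<close> would give 0,
      so either case is nonnegative.\<close>
    ultimately have "cinner f (op_sum I \<sigma> f) \<ge> 0"
      by (cases "(\<lambda>i. cinner f (\<sigma> i f)) summable_on I")
         (auto simp: infsum_not_exists intro: infsum_nonneg_complex)
    then show ?thesis
      by (simp add: complex_nonneg_Reals_iff less_eq_complex_def)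
  qed
  have "Re (op_sum I \<sigma> (ket x) x) = s x" if "x \<in> X" for x
    unfolding op_sum_def s_def using that by (intro infsum_Re[symmetric] summ) simp
  then have tr: "((\<lambda>x. Re (op_sum I \<sigma> (ket x) x)) has_sum T) X"
    using trace by (subst has_sum_cong[where g = s]) auto
  show "op_sum I \<sigma> \<in> trace_pos X"
    using bounded pos has_sum_imp_summable[OF tr] unfolding trace_pos_def positive_op_def by blast
  show "op_trace X (op_sum I \<sigma>) = (\<Sum>\<^sub>\<infinity>i\<in>I. op_trace X (\<sigma> i))"
    unfolding T_def[symmetric] op_trace_def[of X "op_sum I \<sigma>"] by (rule infsumI[OF tr])
qed

lemma op_sum_outside:
  assumes "\<And>i. i \<in> I \<Longrightarrow> \<sigma> i \<in> bounded_ops X" "f \<notin> ell2 X"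
  shows "op_sum I \<sigma> f = (\<lambda>_. 0)"
  unfolding op_sum_def by (intro ext infsum_0) (simp add: bounded_ops_outside[OF assms])

text \<open>Kept apart from the trace bound: single terms of a sum or loop enter as additive maps,
  while the trace estimate concerns their total.\<close>

definition additive_map :: "'x set \<Rightarrow> ('x oper \<Rightarrow> 'x oper) \<Rightarrow> bool" where
  "additive_map X \<E> \<longleftrightarrow> \<E> ` trace_pos X \<subseteq> trace_pos X \<and>
     (\<forall>\<rho>\<in>trace_pos X. \<forall>\<sigma>\<in>trace_pos X. \<E> (op_add \<rho> \<sigma>) = op_add (\<E> \<rho>) (\<E> \<sigma>))"

definition quantum_map :: "'x set \<Rightarrow> ('x oper \<Rightarrow> 'x oper) \<Rightarrow> bool" where
  "quantum_map X \<E> \<longleftrightarrow> additive_map X \<E> \<and> (\<forall>\<rho>\<in>trace_pos X. op_trace X (\<E> \<rho>) \<le> op_trace X \<rho>)"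

lemma additive_mapD:
  assumes "additive_map X \<E>" "\<rho> \<in> trace_pos X"
  shows "\<E> \<rho> \<in> trace_pos X"
    and "\<sigma> \<in> trace_pos X \<Longrightarrow> \<E> (op_add \<rho> \<sigma>) = op_add (\<E> \<rho>) (\<E> \<sigma>)"
  using assms by (auto simp: additive_map_def)

lemma quantum_map_additive: "quantum_map X \<E> \<Longrightarrow> additive_map X \<E>"
  by (simp add: quantum_map_def)

lemma additive_map_comp: "additive_map X \<E> \<Longrightarrow> additive_map X \<F> \<Longrightarrow> additive_map X (\<E> \<circ> \<F>)"
  unfolding additive_map_def by (auto simp: image_subset_iff)

lemma quantum_map_comp: "quantum_map X \<E> \<Longrightarrow> quantum_map X \<F> \<Longrightarrow> quantum_map X (\<E> \<circ> \<F>)"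
  unfolding quantum_map_def using additive_map_comp[of X \<E> \<F>]
  by (auto simp: additive_map_def image_subset_iff) (meson order_trans)

lemma additive_map_sandwich: "A \<in> bounded_ops X \<Longrightarrow> additive_map X (sandwich X A)"
  by (auto simp: additive_map_def sandwich_add simp del: comp_apply)

text \<open>The bound on finite sums of traces does double duty: it makes the traces summable, so
  that the sum of two operator series can be split, and it bounds the trace of the result.\<close>

lemma quantum_map_op_sum:
  assumes add: "\<And>i. i \<in> I \<Longrightarrow> additive_map X (\<E> i)"
    and le: "\<And>F \<rho>. finite F \<Longrightarrow> F \<subseteq> I \<Longrightarrow> \<rho> \<in> trace_pos X \<Longrightarrow>
      (\<Sum>i\<in>F. op_trace X (\<E> i \<rho>)) \<le> op_trace X \<rho>"
  shows "quantum_map X (\<lambda>\<rho>. op_sum I (\<lambda>i. \<E> i \<rho>))"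
proof -
  have mem: "\<E> i \<rho> \<in> trace_pos X" if "i \<in> I" "\<rho> \<in> trace_pos X" for i \<rho>
    using add that by (auto simp: additive_map_def)
  have sum: "(\<lambda>i. op_trace X (\<E> i \<rho>)) summable_on I" if "\<rho> \<in> trace_pos X" for \<rho>
    using that
    by (intro nonneg_bdd_above_summable_on) (auto intro!: bdd_aboveI2 le op_trace_nonneg mem)
  note S = op_sum_trace_pos[OF mem sum] op_trace_op_sum[OF mem sum]
    op_sum_abs_summable[OF mem sum, THEN abs_summable_summable]
  have "op_sum I (\<lambda>i. \<E> i (op_add \<rho> \<sigma>)) = op_add (op_sum I (\<lambda>i. \<E> i \<rho>)) (op_sum I (\<lambda>i. \<E> i \<sigma>))"
    if \<rho>: "\<rho> \<in> trace_pos X" and \<sigma>: "\<sigma> \<in> trace_pos X" for \<rho> \<sigma>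
  proof
    fix f
    show "op_sum I (\<lambda>i. \<E> i (op_add \<rho> \<sigma>)) f = op_add (op_sum I (\<lambda>i. \<E> i \<rho>)) (op_sum I (\<lambda>i. \<E> i \<sigma>)) f"
    proof (cases "f \<in> ell2 X")
      case True
      have "op_sum I (\<lambda>i. \<E> i (op_add \<rho> \<sigma>)) f = (\<lambda>x. \<Sum>\<^sub>\<infinity>i\<in>I. \<E> i \<rho> f x + \<E> i \<sigma> f x)"
        unfolding op_sum_def
        by (intro ext infsum_cong) (simp add: additive_mapD(2)[OF add \<rho> \<sigma>],
          simp add: op_add_def)
      then show ?thesis
        by (simp add: op_sum_def op_add_def infsum_add S(3) True \<rho> \<sigma>)
    next
      case False
      \<comment> \<open>Coordinate summability was obtained for square-summable vectors; elsewhere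
        every summand is zero by the convention on operators.\<close>
      then have "op_sum I (\<lambda>i. \<E> i \<tau>) f = (\<lambda>_. 0)" if "\<tau> \<in> trace_pos X" for \<tau>
        using that by (intro op_sum_outside[of _ _ X] trace_pos_bounded mem)
      from this[OF op_add_trace_pos[OF \<rho> \<sigma>]] this[OF \<rho>] this[OF \<sigma>] show ?thesis
        by (simp add: op_add_def[of "op_sum I _"])
    qed
  qed
  moreover have "op_trace X (op_sum I (\<lambda>i. \<E> i \<rho>)) \<le> op_trace X \<rho>" if "\<rho> \<in> trace_pos X" for \<rho>
    using that by (auto simp: S(2) intro!: infsum_le_finite_sums sum le)
  ultimately show ?thesis
    unfolding quantum_map_def additive_map_def using S(1) by auto
qed

lemma quantum_map_kraus:
  assumes "kraus_family X I A"
  shows "quantum_map X (\<lambda>\<rho>. op_sum I (\<lambda>i. sandwich X (A i) \<rho>))"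
  using assms kraus_trace_le[OF assms]
  by (intro quantum_map_op_sum additive_map_sandwich) (auto simp: kraus_family_def)

text \<open>Branches can only lose trace, so the Kraus bound for the measured states also bounds the
  final ones.\<close>

lemma quantum_map_kraus_branches:
  assumes A: "kraus_family X I A" and \<E>: "\<And>i. i \<in> I \<Longrightarrow> quantum_map X (\<E> i)"
  shows "quantum_map X (\<lambda>\<rho>. op_sum I (\<lambda>i. \<E> i (sandwich X (A i) \<rho>)))"
proof (rule quantum_map_op_sum)
  fix i assume i: "i \<in> I"
  then have "additive_map X (\<E> i \<circ> sandwich X (A i))"
    using A
    by (intro additive_map_comp[OF quantum_map_additive[OF \<E>] additive_map_sandwich])
       (auto simp: kraus_family_def)
  then show "additive_map X (\<lambda>\<rho>. \<E> i (sandwich X (A i) \<rho>))" by (simp add: o_def)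
next
  fix F \<rho> assume F: "finite F" "F \<subseteq> I" and \<rho>: "\<rho> \<in> trace_pos X"
  have "(\<Sum>i\<in>F. op_trace X (\<E> i (sandwich X (A i) \<rho>))) \<le> (\<Sum>i\<in>F. op_trace X (sandwich X (A i) \<rho>))"
    using \<E> F A \<rho> unfolding quantum_map_def kraus_family_def
    by (intro sum_mono) (auto simp del: comp_apply intro!: sandwich_trace_pos)
  also have "\<dots> \<le> op_trace X \<rho>" by (rule kraus_trace_le[OF A \<rho> F])
  finally show "(\<Sum>i\<in>F. op_trace X (\<E> i (sandwich X (A i) \<rho>))) \<le> op_trace X \<rho>" .
qed

text \<open>One iteration splits the trace into an exiting and a continuing part whose sum does not
  exceed the trace before it. Telescoping bounds the total exiting trace by the initial one, even if
  the loop need not terminate.\<close>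

lemma quantum_map_loop:
  assumes AB: "\<And>f. f \<in> ell2 X \<Longrightarrow> (l2norm (A f))\<^sup>2 + (l2norm (B f))\<^sup>2 \<le> (l2norm f)\<^sup>2"
    and A: "A \<in> bounded_ops X" and B: "B \<in> bounded_ops X" and \<E>: "quantum_map X \<E>"
  shows "quantum_map X (\<lambda>\<rho>. op_sum UNIV (\<lambda>n. (sandwich X A \<circ> (\<E> \<circ> sandwich X B) ^^ n) \<rho>))"
proof (rule quantum_map_op_sum)
  let ?L = "\<E> \<circ> sandwich X B"
  have L: "additive_map X ?L"
    by (rule additive_map_comp[OF quantum_map_additive[OF \<E>] additive_map_sandwich[OF B]])
  have Ln: "additive_map X (?L ^^ n)" for n
  proof (induction n)
    case 0
    show ?case by (simp add: additive_map_def)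
  next
    case (Suc n)
    then show ?case by (simp only: funpow.simps additive_map_comp[OF L])
  qed
  show "additive_map X (sandwich X A \<circ> ?L ^^ n)" for n
    by (rule additive_map_comp[OF additive_map_sandwich[OF A] Ln])
  fix F \<rho> assume F: "finite F" "F \<subseteq> (UNIV :: nat set)" and \<rho>: "\<rho> \<in> trace_pos X"
  let ?\<rho> = "\<lambda>n. (?L ^^ n) \<rho>"
  have \<rho>n: "?\<rho> n \<in> trace_pos X" for n by (rule additive_mapD(1)[OF Ln \<rho>])
  \<comment> \<open>Indexing by \<open>bool\<close> puts the two loop operators into one Kraus
    family and keeps them separate even when they coincide.\<close>
  have K: "kraus_family X UNIV (\<lambda>b. if b then A else B)"
    unfolding kraus_family_def
  proof (intro conjI allI impI ballI)
    fix G :: "bool set" and f assume f: "f \<in> ell2 X"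
    have "(\<Sum>b\<in>G. (l2norm ((if b then A else B) f))\<^sup>2) \<le> (\<Sum>b\<in>UNIV. (l2norm ((if b then A else B) f))\<^sup>2)"
      by (rule sum_mono2) auto
    also have "\<dots> \<le> (l2norm f)\<^sup>2" using AB[OF f] by (simp add: UNIV_bool)
    finally show "(\<Sum>b\<in>G. (l2norm ((if b then A else B) f))\<^sup>2) \<le> (l2norm f)\<^sup>2" .
  qed (use A B in auto)
  have step: "op_trace X (sandwich X A (?\<rho> n)) + op_trace X (?\<rho> (Suc n)) \<le> op_trace X (?\<rho> n)" for n
  proof -
    have "op_trace X (?\<rho> (Suc n)) \<le> op_trace X (sandwich X B (?\<rho> n))"
      using \<E> sandwich_trace_pos[OF B \<rho>n[of n]] by (simp add: quantum_map_def)
    then show ?thesis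
      using kraus_trace_le[OF K \<rho>n[of n], of UNIV] by (simp add: UNIV_bool)
  qed
  have "(\<Sum>n<m. op_trace X (sandwich X A (?\<rho> n))) + op_trace X (?\<rho> m) \<le> op_trace X \<rho>" for m
  proof (induction m)
    case (Suc m)
    then show ?case using step[of m] unfolding sum.lessThan_Suc by linarith
  qed simp
  then have le: "(\<Sum>n<m. op_trace X (sandwich X A (?\<rho> n))) \<le> op_trace X \<rho>" for m
    using op_trace_nonneg[OF \<rho>n[of m]] by (smt (verit))
  obtain m where "F \<subseteq> {..<m}" using F(1) finite_nat_bounded by blast
  then have "(\<Sum>n\<in>F. op_trace X (sandwich X A (?\<rho> n))) \<le> (\<Sum>n<m. op_trace X (sandwich X A (?\<rho> n)))"
    by (intro sum_mono2 op_trace_nonneg sandwich_trace_pos A \<rho>n) auto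
  also note le
  finally show "(\<Sum>n\<in>F. op_trace X ((sandwich X A \<circ> ?L ^^ n) \<rho>)) \<le> op_trace X \<rho>"
    by (simp add: o_def)
qed

subsection \<open>Operators on a register\<close>

text \<open>The argument that \<open>lift_op\<close> passes to the register operator. It depends on
  \<open>f\<close> only outside the register.\<close>

definition slice :: "('v, 'b) qsystem \<Rightarrow> 'v list \<Rightarrow> ('v \<Rightarrow> 'b) vec \<Rightarrow> ('v \<Rightarrow> 'b) \<Rightarrow> 'b list vec" where
  "slice S qs \<psi> f = (\<lambda>bs. if bs \<in> reg_basis S qs then \<psi> (override f qs bs) else 0)"

definition agree_off :: "'v set \<Rightarrow> ('v \<Rightarrow> 'b) \<Rightarrow> ('v \<Rightarrow> 'b) \<Rightarrow> bool" where
  "agree_off V f g \<longleftrightarrow> (\<forall>v. v \<notin> V \<longrightarrow> f v = g v)"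

text \<open>One representative for each assignment of the variables outside the register; the
  register itself is set to the reference labels.\<close>

definition rest_configs :: "('v, 'b) qsystem \<Rightarrow> 'v list \<Rightarrow> ('v \<Rightarrow> 'b) set" where
  "rest_configs S qs = {r \<in> configs S. map r qs = map (ref S) qs}"

lemma reg_basis_length: "bs \<in> reg_basis S qs \<Longrightarrow> length bs = length qs"
  by (auto simp: reg_basis_def list_all2_lengthD)

lemma override_notin: "length bs = length qs \<Longrightarrow> v \<notin> set qs \<Longrightarrow> override f qs bs v = f v"
  by (simp add: override_def map_of_eq_None_iff split: option.split)
     (metis fst_conv imageI map_of_SomeD set_zip_leftD)

lemma override_nth:
  "distinct qs \<Longrightarrow> length bs = length qs \<Longrightarrow> i < length qs \<Longrightarrow> override f qs bs (qs ! i) = bs ! i"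
  by (simp add: override_def map_of_zip_nth)

lemma map_override [simp]:
  "distinct qs \<Longrightarrow> length bs = length qs \<Longrightarrow> map (override f qs bs) qs = bs"
  by (rule nth_equalityI) (auto simp: override_nth)

lemma override_eqI:
  assumes "distinct qs" "length bs = length qs" "map g qs = bs" "\<And>v. v \<notin> set qs \<Longrightarrow> g v = f v"
  shows "override f qs bs = g"
proof
  fix v show "override f qs bs v = g v"
  proof (cases "v \<in> set qs")
    case True
    then show ?thesis
      using assms by (metis in_set_conv_nth nth_map override_nth)
  next
    case False
    then show ?thesis using assms by (simp add: override_notin)
  qed
qed

lemma override_self [simp]: "distinct qs \<Longrightarrow> override f qs (map f qs) = f"
  by (intro override_eqI) auto

lemma override_in [simp]: "distinct qs \<Longrightarrow> v \<in> set qs \<Longrightarrow> override f qs (map g qs) v = g v"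
  by (metis in_set_conv_nth length_map nth_map override_nth)

lemma override_override [simp]:
  "distinct qs \<Longrightarrow> length bs = length qs \<Longrightarrow> length cs = length qs \<Longrightarrow>
   override (override f qs bs) qs cs = override f qs cs"
  by (intro override_eqI) (auto simp: override_notin)

lemma map_override_disjoint:
  "length bs = length rs \<Longrightarrow> set qs \<inter> set rs = {} \<Longrightarrow> map (override f rs bs) qs = map f qs"
  by (intro map_cong refl override_notin) auto

lemma registerD: "register S qs \<Longrightarrow> distinct qs" "register S qs \<Longrightarrow> set qs \<subseteq> qvars S"
  by (auto simp: register_def)

lemma map_config_reg_basis:
  "register S qs \<Longrightarrow> f \<in> configs S \<Longrightarrow> map f qs \<in> reg_basis S qs"
  using nth_mem[of _ qs]
  by (fastforce simp: reg_basis_def list_all2_conv_all_nth configs_def PiE_def Pi_def register_def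
      simp del: nth_mem)

lemma map_ref_reg_basis:
  "valid_system S \<Longrightarrow> register S qs \<Longrightarrow> map (ref S) qs \<in> reg_basis S qs"
  using nth_mem[of _ qs]
  by (fastforce simp: reg_basis_def list_all2_conv_all_nth valid_system_def register_def
      simp del: nth_mem)

lemma override_config:
  assumes "register S qs" "f \<in> configs S" "bs \<in> reg_basis S qs"
  shows "override f qs bs \<in> configs S"
proof -
  note len = reg_basis_length[OF assms(3)]
  have "override f qs bs v \<in> qbasis S v" if "v \<in> qvars S" for v
  proof (cases "v \<in> set qs")
    case True
    then obtain i where "i < length qs" "v = qs ! i" by (auto simp: in_set_conv_nth)
    then show ?thesis
      using assms len by (auto simp: override_nth register_def reg_basis_def list_all2_conv_all_nth)
  next
    case False
    then show ?thesis using that assms(2) len by (auto simp: override_notin configs_def)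
  qed
  moreover have "override f qs bs v = undefined" if "v \<notin> qvars S" for v
    using that assms len by (subst override_notin) (auto simp: register_def configs_def PiE_def
        extensional_def)
  \<comment> \<open>A register is a finite list, so overriding preserves the finite deviation from
    \<open>ref\<close> demanded by \<open>configs\<close>.\<close>
  moreover have "{q \<in> qvars S. override f qs bs q \<noteq> ref S q} \<subseteq> set qs \<union> {q \<in> qvars S. f q \<noteq> ref S q}"
    using len by (auto simp: override_notin)
  then have "finite {q \<in> qvars S. override f qs bs q \<noteq> ref S q}"
    by (rule finite_subset) (use assms(2) in \<open>auto simp: configs_def\<close>)
  ultimately show ?thesis by (auto simp: configs_def PiE_def extensional_def)
qed

text \<open>The tensor factorization at the level of basis labels. The inverse reads off the
  register labels and resets the register to \<open>ref\<close>, a legal label by validity of the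
  system.\<close>

lemma bij_betw_override:
  assumes "valid_system S" and q: "register S qs"
  shows "bij_betw (\<lambda>(r, bs). override r qs bs) (rest_configs S qs \<times> reg_basis S qs) (configs S)"
proof (rule bij_betw_byWitness)
  let ?g = "\<lambda>f. (override f qs (map (ref S) qs), map f qs)"
  note q' = registerD(1)[OF q]
  show "\<forall>a\<in>rest_configs S qs \<times> reg_basis S qs. ?g ((\<lambda>(r, bs). override r qs bs) a) = a"
    using q' by (auto simp: rest_configs_def reg_basis_length intro!: override_eqI)
  show "\<forall>f\<in>configs S. (\<lambda>(r, bs). override r qs bs) (?g f) = f"
    using q' by simp
  show "(\<lambda>(r, bs). override r qs bs) ` (rest_configs S qs \<times> reg_basis S qs) \<subseteq> configs S"
    using q by (auto simp: rest_configs_def override_config)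
  show "?g ` configs S \<subseteq> rest_configs S qs \<times> reg_basis S qs"
    using q q' assms(1)
    by (auto simp: rest_configs_def override_config map_ref_reg_basis map_config_reg_basis)
qed

lemma slice_add: "slice S qs (\<lambda>x. \<psi> x + \<phi> x) f = (\<lambda>bs. slice S qs \<psi> f bs + slice S qs \<phi> f bs)"
  by (auto simp: slice_def)

lemma slice_scale: "slice S qs (\<lambda>x. c * \<psi> x) f = (\<lambda>bs. c * slice S qs \<psi> f bs)"
  by (auto simp: slice_def)

text \<open>Different register labels give different configurations, so a slice sums over a
  subfamily of the coordinates of \<psi>.\<close>

lemma slice_ell2 [simp]:
  assumes q: "register S qs" and \<psi>: "\<psi> \<in> ell2 X"
  shows "slice S qs \<psi> f \<in> ell2 (reg_basis S qs)"
proof (rule ell2_bounded_sums)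
  fix F assume F: "finite F" "F \<subseteq> reg_basis S qs"
  have inj: "inj_on (override f qs) F"
    using F registerD(1)[OF q] by (intro inj_onI) (metis map_override reg_basis_length subsetD)
  have "(\<Sum>bs\<in>F. (cmod (slice S qs \<psi> f bs))\<^sup>2) = (\<Sum>g\<in>override f qs ` F. (cmod (\<psi> g))\<^sup>2)"
    using F by (subst sum.reindex[OF inj]) (auto simp: slice_def intro!: sum.cong)
  also have "\<dots> \<le> (l2norm \<psi>)\<^sup>2"
    unfolding l2norm_square using F by (intro finite_sum_le_infsum ell2_summable[OF \<psi>]) auto
  finally show "(\<Sum>bs\<in>F. (cmod (slice S qs \<psi> f bs))\<^sup>2) \<le> (l2norm \<psi>)\<^sup>2" .
qed (auto simp: slice_def)

text \<open>The sum over configurations regrouped along \<open>bij_betw_override\<close>: the state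
  space is an orthogonal sum of copies of the register space.\<close>

lemma slice_cinner:
  assumes v: "valid_system S" and q: "register S qs"
    and \<phi>: "\<phi> \<in> ell2 (configs S)" and \<psi>: "\<psi> \<in> ell2 (configs S)"
  shows "((\<lambda>r. cinner (slice S qs \<phi> r) (slice S qs \<psi> r)) has_sum cinner \<phi> \<psi>) (rest_configs S qs)"
proof (rule has_sum_SigmaD)
  have "((\<lambda>f. cnj (\<phi> f) * \<psi> f) has_sum cinner \<phi> \<psi>) UNIV"
    unfolding cinner_def by (intro has_sum_infsum cinner_summable[OF \<phi> \<psi>])
  then have "((\<lambda>f. cnj (\<phi> f) * \<psi> f) has_sum cinner \<phi> \<psi>) (configs S)"
    by (rule has_sum_cong_neutral[THEN iffD1, rotated -1]) (auto simp: ell2_outside[OF \<psi>])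
  then show "((\<lambda>p. (\<lambda>f. cnj (\<phi> f) * \<psi> f) ((\<lambda>(r, bs). override r qs bs) p)) has_sum cinner \<phi> \<psi>)
      (rest_configs S qs \<times> reg_basis S qs)"
    by (subst has_sum_reindex_bij_betw[OF bij_betw_override[OF v q]])
  fix r
  have "((\<lambda>bs. cnj (slice S qs \<phi> r bs) * slice S qs \<psi> r bs) has_sum
      cinner (slice S qs \<phi> r) (slice S qs \<psi> r)) UNIV"
    unfolding cinner_def
    by (intro has_sum_infsum cinner_summable[of _ "reg_basis S qs"] slice_ell2[OF q \<phi>] slice_ell2[OF q \<psi>])
  then show "((\<lambda>bs. (\<lambda>f. cnj (\<phi> f) * \<psi> f) ((\<lambda>(r, bs). override r qs bs) (r, bs))) has_sum
      cinner (slice S qs \<phi> r) (slice S qs \<psi> r)) (reg_basis S qs)"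
    by (rule has_sum_cong_neutral[THEN iffD1, rotated -1]) (auto simp: slice_def)
qed

lemma slice_l2norm:
  assumes "valid_system S" "register S qs" "\<psi> \<in> ell2 (configs S)"
  shows "((\<lambda>r. (l2norm (slice S qs \<psi> r))\<^sup>2) has_sum (l2norm \<psi>)\<^sup>2) (rest_configs S qs)"
  using slice_cinner[OF assms(1,2,3,3)] assms
  by (simp add: cinner_self[of _ "configs S"] cinner_self[OF slice_ell2] has_sum_of_real_iff
      del: of_real_power)

lemma ell2_slices:
  assumes v: "valid_system S" and q: "register S qs"
    and out: "\<And>f. f \<notin> configs S \<Longrightarrow> \<phi> f = 0"
    and ell: "\<And>r. r \<in> rest_configs S qs \<Longrightarrow> slice S qs \<phi> r \<in> ell2 (reg_basis S qs)"
    and sum: "(\<lambda>r. (l2norm (slice S qs \<phi> r))\<^sup>2) summable_on rest_configs S qs"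
  shows "\<phi> \<in> ell2 (configs S)"
proof -
  have "(\<lambda>p. (\<lambda>f. (cmod (\<phi> f))\<^sup>2) ((\<lambda>(r, bs). override r qs bs) p)) summable_on
      (rest_configs S qs \<times> reg_basis S qs)"
  proof (rule summable_on_SigmaI[OF _ sum])
    fix r assume r: "r \<in> rest_configs S qs"
    show "((\<lambda>bs. (\<lambda>f. (cmod (\<phi> f))\<^sup>2) ((\<lambda>(r, bs). override r qs bs) (r, bs))) has_sum
        (l2norm (slice S qs \<phi> r))\<^sup>2) (reg_basis S qs)"
      using l2norm_has_sum[OF ell[OF r]]
      by (rule has_sum_cong[THEN iffD1, rotated]) (simp add: slice_def)
  qed auto
  then have "(\<lambda>f. (cmod (\<phi> f))\<^sup>2) summable_on configs S"
    by (subst (asm) summable_on_reindex_bij_betw[OF bij_betw_override[OF v q]])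
  then have "(\<lambda>f. (cmod (\<phi> f))\<^sup>2) summable_on UNIV"
    by (rule summable_on_cong_neutral[THEN iffD1, rotated -1]) (auto simp: out)
  then show ?thesis using out by (simp add: ell2_def)
qed

lemma lift_op_apply:
  "\<psi> \<in> ell2 (configs S) \<Longrightarrow> f \<in> configs S \<Longrightarrow>
   lift_op S qs A \<psi> f = A (slice S qs \<psi> f) (map f qs)"
  by (simp add: lift_op_def slice_def)

lemma lift_op_outside:
  "\<psi> \<notin> ell2 (configs S) \<Longrightarrow> lift_op S qs A \<psi> = (\<lambda>_. 0)"
  "f \<notin> configs S \<Longrightarrow> lift_op S qs A \<psi> f = 0"
  by (auto simp: lift_op_def)

lemma slice_override:
  assumes "register S qs" "bs \<in> reg_basis S qs"
  shows "slice S qs \<psi> (override f qs bs) = slice S qs \<psi> f"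
  using assms by (auto simp: slice_def fun_eq_iff reg_basis_length registerD(1))

text \<open>Overriding the register does not change the slice, so a lifted operator is block
  diagonal with the same block \<open>A\<close> on each slice.\<close>

lemma slice_lift_op:
  assumes q: "register S qs" and A: "A \<in> bounded_ops (reg_basis S qs)"
    and \<psi>: "\<psi> \<in> ell2 (configs S)" and f: "f \<in> configs S"
  shows "slice S qs (lift_op S qs A \<psi>) f = A (slice S qs \<psi> f)"
proof
  fix bs show "slice S qs (lift_op S qs A \<psi>) f bs = A (slice S qs \<psi> f) bs"
  proof (cases "bs \<in> reg_basis S qs")
    case True
    then show ?thesis
      using override_config[OF q f True]
      by (simp add: slice_def[of S qs "lift_op S qs A \<psi>"] lift_op_apply[OF \<psi>] slice_override[OF q]
          registerD(1)[OF q] reg_basis_length)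
  next
    case False
    then show ?thesis
      using ell2_outside[OF bounded_ops_ell2[OF A] False] by (simp add: slice_def)
  qed
qed

lemma rest_configs_config: "r \<in> rest_configs S qs \<Longrightarrow> r \<in> configs S"
  by (simp add: rest_configs_def)

text \<open>A norm bound for the block \<open>A\<close> holds on every slice and sums to the same
  bound for the whole operator.\<close>

lemma lift_op_bounded [simp]:
  assumes v: "valid_system S" and q: "register S qs" and A: "A \<in> bounded_ops (reg_basis S qs)"
  shows "lift_op S qs A \<in> bounded_ops (configs S)"
proof -
  obtain C where C: "0 \<le> C" "\<And>f. f \<in> ell2 (reg_basis S qs) \<Longrightarrow> l2norm (A f) \<le> C * l2norm f"
    using bounded_ops_bound[OF A] by blast
  have le: "(l2norm (slice S qs (lift_op S qs A \<psi>) r))\<^sup>2 \<le> C\<^sup>2 * (l2norm (slice S qs \<psi> r))\<^sup>2"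
    if \<psi>: "\<psi> \<in> ell2 (configs S)" and r: "r \<in> rest_configs S qs" for \<psi> r
    using power_mono[OF C(2)[OF slice_ell2[OF q \<psi>, of r]], of 2]
    by (simp add: slice_lift_op[OF q A \<psi> rest_configs_config[OF r]] power_mult_distrib)
  have sum: "((\<lambda>r. C\<^sup>2 * (l2norm (slice S qs \<psi> r))\<^sup>2) has_sum (C\<^sup>2 * (l2norm \<psi>)\<^sup>2)) (rest_configs S qs)"
    if \<psi>: "\<psi> \<in> ell2 (configs S)" for \<psi>
    by (intro has_sum_cmult_right slice_l2norm v q \<psi>)
  have ell: "lift_op S qs A \<psi> \<in> ell2 (configs S)" if \<psi>: "\<psi> \<in> ell2 (configs S)" for \<psi>
  proof (rule ell2_slices[OF v q])
    show "(\<lambda>r. (l2norm (slice S qs (lift_op S qs A \<psi>) r))\<^sup>2) summable_on rest_configs S qs"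
      by (rule summable_on_comparison_test[OF has_sum_imp_summable[OF sum[OF \<psi>]]])
         (auto simp: le[OF \<psi>])
  qed (auto simp: lift_op_outside slice_lift_op[OF q A \<psi> rest_configs_config] A)
  show ?thesis
  proof (rule bounded_opsI)
    fix \<psi> assume \<psi>: "\<psi> \<in> ell2 (configs S)"
    have "(l2norm (lift_op S qs A \<psi>))\<^sup>2 \<le> C\<^sup>2 * (l2norm \<psi>)\<^sup>2"
      by (rule has_sum_mono[OF slice_l2norm[OF v q ell[OF \<psi>]] sum[OF \<psi>]]) (rule le[OF \<psi>])
    then have "(l2norm (lift_op S qs A \<psi>))\<^sup>2 \<le> (C * l2norm \<psi>)\<^sup>2" by (simp add: power_mult_distrib)
    then show "l2norm (lift_op S qs A \<psi>) \<le> C * l2norm \<psi>"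
      using C(1) by (simp add: power2_le_iff_abs_le)
  next
    fix \<phi> \<psi> assume "\<phi> \<in> ell2 (configs S)" "\<psi> \<in> ell2 (configs S)"
    then show "lift_op S qs A (\<lambda>x. \<phi> x + \<psi> x) = (\<lambda>x. lift_op S qs A \<phi> x + lift_op S qs A \<psi> x)"
      by (intro ext, rename_tac f, case_tac "f \<in> configs S")
         (simp_all add: lift_op_apply slice_add bounded_ops_add[OF A] slice_ell2[OF q] lift_op_outside)
  next
    fix \<phi> c assume "\<phi> \<in> ell2 (configs S)"
    then show "lift_op S qs A (\<lambda>x. c * \<phi> x) = (\<lambda>x. c * lift_op S qs A \<phi> x)"
      by (intro ext, rename_tac f, case_tac "f \<in> configs S")
         (simp_all add: lift_op_apply slice_scale bounded_ops_scale[OF A] slice_ell2[OF q]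
           lift_op_outside)
  qed (auto simp: ell lift_op_outside)
qed

text \<open>The condition on \<open>A\<close> at the zero vector covers arguments that are not
  square summable, where the inner operator returns zero and the outer one is applied to it.\<close>

lemma lift_op_comp:
  assumes v: "valid_system S" and q: "register S qs"
    and B: "B \<in> bounded_ops (reg_basis S qs)" and "A (\<lambda>_. 0) = (\<lambda>_. 0)"
  shows "lift_op S qs A \<circ> lift_op S qs B = lift_op S qs (A \<circ> B)"
proof (intro ext)
  fix \<psi> f
  have z: "slice S qs (\<lambda>_. 0) f = (\<lambda>_. 0)" by (simp add: slice_def)
  show "(lift_op S qs A \<circ> lift_op S qs B) \<psi> f = lift_op S qs (A \<circ> B) \<psi> f"
    using assms(4) bounded_ops_ell2[OF lift_op_bounded[OF v q B], of \<psi>]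
    by (cases "\<psi> \<in> ell2 (configs S)"; cases "f \<in> configs S")
       (simp_all add: lift_op_apply slice_lift_op[OF q B] lift_op_outside z)
qed

lemma lift_op_zero [simp]: "lift_op S qs zero_op = zero_op"
  by (auto simp: lift_op_def zero_op_def fun_eq_iff)

lemma lift_op_adj:
  assumes v: "valid_system S" and q: "register S qs" and A: "A \<in> bounded_ops (reg_basis S qs)"
  shows "adj (configs S) (lift_op S qs A) = lift_op S qs (adj (reg_basis S qs) A)"
proof (rule adj_eqI)
  fix \<phi> \<psi> assume \<phi>: "\<phi> \<in> ell2 (configs S)" and \<psi>: "\<psi> \<in> ell2 (configs S)"
  note A' = adj_bounded[OF A]
  note L = bounded_ops_ell2[OF lift_op_bounded[OF v q A], of \<phi>]
  note L' = bounded_ops_ell2[OF lift_op_bounded[OF v q A'], of \<psi>]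
  have "((\<lambda>r. cinner (slice S qs \<phi> r) (slice S qs (lift_op S qs (adj (reg_basis S qs) A) \<psi>) r)) has_sum
      cinner (lift_op S qs A \<phi>) \<psi>) (rest_configs S qs)"
    using slice_cinner[OF v q L \<psi>]
    by (rule has_sum_cong[THEN iffD1, rotated])
       (simp add: slice_lift_op[OF q A \<phi>] slice_lift_op[OF q A' \<psi>] rest_configs_config
          cinner_adj_right[OF A] slice_ell2[OF q \<phi>] slice_ell2[OF q \<psi>])
  then show "cinner (lift_op S qs A \<phi>) \<psi> = cinner \<phi> (lift_op S qs (adj (reg_basis S qs) A) \<psi>)"
    using slice_cinner[OF v q \<phi> L'] has_sum_unique by blast
qed (use assms in auto)

text \<open>The matrix of \<open>A\<close> tensored with the identity: the identity factor forces
  agreement outside the register.\<close>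

lemma lift_op_ket:
  assumes q: "register S qs" and A: "A \<in> bounded_ops (reg_basis S qs)"
    and y: "y \<in> configs S" and f: "f \<in> configs S"
  shows "lift_op S qs A (ket y) f =
    (if agree_off (set qs) f y then A (ket (map y qs)) (map f qs) else 0)"
proof -
  have "slice S qs (ket y) f =
      (if agree_off (set qs) f y then ket (map y qs) else (\<lambda>_. 0))"
  proof
    fix bs
    have "bs \<in> reg_basis S qs \<Longrightarrow>
        override f qs bs = y \<longleftrightarrow> (agree_off (set qs) f y) \<and> bs = map y qs"
      using registerD(1)[OF q] reg_basis_length override_notin unfolding agree_off_def
      by (metis map_override override_eqI)
    then show "slice S qs (ket y) f bs =
        (if agree_off (set qs) f y then ket (map y qs) else (\<lambda>_. 0)) bs"
      using map_config_reg_basis[OF q y] by (auto simp: slice_def ket_def)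
  qed
  then show ?thesis
    using y f by (simp add: lift_op_apply bounded_ops_zero[OF A])
qed

text \<open>The entries of the product on disjoint registers are products of entries. This
  expression is symmetric in the two operators, which is the reason they commute.\<close>

lemma lift_op_lift_op_ket:
  assumes v: "valid_system S" and q: "register S qs" and r: "register S rs"
    and disj: "set qs \<inter> set rs = {}"
    and A: "A \<in> bounded_ops (reg_basis S qs)" and B: "B \<in> bounded_ops (reg_basis S rs)"
    and y: "y \<in> configs S" and f: "f \<in> configs S"
  shows "lift_op S qs A (lift_op S rs B (ket y)) f =
    (if agree_off (set qs \<union> set rs) f y
     then A (ket (map y qs)) (map f qs) * B (ket (map y rs)) (map f rs) else 0)"
proof -
  \<comment> \<open>\<open>B\<close> leaves the variables of \<open>qs\<close> as they are in
    \<open>y\<close>, so the slice along \<open>qs\<close> of its image is a multiple of one basis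
    vector; \<open>c\<close> is the multiple.\<close>
  define c where "c = (if agree_off (set qs \<union> set rs) f y
    then B (ket (map y rs)) (map f rs) else 0)"
  have "slice S qs (lift_op S rs B (ket y)) f = (\<lambda>bs. c * ket (map y qs) bs)"
  proof
    fix bs show "slice S qs (lift_op S rs B (ket y)) f bs = c * ket (map y qs) bs"
    proof (cases "bs \<in> reg_basis S qs")
      case bs: True
      note len = reg_basis_length[OF bs] and d = registerD(1)[OF q]
      have iff: "agree_off (set rs) (override f qs bs) y \<longleftrightarrow>
          (agree_off (set qs \<union> set rs) f y) \<and> bs = map y qs"
      proof
        assume *: "agree_off (set rs) (override f qs bs) y"
        then have "map (override f qs bs) qs = map y qs" using disj by (auto simp: agree_off_def)
        with * show "(agree_off (set qs \<union> set rs) f y) \<and> bs = map y qs"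
          using len d by (auto simp: override_notin agree_off_def)
      next
        assume *: "(agree_off (set qs \<union> set rs) f y) \<and> bs = map y qs"
        show "agree_off (set rs) (override f qs bs) y"
          unfolding agree_off_def
        proof (intro allI impI)
          fix v assume v: "v \<notin> set rs"
          show "override f qs bs v = y v"
          proof (cases "v \<in> set qs")
            case True
            then obtain i where "i < length qs" "v = qs ! i" by (auto simp: in_set_conv_nth)
            then show ?thesis using * d by (simp add: override_nth)
          next
            case False
            then show ?thesis using * v len by (simp add: override_notin agree_off_def)
          qed
        qed
      qed
      have "map (override f qs bs) rs = map f rs"
        using disj len by (intro map_override_disjoint) auto
      then have "slice S qs (lift_op S rs B (ket y)) f bs =
          (if (agree_off (set qs \<union> set rs) f y) \<and> bs = map y qs
           then B (ket (map y rs)) (map f rs) else 0)"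
        using bs unfolding slice_def lift_op_ket[OF r B y override_config[OF q f bs]] iff
        by presburger
      then show ?thesis by (auto simp: c_def ket_def)
    next
      case False
      then have "bs \<noteq> map y qs" using map_config_reg_basis[OF q y] by auto
      then show ?thesis using False by (simp add: slice_def ket_def)
    qed
  qed
  then have "lift_op S qs A (lift_op S rs B (ket y)) f = A (\<lambda>bs. c * ket (map y qs) bs) (map f qs)"
    using f bounded_ops_ell2[OF lift_op_bounded[OF v r B]] by (simp add: lift_op_apply)
  also have "\<dots> = c * A (ket (map y qs)) (map f qs)"
    using map_config_reg_basis[OF q y] by (simp add: bounded_ops_scale[OF A])
  finally show ?thesis by (simp add: c_def)
qed

text \<open>Operators are determined on basis vectors, where the two orders give the same product of
  matrix entries.\<close>

lemma lift_op_commute: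
  assumes v: "valid_system S" and q: "register S qs" and r: "register S rs"
    and disj: "set qs \<inter> set rs = {}"
    and A: "A \<in> bounded_ops (reg_basis S qs)" and B: "B \<in> bounded_ops (reg_basis S rs)"
  shows "lift_op S qs A \<circ> lift_op S rs B = lift_op S rs B \<circ> lift_op S qs A"
proof (rule bounded_ops_eqI[of _ "configs S"])
  fix y assume y: "y \<in> configs S"
  show "(lift_op S qs A \<circ> lift_op S rs B) (ket y) = (lift_op S rs B \<circ> lift_op S qs A) (ket y)"
  proof
    fix f
    have disj': "set rs \<inter> set qs = {}" using disj by auto
    show "(lift_op S qs A \<circ> lift_op S rs B) (ket y) f = (lift_op S rs B \<circ> lift_op S qs A) (ket y) f"
      by (cases "f \<in> configs S")
         (simp_all add: lift_op_lift_op_ket[OF v q r disj A B y] lift_op_lift_op_ket[OF v r q disj' B A y]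
           lift_op_outside Un_commute mult.commute)
  qed
qed (use assms in auto)

lemma lift_op_norm_sum:
  assumes v: "valid_system S" and q: "register S qs"
    and A: "\<And>i. i \<in> F \<Longrightarrow> A i \<in> bounded_ops (reg_basis S qs)" and \<psi>: "\<psi> \<in> ell2 (configs S)"
  shows "((\<lambda>r. \<Sum>i\<in>F. (l2norm (A i (slice S qs \<psi> r)))\<^sup>2) has_sum
    (\<Sum>i\<in>F. (l2norm (lift_op S qs (A i) \<psi>))\<^sup>2)) (rest_configs S qs)"
proof (rule has_sum_sum)
  fix i assume i: "i \<in> F"
  show "((\<lambda>r. (l2norm (A i (slice S qs \<psi> r)))\<^sup>2) has_sum (l2norm (lift_op S qs (A i) \<psi>))\<^sup>2)
      (rest_configs S qs)"
    using slice_l2norm[OF v q bounded_ops_ell2[OF lift_op_bounded[OF v q A[OF i]]], of \<psi>]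
    by (rule has_sum_cong[THEN iffD1, rotated])
       (simp add: slice_lift_op[OF q A[OF i] \<psi>] rest_configs_config)
qed

text \<open>The Kraus inequality holds on every slice, and squared norms add over slices.\<close>

lemma kraus_family_lift:
  assumes v: "valid_system S" and q: "register S qs" and A: "kraus_family (reg_basis S qs) I A"
  shows "kraus_family (configs S) I (\<lambda>i. lift_op S qs (A i))"
  unfolding kraus_family_def
proof (intro conjI allI impI ballI)
  fix F \<psi> assume F: "finite F" "F \<subseteq> I" and \<psi>: "\<psi> \<in> ell2 (configs S)"
  have bd: "A i \<in> bounded_ops (reg_basis S qs)" if "i \<in> F" for i
    using A F that by (auto simp: kraus_family_def)
  show "(\<Sum>i\<in>F. (l2norm (lift_op S qs (A i) \<psi>))\<^sup>2) \<le> (l2norm \<psi>)\<^sup>2"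
    by (rule has_sum_mono[OF lift_op_norm_sum[OF v q bd \<psi>] slice_l2norm[OF v q \<psi>]])
       (use A F slice_ell2[OF q \<psi>] in \<open>auto simp: kraus_family_def\<close>)
qed (use assms in \<open>auto simp: kraus_family_def\<close>)

text \<open>A computational-basis projection is multiplication by the indicator of the
  configurations carrying the label \<open>m\<close>; products of such projections become
  intersections.\<close>

lemma lift_ketbra_ket:
  assumes q: "register S qs" and m: "m \<in> reg_basis S qs"
  shows "lift_op S qs (ketbra (reg_basis S qs) (ket m) (ket m)) \<psi> =
    (if \<psi> \<in> ell2 (configs S) then (\<lambda>f. if f \<in> configs S \<and> map f qs = m then \<psi> f else 0) else (\<lambda>_. 0))"
proof (cases "\<psi> \<in> ell2 (configs S)")
  case True
  have "lift_op S qs (ketbra (reg_basis S qs) (ket m) (ket m)) \<psi> f =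
      (if f \<in> configs S \<and> map f qs = m then \<psi> f else 0)" for f
  proof (cases "f \<in> configs S")
    case f: True
    have "slice S qs \<psi> f m = \<psi> f" if "map f qs = m"
      using that m registerD(1)[OF q] by (auto simp: slice_def)
    then show ?thesis
      using True f slice_ell2[OF q True]
      by (auto simp: lift_op_apply ketbra_def) (auto simp: ket_def)
  qed (simp add: lift_op_outside)
  with True show ?thesis by auto
qed (simp add: lift_op_outside)

subsection \<open>Circuits and measurements\<close>

text \<open>Completeness is given coordinate by coordinate, and pairing it with a vector of infinite
  support would exchange two limits. It is therefore paired with truncations, where the inner
  product is a finite sum, and the inequality is carried over by continuity.\<close>

lemma measurement_kraus:
  assumes M: "measurement S M"
  shows "kraus_family (reg_basis S (mreg M)) (outcomes M) (mop M)"
proof -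
  define X where "X = reg_basis S (mreg M)"
  have A: "mop M m \<in> bounded_ops X" if "m \<in> outcomes M" for m
    using M that by (auto simp: measurement_def X_def)
  have complete: "((\<lambda>m. adj X (mop M m) (mop M m f) x) has_sum f x) (outcomes M)"
    if "f \<in> ell2 X" for f x
    using M that by (auto simp: measurement_def X_def)
  have "(\<Sum>m\<in>F. (l2norm (mop M m f))\<^sup>2) \<le> (l2norm f)\<^sup>2"
    if F: "finite F" "F \<subseteq> outcomes M" and f: "f \<in> ell2 X" for F f
  proof -
    let ?t = "\<lambda>G x. if x \<in> G then f x else 0"
    have le: "(\<Sum>m\<in>F. (l2norm (mop M m (?t G)))\<^sup>2) \<le> (l2norm f)\<^sup>2" if G: "finite G" for G
    proof -
      have t: "?t G \<in> ell2 X" using f by simp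
      \<comment> \<open>Finite support turns the inner product into a finite sum of coordinates, to
        which the completeness relation applies.\<close>
      have ci: "cinner (?t G) g = (\<Sum>x\<in>G. cnj (f x) * g x)" for g
      proof -
        have "cinner (?t G) g = (\<Sum>\<^sub>\<infinity>x\<in>G. cnj (f x) * g x)"
          unfolding cinner_def by (rule infsum_cong_neutral) auto
        then show ?thesis using G by simp
      qed
      have "((\<lambda>m. cinner (?t G) (adj X (mop M m) (mop M m (?t G)))) has_sum cinner (?t G) (?t G)) (outcomes M)"
        unfolding ci[of "adj X _ _"] ci[of "?t G"]
        by (intro has_sum_sum has_sum_cmult_right complete[OF t])
      then have "((\<lambda>m. complex_of_real ((l2norm (mop M m (?t G)))\<^sup>2)) has_sum
          of_real ((l2norm (?t G))\<^sup>2)) (outcomes M)"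
        unfolding cinner_self[OF t]
        by (rule has_sum_cong[THEN iffD1, rotated])
           (simp add: cinner_adj_right[OF A t] cinner_self[OF bounded_ops_ell2[OF A]] A
             del: of_real_power)
      then have "((\<lambda>m. (l2norm (mop M m (?t G)))\<^sup>2) has_sum (l2norm (?t G))\<^sup>2) (outcomes M)"
        by (simp only: has_sum_of_real_iff)
      then have "(\<Sum>m\<in>F. (l2norm (mop M m (?t G)))\<^sup>2) \<le> (l2norm (?t G))\<^sup>2"
        using F by (intro finite_sum_le_has_sum) auto
      also have "\<dots> \<le> (l2norm f)\<^sup>2"
        by (intro power_mono l2norm_truncation_le[OF f]) auto
      finally show ?thesis .
    qed
    \<comment> \<open>Finitely many continuous norms are summed, so the bound for truncations
      persists in the limit.\<close>
    have "((\<lambda>G. \<Sum>m\<in>F. (l2norm (mop M m (?t G)))\<^sup>2) \<longlongrightarrow> (\<Sum>m\<in>F. (l2norm (mop M m f))\<^sup>2))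
        (finite_subsets_at_top UNIV)"
      using F by (intro tendsto_intros bounded_ops_truncation[OF A f]) auto
    then show ?thesis
      by (rule tendsto_upperbound)
         (auto intro!: eventually_finite_subsets_at_top_weakI le)
  qed
  then show ?thesis using A unfolding kraus_family_def X_def[symmetric] by blast
qed

text \<open>A contraction is a Kraus family with one member, so the lifting of Kraus families
  applies.\<close>

lemma lift_contraction:
  assumes v: "valid_system S" and q: "register S qs" and A: "A \<in> bounded_ops (reg_basis S qs)"
    and le: "\<And>g. g \<in> ell2 (reg_basis S qs) \<Longrightarrow> l2norm (A g) \<le> l2norm g"
    and f: "f \<in> ell2 (configs S)"
  shows "l2norm (lift_op S qs A f) \<le> l2norm f"
proof -
  have "(\<Sum>i\<in>F. (l2norm (A g))\<^sup>2) \<le> (l2norm g)\<^sup>2"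
    if "F \<subseteq> {()}" "g \<in> ell2 (reg_basis S qs)" for F g
    using that power_mono[OF le[OF that(2)], of 2] by (cases "F = {}") (auto simp: subset_singleton_iff)
  then have "kraus_family (reg_basis S qs) {()} (\<lambda>_. A)"
    using A by (auto simp: kraus_family_def)
  from kraus_family_lift[OF v q this] have "(l2norm (lift_op S qs A f))\<^sup>2 \<le> (l2norm f)\<^sup>2"
    using f by (auto simp: kraus_family_def dest!: spec[of _ "{()}"])
  then show ?thesis by (simp add: power2_le_iff_abs_le)
qed

section \<open>Norms under unitaries and orthonormal bases\<close>

lemma unitary_norm:
  assumes "unitary X U" "f \<in> ell2 X"
  shows "l2norm (U f) = l2norm f"
proof -
  have U: "U \<in> bounded_ops X" and "(adj X U \<circ> U) f = f"
    using assms by (auto simp: unitary_def id_op_def)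
  then have "cinner (U f) (U f) = cinner f f"
    using assms(2) by (simp flip: cinner_adj_right)
  then have "complex_of_real ((l2norm (U f))\<^sup>2) = of_real ((l2norm f)\<^sup>2)"
    using U assms(2) by (simp add: cinner_self[of _ X] del: of_real_power)
  then have "(l2norm (U f))\<^sup>2 = (l2norm f)\<^sup>2" by (simp only: of_real_eq_iff)
  then show ?thesis by (simp add: power2_eq_iff_nonneg)
qed

lemma onb_norm:
  assumes "onb X I \<psi>" "i \<in> I" shows "\<psi> i \<in> ell2 X" "l2norm (\<psi> i) = 1"
proof -
  show e: "\<psi> i \<in> ell2 X" using assms by (auto simp: onb_def)
  have "cinner (\<psi> i) (\<psi> i) = 1" using assms by (simp add: onb_def)
  then have "(l2norm (\<psi> i))\<^sup>2 = 1" unfolding cinner_self[OF e] by (simp only: of_real_eq_1_iff)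
  then show "l2norm (\<psi> i) = 1"
    using l2norm_nonneg[of "\<psi> i"] by (simp add: power2_eq_1_iff)
qed

lemma l2norm_ketbra:
  assumes "f \<in> ell2 X"
  shows "l2norm (ketbra X \<psi> \<phi> f) = cmod (cinner \<phi> f) * l2norm \<psi>"
proof -
  have "ketbra X \<psi> \<phi> f = (\<lambda>x. cinner \<phi> f * \<psi> x)" using assms by (auto simp: ketbra_def)
  then show ?thesis by (simp only: l2norm_scale)
qed

text \<open>\<open>onb\<close> states completeness as a trivial orthogonal complement. The
  difference between \<open>f\<close> and its expansion is orthogonal to the basis, hence zero;
  pairing the expansion with \<open>f\<close> gives the identity.\<close>

lemma onb_parseval:
  assumes b: "onb X I \<psi>" and I: "finite I" and f: "f \<in> ell2 X"
  shows "(\<Sum>i\<in>I. (l2norm (ketbra X (\<psi> i) (\<psi> i) f))\<^sup>2) = (l2norm f)\<^sup>2"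
proof -
  define g where "g = (\<lambda>x. \<Sum>i\<in>I. cinner (\<psi> i) f * \<psi> i x)"
  note e = onb_norm[OF b]
  have g: "g \<in> ell2 X" unfolding g_def by (intro ell2_sum ell2_scale e)
  have cg: "cinner h g = (\<Sum>i\<in>I. cinner (\<psi> i) f * cinner h (\<psi> i))" if h: "h \<in> ell2 X" for h
    unfolding g_def using h by (subst cinner_sum_right[of _ X]) (auto simp: e cinner_scale_right)
  have "cinner (\<psi> j) (\<lambda>x. f x - g x) = 0" if j: "j \<in> I" for j
  proof -
    have "cinner (\<psi> j) g = (\<Sum>i\<in>I. cinner (\<psi> i) f * (if i = j then 1 else 0))"
      unfolding cg[OF e(1)[OF j]] using b j by (intro sum.cong) (auto simp: onb_def)
    also have "\<dots> = cinner (\<psi> j) f" using I j by (simp add: if_distrib cong: if_cong)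
    finally show ?thesis by (simp add: cinner_diff_right[OF e(1)[OF j] f g])
  qed
  moreover have "(\<lambda>x. f x - g x) \<in> ell2 X" using f g by simp
  ultimately have "(\<lambda>x. f x - g x) = (\<lambda>_. 0)" using b by (simp add: onb_def)
  then have "f = g" by (simp add: fun_eq_iff)
  then have "complex_of_real ((l2norm f)\<^sup>2) = cinner f g"
    using cinner_self[OF f] by simp
  also have "\<dots> = (\<Sum>i\<in>I. of_real ((cmod (cinner (\<psi> i) f))\<^sup>2))"
    unfolding cg[OF f] complex_norm_square by (simp only: cinner_commute[of f])
  finally have "complex_of_real ((l2norm f)\<^sup>2) = of_real (\<Sum>i\<in>I. (cmod (cinner (\<psi> i) f))\<^sup>2)"
    by (simp only: of_real_sum)
  then have "(l2norm f)\<^sup>2 = (\<Sum>i\<in>I. (cmod (cinner (\<psi> i) f))\<^sup>2)" by (simp only: of_real_eq_iff)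
  then show ?thesis by (simp add: l2norm_ketbra[OF f] e)
qed

lemma ketbra_comp:
  assumes "\<psi> \<in> ell2 X"
  shows "ketbra X \<eta> \<xi> \<circ> ketbra X \<psi> \<phi> = (\<lambda>f x. cinner \<xi> \<psi> * ketbra X \<eta> \<phi> f x)"
proof
  fix f
  show "(ketbra X \<eta> \<xi> \<circ> ketbra X \<psi> \<phi>) f = (\<lambda>x. cinner \<xi> \<psi> * ketbra X \<eta> \<phi> f x)"
  proof (cases "f \<in> ell2 X")
    case True
    have e: "ketbra X \<psi> \<phi> f = (\<lambda>x. cinner \<phi> f * \<psi> x)" using True by (auto simp: ketbra_def)
    have "ketbra X \<eta> \<xi> (\<lambda>x. cinner \<phi> f * \<psi> x) = (\<lambda>x. \<eta> x * (cinner \<phi> f * cinner \<xi> \<psi>))"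
      using ell2_scale[OF assms] by (simp add: ketbra_def cinner_scale_right)
    then show ?thesis using True e by (auto simp: ketbra_def[of X \<eta> \<phi>])
  qed (simp add: ketbra_def)
qed

lemma bounded_ops_contraction_sum:
  assumes A: "\<And>i. i \<in> I \<Longrightarrow> A i \<in> bounded_ops X"
    and le: "\<And>f. f \<in> ell2 X \<Longrightarrow> l2norm (\<lambda>x. \<Sum>i\<in>I. A i f x) \<le> l2norm f"
  shows "(\<lambda>f x. \<Sum>i\<in>I. A i f x) \<in> bounded_ops X"
proof (rule bounded_opsI[where K = 1])
  fix f g assume "f \<in> ell2 X" "g \<in> ell2 X"
  then show "(\<lambda>x. \<Sum>i\<in>I. A i (\<lambda>x. f x + g x) x) = (\<lambda>x. (\<Sum>i\<in>I. A i f x) + (\<Sum>i\<in>I. A i g x))"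
    by (simp add: bounded_ops_add[OF A] flip: sum.distrib)
next
  fix f c assume "f \<in> ell2 X"
  then show "(\<lambda>x. \<Sum>i\<in>I. A i (\<lambda>x. c * f x) x) = (\<lambda>x. c * (\<Sum>i\<in>I. A i f x))"
    by (simp add: bounded_ops_scale[OF A] sum_distrib_left)
next
  fix f assume "f \<notin> ell2 X"
  then show "(\<lambda>x. \<Sum>i\<in>I. A i f x) = (\<lambda>_. 0)"
    by (simp add: bounded_ops_outside[OF A])
qed (use le in \<open>auto intro!: ell2_sum bounded_ops_ell2[OF A]\<close>)

text \<open>
  The branches of a \<open>qif\<close> commute with the projections on the control register since they act
  on other variables; this makes the sum of the branches a contraction.
\<close>

lemma csem_contraction_commute:
  assumes v: "valid_system S" and "wf_circ S C"
  shows "csem S C \<in> bounded_ops (configs S) \<and>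
    (\<forall>f\<in>ell2 (configs S). l2norm (csem S C f) \<le> l2norm f) \<and>
    (\<forall>qs A. register S qs \<longrightarrow> A \<in> bounded_ops (reg_basis S qs) \<longrightarrow> set qs \<inter> cvars C = {} \<longrightarrow>
      lift_op S qs A \<circ> csem S C = csem S C \<circ> lift_op S qs A)"
  using assms(2)
proof (induction C)
  case CSkip
  have "lift_op S qs A \<circ> id_op (configs S) = id_op (configs S) \<circ> lift_op S qs A"
    if "register S qs" "A \<in> bounded_ops (reg_basis S qs)" for qs A
  proof
    fix f
    note L = lift_op_bounded[OF v that]
    show "(lift_op S qs A \<circ> id_op (configs S)) f = (id_op (configs S) \<circ> lift_op S qs A) f"
      using bounded_ops_ell2[OF L, of f] bounded_ops_zero[OF L]
      by (cases "f \<in> ell2 (configs S)") (auto simp: id_op_def lift_op_outside)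
  qed
  moreover have "l2norm (id_op (configs S) f) \<le> l2norm f" if "f \<in> ell2 (configs S)" for f
    using that by (simp add: id_op_def)
  ultimately show ?case unfolding csem.simps using id_op_bounded by blast
next
  case (Gate U rs)
  then have r: "register S rs" and U: "unitary (reg_basis S rs) U" by auto
  have B: "U \<in> bounded_ops (reg_basis S rs)" using U by (simp add: unitary_def)
  show ?case
    using lift_op_bounded[OF v r B] lift_contraction[OF v r B] unitary_norm[OF U]
      lift_op_commute[OF v _ r _ _ B]
    by auto
next
  case (CSeq C D)
  then have C: "csem S C \<in> bounded_ops (configs S)" "csem S D \<in> bounded_ops (configs S)" by auto
  have "l2norm ((csem S D \<circ> csem S C) f) \<le> l2norm f" if "f \<in> ell2 (configs S)" for f
  proof -
    have "l2norm (csem S D (csem S C f)) \<le> l2norm (csem S C f)" using CSeq C by auto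
    also have "\<dots> \<le> l2norm f" using CSeq that by auto
    finally show ?thesis by simp
  qed
  moreover have "lift_op S qs A \<circ> (csem S D \<circ> csem S C) = csem S D \<circ> csem S C \<circ> lift_op S qs A"
    if "register S qs" "A \<in> bounded_ops (reg_basis S qs)" "set qs \<inter> (cvars C \<union> cvars D) = {}" for qs A
  proof -
    have "lift_op S qs A \<circ> csem S C = csem S C \<circ> lift_op S qs A"
      "lift_op S qs A \<circ> csem S D = csem S D \<circ> lift_op S qs A"
      using CSeq.IH CSeq.prems that unfolding wf_circ.simps by blast+
    then show ?thesis by (metis comp_assoc)
  qed
  ultimately show ?case
    unfolding csem.simps cvars.simps using bounded_ops_comp[OF C(2) C(1)] by blast
next
  case (Qif rs d \<psi> C)
  let ?I = "{1..d}" and ?X = "configs S" and ?R = "reg_basis S rs"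
  define P where "P i = ketbra ?R (\<psi> i) (\<psi> i)" for i
  define E where "E i = lift_op S rs (P i)" for i
  from Qif.prems have r: "register S rs" and b: "onb ?R ?I \<psi>" by auto
  have disj: "set rs \<inter> cvars (C i) = {}" if "i \<in> ?I" for i using Qif.prems that by auto
  have wf: "wf_circ S (C i)" if "i \<in> ?I" for i using Qif.prems that by auto
  \<comment> \<open>Branches form a function, so the induction hypothesis ranges over its image.
    Commutation is assumed for every register disjoint from a branch: it is applied to the control
    register here and to \<open>qs\<close> in the commutation part.\<close>
  have C: "csem S (C i) \<in> bounded_ops ?X"
    "\<And>f. f \<in> ell2 ?X \<Longrightarrow> l2norm (csem S (C i) f) \<le> l2norm f"
    "\<And>qs A. register S qs \<Longrightarrow> A \<in> bounded_ops (reg_basis S qs) \<Longrightarrow> set qs \<inter> cvars (C i) = {} \<Longrightarrow>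
      lift_op S qs A \<circ> csem S (C i) = csem S (C i) \<circ> lift_op S qs A" if "i \<in> ?I" for i
    using Qif.IH[OF rangeI, of i] wf[OF that] by blast+
  have P: "P i \<in> bounded_ops ?R" if "i \<in> ?I" for i
    unfolding P_def using onb_norm[OF b that] by (intro ketbra_bounded) auto
  have E: "E i \<in> bounded_ops ?X" if "i \<in> ?I" for i
    unfolding E_def by (rule lift_op_bounded[OF v r P[OF that]])
  have EC: "E i \<circ> csem S (C i) = csem S (C i) \<circ> E i" if "i \<in> ?I" for i
    unfolding E_def by (rule C(3)[OF that r P[OF that] disj[OF that]])
  have PP: "P j \<circ> P i = (if i = j then P j else zero_op)" if "i \<in> ?I" "j \<in> ?I" for i j
  proof -
    have "cinner (\<psi> j) (\<psi> i) = (if i = j then 1 else 0)" using b that by (auto simp: onb_def)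
    then show ?thesis
      unfolding P_def using ketbra_comp[OF onb_norm(1)[OF b that(1)], of "\<psi> j" "\<psi> j" "\<psi> i"]
      by (auto simp: zero_op_def)
  qed
  have EE: "E j (E i f) = (if i = j then E j f else (\<lambda>_. 0))" if ij: "i \<in> ?I" "j \<in> ?I" for i j f
  proof -
    have "E j \<circ> E i = lift_op S rs (P j \<circ> P i)"
      unfolding E_def by (intro lift_op_comp v r P ij bounded_ops_zero[OF P])
    then have "E j (E i f) = lift_op S rs (P j \<circ> P i) f" by (metis comp_apply)
    then show ?thesis unfolding PP[OF ij] by (auto simp: E_def fun_eq_iff)
  qed
  have parseval: "(\<Sum>i\<in>?I. (l2norm (E i f))\<^sup>2) = (l2norm f)\<^sup>2" if f: "f \<in> ell2 ?X" for f
  proof -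
    have "((\<lambda>q. \<Sum>i\<in>?I. (l2norm (P i (slice S rs f q)))\<^sup>2) has_sum (l2norm f)\<^sup>2) (rest_configs S rs)"
      unfolding P_def onb_parseval[OF b finite_atLeastAtMost slice_ell2[OF r f]]
      by (rule slice_l2norm[OF v r f])
    from has_sum_unique[OF lift_op_norm_sum[OF v r P f] this] show ?thesis
      unfolding E_def by blast
  qed
  define B where "B = (\<lambda>f x. \<Sum>i\<in>?I. (E i \<circ> csem S (C i)) f x)"
  have BS: "csem S (Qif rs d \<psi> C) = B" by (simp add: B_def E_def P_def op_sum_def)
  have bd: "E i \<circ> csem S (C i) \<in> bounded_ops ?X" if "i \<in> ?I" for i
    using that by (intro bounded_ops_comp E C)
  have le: "l2norm (B f) \<le> l2norm f" if f: "f \<in> ell2 ?X" for f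
  proof -
    have Bf: "B f \<in> ell2 ?X" unfolding B_def by (intro ell2_sum bounded_ops_ell2[OF bd])
    \<comment> \<open>Orthogonality of the projections selects branch \<open>j\<close>, and
      commutation makes that branch act on the component \<open>E j f\<close>. Parseval for
      \<open>B f\<close> and for \<open>f\<close> then reduces contractivity to that of the
      branches.\<close>
    have "E j (B f) = csem S (C j) (E j f)" if j: "j \<in> ?I" for j
    proof -
      have "E j (B f) = (\<lambda>x. \<Sum>i\<in>?I. E j ((E i \<circ> csem S (C i)) f) x)"
        unfolding B_def by (rule bounded_ops_sum[OF E[OF j]]) (rule bounded_ops_ell2[OF bd])
      also have "\<dots> = (\<lambda>x. \<Sum>i\<in>?I. if i = j then E j (csem S (C j) f) x else 0)"
        using j by (intro ext sum.cong) (auto simp: EE)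
      also have "\<dots> = E j (csem S (C j) f)" using j by simp
      finally show ?thesis using EC[OF j] by (metis comp_apply)
    qed
    then have "(l2norm (B f))\<^sup>2 = (\<Sum>j\<in>?I. (l2norm (csem S (C j) (E j f)))\<^sup>2)"
      unfolding parseval[OF Bf, symmetric] by (intro sum.cong) auto
    also have "\<dots> \<le> (\<Sum>j\<in>?I. (l2norm (E j f))\<^sup>2)"
      by (intro sum_mono power_mono C(2) bounded_ops_ell2[OF E]) auto
    also have "\<dots> = (l2norm f)\<^sup>2" by (rule parseval[OF f])
    finally show ?thesis by (simp add: power2_le_iff_abs_le)
  qed
  have "B \<in> bounded_ops ?X"
    unfolding B_def by (rule bounded_ops_contraction_sum[OF bd]) (use le in \<open>auto simp: B_def\<close>)
  moreover have "lift_op S qs A \<circ> B = B \<circ> lift_op S qs A"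
    if q: "register S qs" and A: "A \<in> bounded_ops (reg_basis S qs)"
      and d: "set qs \<inter> cvars (Qif rs d \<psi> C) = {}" for qs A
  proof
    fix f
    note L = lift_op_bounded[OF v q A]
    have d': "set qs \<inter> set rs = {}" "i \<in> ?I \<Longrightarrow> set qs \<inter> cvars (C i) = {}" for i
      using d by auto
    have c: "lift_op S qs A ((E i \<circ> csem S (C i)) f) = (E i \<circ> csem S (C i)) (lift_op S qs A f)"
      if i: "i \<in> ?I" for i
    proof -
      have "lift_op S qs A \<circ> E i = E i \<circ> lift_op S qs A"
        unfolding E_def by (rule lift_op_commute[OF v q r d'(1) A P[OF i]])
      moreover have "lift_op S qs A \<circ> csem S (C i) = csem S (C i) \<circ> lift_op S qs A"
        by (rule C(3)[OF i q A d'(2)[OF i]])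
      ultimately show ?thesis by (metis comp_apply)
    qed
    have "lift_op S qs A (B f) = (\<lambda>x. \<Sum>i\<in>?I. lift_op S qs A ((E i \<circ> csem S (C i)) f) x)"
      unfolding B_def by (rule bounded_ops_sum[OF L]) (rule bounded_ops_ell2[OF bd])
    also have "\<dots> = B (lift_op S qs A f)"
      unfolding B_def by (intro ext sum.cong refl) (simp only: c)
    finally show "(lift_op S qs A \<circ> B) f = (B \<circ> lift_op S qs A) f" by simp
  qed
  ultimately show ?case unfolding BS using le by blast
qed

subsection \<open>Programs\<close>

lemma conjugate_eq_sandwich: "conjugate S A = sandwich (configs S) A"
  by (simp add: fun_eq_iff conjugate_def)

lemma quantum_map_id: "quantum_map X (\<lambda>\<rho>. \<rho>)"
  by (simp add: quantum_map_def additive_map_def)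

lemma quantum_map_zero: "quantum_map X (\<lambda>\<rho>. zero_op)"
  by (auto simp: quantum_map_def additive_map_def op_trace_nonneg)

lemma quantum_map_sandwich:
  assumes A: "A \<in> bounded_ops X" and le: "\<And>f. f \<in> ell2 X \<Longrightarrow> l2norm (A f) \<le> l2norm f"
  shows "quantum_map X (sandwich X A)"
proof -
  have "(\<Sum>i\<in>F. (l2norm (A g))\<^sup>2) \<le> (l2norm g)\<^sup>2" if "F \<subseteq> {()}" "g \<in> ell2 X" for F g
    using that power_mono[OF le[OF that(2)], of 2] by (cases "F = {}") (auto simp: subset_singleton_iff)
  then have "kraus_family X {()} (\<lambda>_. A)" using A by (auto simp: kraus_family_def)
  from kraus_trace_le[OF this, of _ "{()}"] show ?thesis
    using additive_map_sandwich[OF A] by (simp add: quantum_map_def)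
qed

lemma kraus_familyD:
  "kraus_family X I A \<Longrightarrow> finite F \<Longrightarrow> F \<subseteq> I \<Longrightarrow> f \<in> ell2 X \<Longrightarrow>
   (\<Sum>i\<in>F. (l2norm (A i f))\<^sup>2) \<le> (l2norm f)\<^sup>2"
  by (simp add: kraus_family_def)

lemma mext_kraus:
  assumes v: "valid_system S" and M: "measurement S M"
  shows "kraus_family (configs S) (outcomes M) (mext S M)"
  using kraus_family_lift[OF v _ measurement_kraus[OF M]] M
  by (simp add: mext_def[abs_def] measurement_def)

text \<open>Trace control belongs to the induction because convergence of an outer sum depends on
  the branches not increasing the trace.\<close>

lemma sem_quantum_map:
  assumes v: "valid_system S" and "wf_prog S P"
  shows "quantum_map (configs S) (sem S P)"
  using assms(2)
proof (induction P)
  case Skip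
  show ?case by (simp add: quantum_map_id)
next
  case Abort
  show ?case unfolding sem.simps by (rule quantum_map_zero)
next
  case (Init qs \<psi>)
  let ?R = "reg_basis S qs"
  from Init have q: "register S qs" and \<psi>: "\<psi> \<in> ell2 ?R" "l2norm \<psi> = 1" by auto
  \<comment> \<open>Since \<psi> has norm 1, operator \<open>n\<close> maps \<open>f\<close> to a
    vector of norm \<open>cmod (f n)\<close>, so the Kraus inequality is the partial-sum bound for
    the norm of \<open>f\<close>.\<close>
  have "kraus_family ?R ?R (\<lambda>n. ketbra ?R \<psi> (ket n))"
    unfolding kraus_family_def
  proof (intro conjI allI impI ballI)
    fix F f assume F: "finite F" "F \<subseteq> ?R" and f: "f \<in> ell2 ?R"
    have "(\<Sum>n\<in>F. (l2norm (ketbra ?R \<psi> (ket n) f))\<^sup>2) = (\<Sum>n\<in>F. (cmod (f n))\<^sup>2)"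
      by (simp add: l2norm_ketbra[OF f] \<psi>)
    also have "\<dots> \<le> (l2norm f)\<^sup>2"
      unfolding l2norm_square using F by (intro finite_sum_le_infsum ell2_summable[OF f]) auto
    finally show "(\<Sum>n\<in>F. (l2norm (ketbra ?R \<psi> (ket n) f))\<^sup>2) \<le> (l2norm f)\<^sup>2" .
  qed (use \<psi> in auto)
  from quantum_map_kraus[OF kraus_family_lift[OF v q this]]
  have "quantum_map (configs S) (\<lambda>\<rho>. op_sum ?R (\<lambda>n.
    sandwich (configs S) (lift_op S qs (ketbra ?R \<psi> (ket n))) \<rho>))" .
  \<comment> \<open>The semantics writes the right factor as an explicit \<open>ketbra\<close>; it
    is the adjoint of the left factor.\<close>
  moreover have "op_sum ?R (\<lambda>n. sandwich (configs S) (lift_op S qs (ketbra ?R \<psi> (ket n))) \<rho>) =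
      sem S (Init qs \<psi>) \<rho>" for \<rho>
    unfolding op_sum_def sem.simps using \<psi>(1)
    by (intro ext infsum_cong) (simp add: lift_op_adj[OF v q] adj_ketbra)
  ultimately show ?case by simp
next
  case (Circ C)
  then have "csem S C \<in> bounded_ops (configs S)"
    "\<And>f. f \<in> ell2 (configs S) \<Longrightarrow> l2norm (csem S C f) \<le> l2norm f"
    using csem_contraction_commute[OF v, of C] by auto
  then have "quantum_map (configs S) (sandwich (configs S) (csem S C))"
    by (rule quantum_map_sandwich)
  then show ?case unfolding sem.simps conjugate_eq_sandwich .
next
  case (Seq P Q)
  then show ?case unfolding sem.simps wf_prog.simps by (blast intro: quantum_map_comp)
next
  case (If M P)
  then have "measurement S M" by simp
  from quantum_map_kraus_branches[OF mext_kraus[OF v this], of "\<lambda>m. sem S (P m)"] If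
  have "quantum_map (configs S) (\<lambda>\<rho>. op_sum (outcomes M) (\<lambda>m. sem S (P m) (sandwich (configs S) (mext S M m) \<rho>)))"
    by auto
  then show ?case by (simp add: conjugate_def)
next
  case (While M P)
  then have M: "measurement S M" "outcomes M = {Val 0, Val 1}"
    by (auto simp: binary_measurement_def)
  note K = mext_kraus[OF v M(1)]
  have "quantum_map (configs S) (\<lambda>\<rho>. op_sum UNIV (\<lambda>n. (sandwich (configs S) (mext S M (Val 0)) \<circ>
      (sem S P \<circ> sandwich (configs S) (mext S M (Val 1))) ^^ n) \<rho>))"
  proof (rule quantum_map_loop)
    fix f assume "f \<in> ell2 (configs S)"
    then have "(\<Sum>m\<in>{Val 0, Val 1}. (l2norm (mext S M m f))\<^sup>2) \<le> (l2norm f)\<^sup>2"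
      using M(2) by (intro kraus_familyD[OF K]) auto
    then show "(l2norm (mext S M (Val 0) f))\<^sup>2 + (l2norm (mext S M (Val 1) f))\<^sup>2 \<le> (l2norm f)\<^sup>2"
      by simp
  qed (use K M(2) While in \<open>auto simp: kraus_family_def\<close>)
  then show ?case unfolding sem.simps conjugate_eq_sandwich .
qed

lemma sem_cond:
  assumes "binary_measurement S M"
  shows "sem S (P \<triangleleft> M \<triangleright> Q) \<rho> =
    op_add (sem S P (sandwich (configs S) (mext S M (Val 0)) \<rho>))
           (sem S Q (sandwich (configs S) (mext S M (Val 1)) \<rho>))"
  using assms by (simp add: cond_def binary_measurement_def op_sum_def op_add_def conjugate_def)

lemma mext_bounded:
  assumes "valid_system S" "binary_measurement S M" "i \<in> {0, 1}"
  shows "mext S M (Val i) \<in> bounded_ops (configs S)"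
  using mext_kraus[OF assms(1), of M] assms
  by (auto simp: binary_measurement_def kraus_family_def)

lemma zero_op_comp: "zero_op \<circ> A = zero_op"
  by (simp add: fun_eq_iff)

text \<open>Both memberships are offered: equivalences of test programs speak about partial
  densities, additivity about the cone containing them.\<close>

lemma prog_equivI:
  assumes "\<And>\<rho>. \<rho> \<in> trace_pos (configs S) \<Longrightarrow> \<rho> \<in> partial_density (configs S) \<Longrightarrow>
    sem S P \<rho> = sem S Q \<rho>"
  shows "P \<simeq>\<^bsub>S\<^esub> Q"
  using assms partial_density_trace_pos by (auto simp: prog_equiv_def)

lemmas op_add_ac = op_add_assoc op_add_commute op_add_left_commute

subsection \<open>Laws of conditionals\<close>

text \<open>The \<open>Abort\<close> branch contributes zero, so a one-sided test is conjugation by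
  a single measurement operator, and the hypotheses write both conjugations by \<open>N\<close> as
  sums over the two nested paths. Additivity of \<open>P\<close> and \<open>Q\<close> distributes
  them over these sums.\<close>

lemma cond_reduction:
  assumes v: "valid_system S" and P: "wf_prog S P" and Q: "wf_prog S Q"
    and K: "binary_measurement S K" and L: "binary_measurement S L"
    and M: "binary_measurement S M" and N: "binary_measurement S N"
    and one: "test_one N \<simeq>\<^bsub>S\<^esub> (test_one K \<triangleleft> M \<triangleright> test_one L)"
    and zero: "test_zero N \<simeq>\<^bsub>S\<^esub> (test_zero K \<triangleleft> M \<triangleright> test_zero L)"
  shows "((P \<triangleleft> K \<triangleright> Q) \<triangleleft> M \<triangleright> (P \<triangleleft> L \<triangleright> Q)) \<simeq>\<^bsub>S\<^esub> (P \<triangleleft> N \<triangleright> Q)"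
proof (rule prog_equivI)
  fix \<rho> assume T: "\<rho> \<in> trace_pos (configs S)" and \<rho>: "\<rho> \<in> partial_density (configs S)"
  let ?c = "\<lambda>A i. sandwich (configs S) (mext S A (Val i))"
  note sc = sem_cond[OF K] sem_cond[OF L] sem_cond[OF M] sem_cond[OF N]
  have mem: "?c A i \<sigma> \<in> trace_pos (configs S)"
    if "\<sigma> \<in> trace_pos (configs S)" "A \<in> {K, L, M, N}" "i \<in> {0, 1}" for A i \<sigma>
    using that mext_bounded[OF v] K L M N by (intro sandwich_trace_pos) auto
  note add = additive_mapD(2)[OF quantum_map_additive[OF sem_quantum_map[OF v P]]]
    additive_mapD(2)[OF quantum_map_additive[OF sem_quantum_map[OF v Q]]]
  have "?c N 1 \<rho> = op_add (?c K 1 (?c M 0 \<rho>)) (?c L 1 (?c M 1 \<rho>))"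
    using one \<rho> unfolding prog_equiv_def test_one_def by (simp add: sc del: comp_apply)
  moreover have "?c N 0 \<rho> = op_add (?c K 0 (?c M 0 \<rho>)) (?c L 0 (?c M 1 \<rho>))"
    using zero \<rho> unfolding prog_equiv_def test_zero_def by (simp add: sc del: comp_apply)
  ultimately show "sem S ((P \<triangleleft> K \<triangleright> Q) \<triangleleft> M \<triangleright> (P \<triangleleft> L \<triangleright> Q)) \<rho> = sem S (P \<triangleleft> N \<triangleright> Q) \<rho>"
    unfolding sc by (simp only: add mem T insert_iff simp_thms op_add_ac)
qed

text \<open>The premise \<open>split\<close> is common to the general and the projective law.
  Additivity of \<open>R\<close> merges its two copies along it, while commutation gives
  \<open>P\<close> and \<open>Q\<close> the same input on both sides.\<close>

lemma cond_left_distrib: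
  assumes v: "valid_system S" and R: "wf_prog S R"
    and M: "binary_measurement S M" and N: "binary_measurement S N"
    and comm: "commute_L S M N"
    and split: "\<And>\<rho>. \<rho> \<in> partial_density (configs S) \<Longrightarrow>
      sandwich (configs S) (mext S N (Val 0)) \<rho> =
      op_add (sandwich (configs S) (mext S N (Val 0) \<circ> mext S M (Val 0)) \<rho>)
             (sandwich (configs S) (mext S N (Val 0) \<circ> mext S M (Val 1)) \<rho>)"
  shows "(R \<triangleleft> N \<triangleright> (P \<triangleleft> M \<triangleright> Q)) \<simeq>\<^bsub>S\<^esub> ((R \<triangleleft> N \<triangleright> P) \<triangleleft> M \<triangleright> (R \<triangleleft> N \<triangleright> Q))"
proof (rule prog_equivI)
  fix \<rho> assume T: "\<rho> \<in> trace_pos (configs S)" and \<rho>: "\<rho> \<in> partial_density (configs S)"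
  note sc = sem_cond[OF M] sem_cond[OF N]
  have bd: "mext S A (Val i) \<in> bounded_ops (configs S)" if "A \<in> {M, N}" "i \<in> {0, 1}" for A i
    using that mext_bounded[OF v] M N by auto
  have mem: "sandwich (configs S) (mext S A (Val i) \<circ> mext S B (Val j)) \<rho> \<in> trace_pos (configs S)"
    if "A \<in> {M, N}" "B \<in> {M, N}" "i \<in> {0, 1}" "j \<in> {0, 1}" for A B i j
    using that T by (intro sandwich_trace_pos bounded_ops_comp bd)
  note add = additive_mapD(2)[OF quantum_map_additive[OF sem_quantum_map[OF v R]]]
  have c: "mext S N (Val 1) \<circ> mext S M (Val 0) = mext S M (Val 0) \<circ> mext S N (Val 1)"
    "mext S N (Val 1) \<circ> mext S M (Val 1) = mext S M (Val 1) \<circ> mext S N (Val 1)"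
    using comm by (simp_all add: commute_L_def)
  show "sem S (R \<triangleleft> N \<triangleright> (P \<triangleleft> M \<triangleright> Q)) \<rho> = sem S ((R \<triangleleft> N \<triangleright> P) \<triangleleft> M \<triangleright> (R \<triangleleft> N \<triangleright> Q)) \<rho>"
    unfolding sc
    by (simp only: sandwich_comp bd c split[OF \<rho>] add mem insert_iff simp_thms op_add_ac)
qed

text \<open>The mirror image: \<open>R\<close> now sits on outcome 1, so splitting concerns that
  outcome of \<open>N\<close> and commutation the other one.\<close>

lemma cond_right_distrib:
  assumes v: "valid_system S" and R: "wf_prog S R"
    and M: "binary_measurement S M" and N: "binary_measurement S N"
    and comm: "commute_R S M N"
    and split: "\<And>\<rho>. \<rho> \<in> partial_density (configs S) \<Longrightarrow>
      sandwich (configs S) (mext S N (Val 1)) \<rho> =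
      op_add (sandwich (configs S) (mext S N (Val 1) \<circ> mext S M (Val 0)) \<rho>)
             (sandwich (configs S) (mext S N (Val 1) \<circ> mext S M (Val 1)) \<rho>)"
  shows "((P \<triangleleft> M \<triangleright> Q) \<triangleleft> N \<triangleright> R) \<simeq>\<^bsub>S\<^esub> ((P \<triangleleft> N \<triangleright> R) \<triangleleft> M \<triangleright> (Q \<triangleleft> N \<triangleright> R))"
proof (rule prog_equivI)
  fix \<rho> assume T: "\<rho> \<in> trace_pos (configs S)" and \<rho>: "\<rho> \<in> partial_density (configs S)"
  note sc = sem_cond[OF M] sem_cond[OF N]
  have bd: "mext S A (Val i) \<in> bounded_ops (configs S)" if "A \<in> {M, N}" "i \<in> {0, 1}" for A i
    using that mext_bounded[OF v] M N by auto
  have mem: "sandwich (configs S) (mext S A (Val i) \<circ> mext S B (Val j)) \<rho> \<in> trace_pos (configs S)"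
    if "A \<in> {M, N}" "B \<in> {M, N}" "i \<in> {0, 1}" "j \<in> {0, 1}" for A B i j
    using that T by (intro sandwich_trace_pos bounded_ops_comp bd)
  note add = additive_mapD(2)[OF quantum_map_additive[OF sem_quantum_map[OF v R]]]
  have c: "mext S N (Val 0) \<circ> mext S M (Val 0) = mext S M (Val 0) \<circ> mext S N (Val 0)"
    "mext S N (Val 0) \<circ> mext S M (Val 1) = mext S M (Val 1) \<circ> mext S N (Val 0)"
    using comm by (simp_all add: commute_R_def)
  show "sem S ((P \<triangleleft> M \<triangleright> Q) \<triangleleft> N \<triangleright> R) \<rho> = sem S ((P \<triangleleft> N \<triangleright> R) \<triangleleft> M \<triangleright> (Q \<triangleleft> N \<triangleright> R)) \<rho>"
    unfolding sc
    by (simp only: sandwich_comp bd c split[OF \<rho>] add mem insert_iff simp_thms op_add_ac)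
qed

lemma sandwich_sem_test_any:
  assumes v: "valid_system S" and M: "binary_measurement S M" and A: "A \<in> bounded_ops (configs S)"
    and \<rho>: "\<rho> \<in> trace_pos (configs S)"
  shows "sandwich (configs S) A (sem S (test_any M) \<rho>) =
    op_add (sandwich (configs S) (A \<circ> mext S M (Val 0)) \<rho>)
           (sandwich (configs S) (A \<circ> mext S M (Val 1)) \<rho>)"
proof -
  note bd = mext_bounded[OF v M]
  have "sandwich (configs S) (mext S M (Val i)) \<rho> \<in> bounded_ops (configs S)" if "i \<in> {0, 1}" for i
    by (rule trace_pos_bounded[OF sandwich_trace_pos[OF bd[OF that] \<rho>]])
  then show ?thesis
    unfolding test_any_def sem_cond[OF M] sem.simps
    by (simp only: sandwich_add[OF A] sandwich_comp[OF A bd] insert_iff simp_thms)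
qed

section \<open>Algebra of projective measurements\<close>

lemma projective_adj:
  assumes v: "valid_system S" and M: "binary_measurement S M" and "projective S M" "i \<in> {0, 1}"
  shows "adj (configs S) (mext S M (Val i)) = mext S M (Val i)"
proof -
  have "register S (mreg M)" "mop M (Val i) \<in> bounded_ops (reg_basis S (mreg M))"
    "adj (reg_basis S (mreg M)) (mop M (Val i)) = mop M (Val i)"
    using assms by (auto simp: binary_measurement_def measurement_def projective_def projection_def)
  then show ?thesis by (simp add: mext_def lift_op_adj[OF v])
qed

text \<open>For a projection the product with its adjoint is the projection itself, so completeness
  says that the two operators add up to the identity on each slice.\<close>

lemma projective_complete:
  assumes M: "binary_measurement S M" and p: "projective S M"
    and f: "f \<in> ell2 (configs S)"
  shows "(\<lambda>x. mext S M (Val 0) f x + mext S M (Val 1) f x) = f"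
proof
  fix x
  let ?R = "reg_basis S (mreg M)"
  have q: "register S (mreg M)" using M by (simp add: binary_measurement_def measurement_def)
  show "mext S M (Val 0) f x + mext S M (Val 1) f x = f x"
  proof (cases "x \<in> configs S")
    case x: True
    let ?g = "slice S (mreg M) f x" and ?y = "map x (mreg M)"
    have o: "outcomes M = {Val 0, Val 1}"
      and c: "\<forall>g\<in>ell2 ?R. \<forall>y. ((\<lambda>m. adj ?R (mop M m) (mop M m g) y) has_sum g y) (outcomes M)"
      using M unfolding binary_measurement_def measurement_def by blast+
    have "((\<lambda>m. adj ?R (mop M m) (mop M m ?g) ?y) has_sum ?g ?y) {Val 0, Val 1}"
      using bspec[OF c[unfolded o] slice_ell2[OF q f]] by (rule spec)
    moreover have "adj ?R (mop M m) (mop M m ?g) = mop M m ?g" if "m \<in> {Val 0, Val 1}" for m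
    proof -
      have "adj ?R (mop M m) = mop M m" "mop M m \<circ> mop M m = mop M m"
        using that p M by (auto simp: binary_measurement_def projective_def projection_def)
      then show ?thesis by (metis comp_apply)
    qed
    ultimately have "mop M (Val 0) ?g ?y + mop M (Val 1) ?g ?y = ?g ?y"
      by (simp add: has_sum_finite_iff)
    moreover have "?g ?y = f x"
      using map_config_reg_basis[OF q x] registerD(1)[OF q] by (simp add: slice_def)
    ultimately show ?thesis using x f by (simp add: mext_def lift_op_apply)
  next
    case False
    then show ?thesis using ell2_outside[OF f] by (simp add: mext_def lift_op_outside)
  qed
qed

text \<open>The algebra behind both projective laws: if \<open>B\<close> annihilates the complement
  \<open>A'\<close> of \<open>A\<close>, then \<open>B\<close> lies below \<open>A\<close>, and both
  commute with the complement \<open>B'\<close> of \<open>B\<close>.\<close>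

lemma orthogonal_complement_commute:
  assumes A: "A \<in> bounded_ops X" "A' \<in> bounded_ops X" "adj X A' = A'"
    and B: "B \<in> bounded_ops X" "B' \<in> bounded_ops X" "adj X B = B"
    and AA: "\<And>f. f \<in> ell2 X \<Longrightarrow> (\<lambda>x. A f x + A' f x) = f"
    and BB: "\<And>f. f \<in> ell2 X \<Longrightarrow> (\<lambda>x. B f x + B' f x) = f"
    and BA': "B \<circ> A' = zero_op"
  shows "B \<circ> A = B" "A \<circ> B' = B' \<circ> A" "A' \<circ> B' = B' \<circ> A'"
proof -
  \<comment> \<open>Self-adjointness turns the one-sided annihilation into a two-sided one, from
    which commutation follows.\<close>
  have "A' \<circ> B = adj X (B \<circ> A')" by (simp only: adj_comp[OF B(1) A(2)] A(3) B(3))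
  then have A'B: "A' \<circ> B = zero_op" by (simp only: BA' sandwich_zero)
  have B': "B' f = (\<lambda>x. f x - B f x)" if "f \<in> ell2 X" for f
    using fun_cong[OF BB[OF that]] by (simp add: fun_eq_iff algebra_simps)
  have A_eq: "A f = (\<lambda>x. f x - A' f x)" if "f \<in> ell2 X" for f
    using fun_cong[OF AA[OF that]] by (simp add: fun_eq_iff algebra_simps)
  have z: "B (A' f) = (\<lambda>_. 0)" "A' (B f) = (\<lambda>_. 0)" for f
    using fun_cong[OF BA', of f] fun_cong[OF A'B, of f] by (simp_all add: zero_op_def)
  have BAk: "B (A f) = B f" "A (B f) = B f" if "f \<in> ell2 X" for f
    using that A B by (simp_all add: A_eq bounded_ops_diff[OF B(1)] z)
  show 1: "B \<circ> A = B"
    by (rule bounded_ops_eqI[of _ X]) (simp_all add: A B BAk)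
  show "A \<circ> B' = B' \<circ> A"
    by (rule bounded_ops_eqI[of _ X]) (simp_all add: A B B' BAk bounded_ops_diff[OF A(1)])
  show "A' \<circ> B' = B' \<circ> A'"
    by (rule bounded_ops_eqI[of _ X]) (simp_all add: A B B' z bounded_ops_diff[OF A(2)])
qed

lemma finite_reg_basis: "(\<And>q. q \<in> set qs \<Longrightarrow> is_qubit S q) \<Longrightarrow> finite (reg_basis S qs)"
proof (induction qs)
  case Nil
  then show ?case by (simp add: reg_basis_def)
next
  case (Cons q qs)
  have "reg_basis S (q # qs) = (\<lambda>(b, bs). b # bs) ` (qbasis S q \<times> reg_basis S qs)"
    by (auto simp: reg_basis_def list_all2_Cons2)
  moreover have "finite (qbasis S q)"
    \<comment> \<open>Infinite sets have cardinality 0, so cardinality 2 includes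
      finiteness.\<close>
    using Cons.prems[of q] by (intro card_ge_0_finite) (simp add: is_qubit_def)
  ultimately show ?case using Cons by simp
qed

lemma bij_betw_reg_basis_append:
  "bij_betw (\<lambda>(m, n). m @ n) (reg_basis S qs \<times> reg_basis S rs) (reg_basis S (qs @ rs))"
proof (rule bij_betw_byWitness[where f' = "\<lambda>b. (take (length qs) b, drop (length qs) b)"])
  show "(\<lambda>(m, n). m @ n) ` (reg_basis S qs \<times> reg_basis S rs) \<subseteq> reg_basis S (qs @ rs)"
    by (auto simp: reg_basis_def intro: list_all2_appendI)
qed (auto simp: reg_basis_def list_all2_lengthD list_all2_append2)

lemma sem_if_comp:
  "sem S (if_comp S qs P) \<rho> = op_sum (reg_basis S qs)
     (\<lambda>m. sem S (P m) (sandwich (configs S)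
        (lift_op S qs (ketbra (reg_basis S qs) (ket m) (ket m))) \<rho>))"
proof -
  have "inj_on Basis (reg_basis S qs)" by (simp add: inj_on_def)
  then show ?thesis
    by (simp add: if_comp_def comp_meas_def op_sum_def infsum_reindex mext_def conjugate_def o_def)
qed

text \<open>A configuration carries \<open>m @ n\<close> on the joint register exactly when it
  carries \<open>m\<close> and \<open>n\<close> on the parts, so the projections multiply to the
  joint one. Qubit registers have finite bases, so the sums over outcomes regroup freely.\<close>

lemma if_comp_nested:
  assumes v: "valid_system S" and q: "register S qs" and r: "register S rs"
    and disj: "set qs \<inter> set rs = {}" and qubit: "\<And>q. q \<in> set qs \<union> set rs \<Longrightarrow> is_qubit S q"
  shows "if_comp S qs (\<lambda>m. if_comp S rs (\<lambda>n. PP m n)) \<simeq>\<^bsub>S\<^esub>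
         if_comp S (qs @ rs) (\<lambda>mn. PP (take (length qs) mn) (drop (length qs) mn))"
proof (rule prog_equivI)
  fix \<rho>
  let ?E = "\<lambda>qs m. lift_op S qs (ketbra (reg_basis S qs) (ket m) (ket m))"
  let ?I = "reg_basis S qs" and ?J = "reg_basis S rs"
  have qr: "register S (qs @ rs)" using q r disj by (auto simp: register_def)
  have fin: "finite ?I" "finite ?J" "finite (reg_basis S (qs @ rs))"
    using qubit by (auto intro!: finite_reg_basis)
  have E: "?E rs n \<circ> ?E qs m = ?E (qs @ rs) (m @ n)" if m: "m \<in> ?I" and n: "n \<in> ?J" for m n
  proof
    fix \<psi>
    have mn: "m @ n \<in> reg_basis S (qs @ rs)"
      using m n by (auto simp: reg_basis_def intro: list_all2_appendI)
    have len: "length m = length qs" by (rule reg_basis_length[OF m])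
    \<comment> \<open>Lets the outer projection act by its indicator formula instead of its zero
      default.\<close>
    have "?E qs m \<psi> \<in> ell2 (configs S)"
      using m by (intro bounded_ops_ell2[OF lift_op_bounded[OF v q ketbra_bounded]]) simp_all
    then show "(?E rs n \<circ> ?E qs m) \<psi> = ?E (qs @ rs) (m @ n) \<psi>"
      using len
      by (auto simp: lift_ketbra_ket[OF r n] lift_ketbra_ket[OF q m] lift_ketbra_ket[OF qr mn]
          fun_eq_iff)
  qed
  have EE: "sandwich (configs S) (?E rs n) (sandwich (configs S) (?E qs m) \<rho>) =
      sandwich (configs S) (?E (qs @ rs) (m @ n)) \<rho>" if m: "m \<in> ?I" and n: "n \<in> ?J" for m n
  proof -
    have "?E qs m \<in> bounded_ops (configs S)" "?E rs n \<in> bounded_ops (configs S)"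
      using m n q r v by simp_all
    then show ?thesis by (simp only: sandwich_comp E[OF m n])
  qed
  let ?T = "\<lambda>m n. sem S (PP m n) (sandwich (configs S) (?E (qs @ rs) (m @ n)) \<rho>)"
  have "sem S (if_comp S qs (\<lambda>m. if_comp S rs (\<lambda>n. PP m n))) \<rho> =
      (\<lambda>f x. \<Sum>m\<in>?I. \<Sum>n\<in>?J. ?T m n f x)"
    using fin by (simp add: sem_if_comp op_sum_def EE del: comp_apply)
  also have "\<dots> = (\<lambda>f x. \<Sum>(m, n)\<in>?I \<times> ?J. ?T m n f x)"
    by (simp only: sum.cartesian_product)
  \<comment> \<open>Recovering \<open>m\<close> and \<open>n\<close> from \<open>m @ n\<close> makes
    the summand a function of the concatenated label, as the reindexing requires.\<close>
  also have "\<dots> = (\<lambda>f x. \<Sum>(m, n)\<in>?I \<times> ?J.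
      ?T (take (length qs) (m @ n)) (drop (length qs) (m @ n)) f x)"
    by (intro ext sum.cong) (auto simp: reg_basis_length)
  also have "\<dots> = (\<lambda>f x. \<Sum>b\<in>reg_basis S (qs @ rs). ?T (take (length qs) b) (drop (length qs) b) f x)"
    unfolding sum.reindex_bij_betw[OF bij_betw_reg_basis_append, symmetric]
    by (simp only: case_prod_unfold)
  also have "\<dots> = sem S (if_comp S (qs @ rs) (\<lambda>mn. PP (take (length qs) mn) (drop (length qs) mn))) \<rho>"
    using fin by (simp add: sem_if_comp op_sum_def del: comp_apply)
  finally show "sem S (if_comp S qs (\<lambda>m. if_comp S rs (\<lambda>n. PP m n))) \<rho> =
    sem S (if_comp S (qs @ rs) (\<lambda>mn. PP (take (length qs) mn) (drop (length qs) mn))) \<rho>" .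
qed

lemma mext_meas_compl:
  "mext S (meas_compl M) (Val 0) = mext S M (Val 1)"
  "mext S (meas_compl M) (Val 1) = mext S M (Val 0)"
  by (simp_all add: mext_def meas_compl_def)

text \<open>One product of \<open>N\<close> at outcome 0 with \<open>M\<close> is zero and the other
  equals that operator of \<open>N\<close>, so the split holds with a vanishing term. The two
  alternatives differ by exchanging the outcomes of \<open>M\<close>.\<close>

lemma cond_left_distrib_projective:
  assumes v: "valid_system S" and R: "wf_prog S R"
    and M: "binary_measurement S M" and N: "binary_measurement S N"
    and pM: "projective S M" and pN: "projective S N"
    and impl: "meas_impl S M N \<or> meas_impl S (meas_compl M) N"
  shows "(R \<triangleleft> N \<triangleright> (P \<triangleleft> M \<triangleright> Q)) \<simeq>\<^bsub>S\<^esub> ((R \<triangleleft> N \<triangleright> P) \<triangleleft> M \<triangleright> (R \<triangleleft> N \<triangleright> Q))"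
proof (rule cond_left_distrib[OF v R M N])
  note i0 = insertI1[of "0::nat" "{1}"] and i1 = insertI2[OF singletonI, of "1::nat" "0"]
  note bM = mext_bounded[OF v M i0] mext_bounded[OF v M i1]
  note bN = mext_bounded[OF v N i0] mext_bounded[OF v N i1]
  note aM = projective_adj[OF v M pM i0] projective_adj[OF v M pM i1]
  note aN = projective_adj[OF v N pN i0] projective_adj[OF v N pN i1]
  note cM = projective_complete[OF M pM] and cN = projective_complete[OF N pN]
  have cM': "(\<lambda>x. mext S M (Val 1) f x + mext S M (Val 0) f x) = f" if "f \<in> ell2 (configs S)" for f
    using cM[OF that] by (simp add: add.commute)
  note case0 = orthogonal_complement_commute[OF bM aM(2) bN aN(1) cM cN]
    and case1 = orthogonal_complement_commute[OF bM(2,1) aM(1) bN aN(1) cM' cN]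
  show "commute_L S M N"
    using impl unfolding meas_impl_def mext_meas_compl commute_L_def
    using case0(2,3) case1(2,3) by metis
  fix \<rho>
  have "mext S N (Val 0) \<circ> mext S M (Val 1) = zero_op \<and> mext S N (Val 0) \<circ> mext S M (Val 0) = mext S N (Val 0)
    \<or> mext S N (Val 0) \<circ> mext S M (Val 0) = zero_op \<and> mext S N (Val 0) \<circ> mext S M (Val 1) = mext S N (Val 0)"
    using impl unfolding meas_impl_def mext_meas_compl
    using case0(1) case1(1) by metis
  then show "sandwich (configs S) (mext S N (Val 0)) \<rho> =
      op_add (sandwich (configs S) (mext S N (Val 0) \<circ> mext S M (Val 0)) \<rho>)
             (sandwich (configs S) (mext S N (Val 0) \<circ> mext S M (Val 1)) \<rho>)"
    by (elim disjE conjE) (simp_all only: sandwich_zero zero_op_comp op_add_zero)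
qed

text \<open>The left-hand argument with the outcomes of \<open>N\<close> exchanged. Here the
  hypothesis has the factors in the opposite order, so it is first turned around by
  adjoints.\<close>

lemma cond_right_distrib_projective:
  assumes v: "valid_system S" and R: "wf_prog S R"
    and M: "binary_measurement S M" and N: "binary_measurement S N"
    and pM: "projective S M" and pN: "projective S N"
    and impl: "meas_impl S N M \<or> meas_impl S N (meas_compl M)"
  shows "((P \<triangleleft> M \<triangleright> Q) \<triangleleft> N \<triangleright> R) \<simeq>\<^bsub>S\<^esub> ((P \<triangleleft> N \<triangleright> R) \<triangleleft> M \<triangleright> (Q \<triangleleft> N \<triangleright> R))"
proof (rule cond_right_distrib[OF v R M N])
  note i0 = insertI1[of "0::nat" "{1}"] and i1 = insertI2[OF singletonI, of "1::nat" "0"]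
  note bM = mext_bounded[OF v M i0] mext_bounded[OF v M i1]
  note bN = mext_bounded[OF v N i0] mext_bounded[OF v N i1]
  note aM = projective_adj[OF v M pM i0] projective_adj[OF v M pM i1]
  note aN = projective_adj[OF v N pN i0] projective_adj[OF v N pN i1]
  note cM = projective_complete[OF M pM]
  have cM': "(\<lambda>x. mext S M (Val 1) f x + mext S M (Val 0) f x) = f" if "f \<in> ell2 (configs S)" for f
    using cM[OF that] by (simp add: add.commute)
  have cN: "(\<lambda>x. mext S N (Val 1) f x + mext S N (Val 0) f x) = f" if "f \<in> ell2 (configs S)" for f
    using projective_complete[OF N pN that] by (simp add: add.commute)
  note case0 = orthogonal_complement_commute[OF bM aM(2) bN(2,1) aN(2) cM cN]
    and case1 = orthogonal_complement_commute[OF bM(2,1) aM(1) bN(2,1) aN(2) cM' cN]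
  \<comment> \<open>A product of self-adjoint operators is the adjoint of the reversed product, so
    both vanish together.\<close>
  have flip: "mext S N (Val 1) \<circ> mext S M (Val i) = zero_op"
    if "mext S M (Val i) \<circ> mext S N (Val 1) = zero_op" "i \<in> {0, 1}" for i
  proof -
    have "mext S N (Val 1) \<circ> mext S M (Val i) = adj (configs S) (mext S M (Val i) \<circ> mext S N (Val 1))"
      using that(2) bM bN aM aN by (elim insertE emptyE) (simp_all only: adj_comp)
    then show ?thesis using that(1) by (simp only: sandwich_zero)
  qed
  have impl': "mext S N (Val 1) \<circ> mext S M (Val 0) = zero_op \<or> mext S N (Val 1) \<circ> mext S M (Val 1) = zero_op"
    using impl flip unfolding meas_impl_def mext_meas_compl by blast
  show "commute_R S M N"
    using impl' unfolding commute_R_def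
    using case0(2,3) case1(2,3) by metis
  fix \<rho>
  have "mext S N (Val 1) \<circ> mext S M (Val 1) = zero_op \<and> mext S N (Val 1) \<circ> mext S M (Val 0) = mext S N (Val 1)
    \<or> mext S N (Val 1) \<circ> mext S M (Val 0) = zero_op \<and> mext S N (Val 1) \<circ> mext S M (Val 1) = mext S N (Val 1)"
    using impl'
    using case0(1) case1(1) by metis
  then show "sandwich (configs S) (mext S N (Val 1)) \<rho> =
      op_add (sandwich (configs S) (mext S N (Val 1) \<circ> mext S M (Val 0)) \<rho>)
             (sandwich (configs S) (mext S N (Val 1) \<circ> mext S M (Val 1)) \<rho>)"
    by (elim disjE conjE) (simp_all only: sandwich_zero zero_op_comp op_add_zero)
qed

text \<open>Unfolding the tests turns the equivalence into the splitting premise of the left law: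
  preceding \<open>N\<close> at outcome 0 by a discarded measurement \<open>M\<close> has no
  effect.\<close>

lemma test_zero_split:
  assumes v: "valid_system S" and M: "binary_measurement S M" and N: "binary_measurement S N"
    and eq: "test_zero N \<simeq>\<^bsub>S\<^esub> Seq (test_any M) (test_zero N)"
    and \<rho>: "\<rho> \<in> partial_density (configs S)"
  shows "sandwich (configs S) (mext S N (Val 0)) \<rho> =
      op_add (sandwich (configs S) (mext S N (Val 0) \<circ> mext S M (Val 0)) \<rho>)
             (sandwich (configs S) (mext S N (Val 0) \<circ> mext S M (Val 1)) \<rho>)"
proof -
  have T: "\<rho> \<in> trace_pos (configs S)" using \<rho> partial_density_trace_pos by blast
  have B: "mext S N (Val 0) \<in> bounded_ops (configs S)" by (rule mext_bounded[OF v N]) simp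
  have z: "sem S (test_zero N) \<sigma> = sandwich (configs S) (mext S N (Val 0)) \<sigma>" for \<sigma>
    by (simp only: test_zero_def sem_cond[OF N] sem.simps op_add_zero)
  have "sem S (test_zero N) \<rho> = sem S (test_zero N) (sem S (test_any M) \<rho>)"
    using eq \<rho> by (simp add: prog_equiv_def)
  then show ?thesis
    unfolding z sandwich_sem_test_any[OF v M B T] .
qed

lemma test_one_split:
  assumes v: "valid_system S" and M: "binary_measurement S M" and N: "binary_measurement S N"
    and eq: "test_one N \<simeq>\<^bsub>S\<^esub> Seq (test_any M) (test_one N)"
    and \<rho>: "\<rho> \<in> partial_density (configs S)"
  shows "sandwich (configs S) (mext S N (Val 1)) \<rho> =
      op_add (sandwich (configs S) (mext S N (Val 1) \<circ> mext S M (Val 0)) \<rho>)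
             (sandwich (configs S) (mext S N (Val 1) \<circ> mext S M (Val 1)) \<rho>)"
proof -
  have T: "\<rho> \<in> trace_pos (configs S)" using \<rho> partial_density_trace_pos by blast
  have B: "mext S N (Val 1) \<in> bounded_ops (configs S)" by (rule mext_bounded[OF v N]) simp
  have z: "sem S (test_one N) \<sigma> = sandwich (configs S) (mext S N (Val 1)) \<sigma>" for \<sigma>
    by (simp only: test_one_def sem_cond[OF N] sem.simps op_add_zero)
  have "sem S (test_one N) \<rho> = sem S (test_one N) (sem S (test_any M) \<rho>)"
    using eq \<rho> by (simp add: prog_equiv_def)
  then show ?thesis
    unfolding z sandwich_sem_test_any[OF v M B T] .
qed

theorem proposition5p3:
  fixes S :: "('v, 'b) qsystem"
    and P Q R :: "('v, 'b) prog"
    and PP :: "'b list \<Rightarrow> 'b list \<Rightarrow> ('v, 'b) prog"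
    and K L M N :: "('v, 'b) meas"
    and qs rs :: "'v list"
  assumes "valid_system S"
    and "wf_prog S P" and "wf_prog S Q" and "wf_prog S R"
    and "binary_measurement S K" and "binary_measurement S L"
    and "binary_measurement S M" and "binary_measurement S N"
  shows
    "(test_one N \<simeq>\<^bsub>S\<^esub> (test_one K \<triangleleft> M \<triangleright> test_one L) \<and>
      test_zero N \<simeq>\<^bsub>S\<^esub> (test_zero K \<triangleleft> M \<triangleright> test_zero L)
      \<longrightarrow> ((P \<triangleleft> K \<triangleright> Q) \<triangleleft> M \<triangleright> (P \<triangleleft> L \<triangleright> Q)) \<simeq>\<^bsub>S\<^esub> (P \<triangleleft> N \<triangleright> Q))
     \<and>
     (register S qs \<and> register S rs \<and> set qs \<inter> set rs = {} \<and>
      (\<forall>q\<in>set qs \<union> set rs. is_qubit S q) \<and>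
      (\<forall>m\<in>reg_basis S qs. \<forall>n\<in>reg_basis S rs. wf_prog S (PP m n))
      \<longrightarrow> if_comp S qs (\<lambda>m. if_comp S rs (\<lambda>n. PP m n)) \<simeq>\<^bsub>S\<^esub>
          if_comp S (qs @ rs) (\<lambda>mn. PP (take (length qs) mn) (drop (length qs) mn)))
     \<and>
     (commute_L S M N \<and> test_zero N \<simeq>\<^bsub>S\<^esub> Seq (test_any M) (test_zero N)
      \<longrightarrow> (R \<triangleleft> N \<triangleright> (P \<triangleleft> M \<triangleright> Q)) \<simeq>\<^bsub>S\<^esub> ((R \<triangleleft> N \<triangleright> P) \<triangleleft> M \<triangleright> (R \<triangleleft> N \<triangleright> Q)))
     \<and>
     (commute_R S M N \<and> test_one N \<simeq>\<^bsub>S\<^esub> Seq (test_any M) (test_one N)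
      \<longrightarrow> ((P \<triangleleft> M \<triangleright> Q) \<triangleleft> N \<triangleright> R) \<simeq>\<^bsub>S\<^esub> ((P \<triangleleft> N \<triangleright> R) \<triangleleft> M \<triangleright> (Q \<triangleleft> N \<triangleright> R)))
     \<and>
     (projective S M \<and> projective S N \<and> (meas_impl S M N \<or> meas_impl S (meas_compl M) N)
      \<longrightarrow> (R \<triangleleft> N \<triangleright> (P \<triangleleft> M \<triangleright> Q)) \<simeq>\<^bsub>S\<^esub> ((R \<triangleleft> N \<triangleright> P) \<triangleleft> M \<triangleright> (R \<triangleleft> N \<triangleright> Q)))
     \<and>
     (projective S M \<and> projective S N \<and> (meas_impl S N M \<or> meas_impl S N (meas_compl M))
      \<longrightarrow> ((P \<triangleleft> M \<triangleright> Q) \<triangleleft> N \<triangleright> R) \<simeq>\<^bsub>S\<^esub> ((P \<triangleleft> N \<triangleright> R) \<triangleleft> M \<triangleright> (Q \<triangleleft> N \<triangleright> R)))"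
proof (intro conjI impI; elim conjE)
  note v = assms(1) and K = assms(5) and L = assms(6) and M = assms(7) and N = assms(8)
  show "((P \<triangleleft> K \<triangleright> Q) \<triangleleft> M \<triangleright> (P \<triangleleft> L \<triangleright> Q)) \<simeq>\<^bsub>S\<^esub> (P \<triangleleft> N \<triangleright> Q)"
    if "test_one N \<simeq>\<^bsub>S\<^esub> (test_one K \<triangleleft> M \<triangleright> test_one L)"
      "test_zero N \<simeq>\<^bsub>S\<^esub> (test_zero K \<triangleleft> M \<triangleright> test_zero L)"
    using that by (rule cond_reduction[OF v assms(2,3) K L M N])
  show "if_comp S qs (\<lambda>m. if_comp S rs (\<lambda>n. PP m n)) \<simeq>\<^bsub>S\<^esub>
      if_comp S (qs @ rs) (\<lambda>mn. PP (take (length qs) mn) (drop (length qs) mn))"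
    if "register S qs" "register S rs" "set qs \<inter> set rs = {}" "\<forall>q\<in>set qs \<union> set rs. is_qubit S q"
    by (rule if_comp_nested[OF v that(1-3) bspec[OF that(4)]])
  show "(R \<triangleleft> N \<triangleright> (P \<triangleleft> M \<triangleright> Q)) \<simeq>\<^bsub>S\<^esub> ((R \<triangleleft> N \<triangleright> P) \<triangleleft> M \<triangleright> (R \<triangleleft> N \<triangleright> Q))"
    if "commute_L S M N" "test_zero N \<simeq>\<^bsub>S\<^esub> Seq (test_any M) (test_zero N)"
    by (rule cond_left_distrib[OF v assms(4) M N that(1) test_zero_split[OF v M N that(2)]])
  show "((P \<triangleleft> M \<triangleright> Q) \<triangleleft> N \<triangleright> R) \<simeq>\<^bsub>S\<^esub> ((P \<triangleleft> N \<triangleright> R) \<triangleleft> M \<triangleright> (Q \<triangleleft> N \<triangleright> R))"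
    if "commute_R S M N" "test_one N \<simeq>\<^bsub>S\<^esub> Seq (test_any M) (test_one N)"
    by (rule cond_right_distrib[OF v assms(4) M N that(1) test_one_split[OF v M N that(2)]])
  show "(R \<triangleleft> N \<triangleright> (P \<triangleleft> M \<triangleright> Q)) \<simeq>\<^bsub>S\<^esub> ((R \<triangleleft> N \<triangleright> P) \<triangleleft> M \<triangleright> (R \<triangleleft> N \<triangleright> Q))"
    if "projective S M" "projective S N" "meas_impl S M N \<or> meas_impl S (meas_compl M) N"
    using that by (rule cond_left_distrib_projective[OF v assms(4) M N])
  show "((P \<triangleleft> M \<triangleright> Q) \<triangleleft> N \<triangleright> R) \<simeq>\<^bsub>S\<^esub> ((P \<triangleleft> N \<triangleright> R) \<triangleleft> M \<triangleright> (Q \<triangleleft> N \<triangleright> R))"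
    if "projective S M" "projective S N" "meas_impl S N M \<or> meas_impl S N (meas_compl M)"
    using that by (rule cond_right_distrib_projective[OF v assms(4) M N])
qed

end
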